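(* Let $0<q<1$, $s>0$ and let $N\in\frac12\mathbb Z$, $N>0$. Let $\mathcal H_{N,1}=\mathcal H_N\oplus\mathcal H_{N+1}$, with grading $\gamma$ equal to $+1$ on the first and $-1$ on the second summand, carry the approximate representation $\tilde\pi=\tilde\pi_N\oplus\tilde\pi_{N+1}$ of the Podleś sphere algebra with generators $a=a^*,b,b^*$ and parameter $s$ (defined in the context). Then the densely defined operator $$D_N|l,m\rangle_N=(l-N)|l,m\rangle_{N+1},\qquad D_N|l,m\rangle_{N+1}=(l-N)|l,m\rangle_N$$ (the coefficient being $0$ when $l=N$, where the vector $|l,m\rangle_{N+1}$ does not exist) has bounded commutators with the algebra elements, and satisfies the generalized order-one condition up to compact operators from the ideal $\mathcal K_q$ (as defined in the context). The eigenvalues of $D_N$ are $\pm(l-N)$, $l=N,N+1,\dots$, with multiplicities $2l+1$. Moreover, in comparison to the "classical" twisted Dirac operator (defined in the context), $D_N$ is just a compact perturbation, since $$\sqrt{l-N}\,\sqrt{l+N+1}\sim(l-N)\left(1+\frac{N+\frac12}{l-N}+\cdots\right)$$ for $l-N$ sufficiently big.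
   Context: The (rescaled) Podleś sphere algebra with parameter $s$ is the $*$-algebra generated by $a=a^*,b,b^*$ with relations $ab=q^2ba$, $ab^*=q^{-2}b^*a$, $bb^*+a^2-a=s^2$, $b^*b+q^4a^2-q^2a=s^2$. For $M\in\frac12\mathbb Z$, $\mathcal H_M$ is the Hilbert space with orthonormal basis $|l,m\rangle_M$, $l=|M|,|M|+1,\dots$, $m=-l,-l+1,\dots,l$. The approximate representation $\tilde\pi_M$ on $\mathcal H_M$ is given on generators by the following bounded operators, with the convention that any vector $|l',m'\rangle$ on the right not belonging to the basis (i.e. with $l'<|M|$ or $|m'|>l'$) is replaced by $0$: $$\begin{aligned}\tilde\pi_M(a)|l,m\rangle=&\ s\,q^{l+m}\sqrt{1-q^{2(l+m+1)}}\,|l+1,m\rangle+s\,q^{l+m-1}\sqrt{1-q^{2(l+m)}}\,|l-1,m\rangle+q^{2(l+m)}|l,m\rangle,\\ \tilde\pi_M(b)|l,m\rangle=&\ s\sqrt{1-q^{2(l+m+2)}}\sqrt{1-q^{2(l+m+1)}}\,|l+1,m+1\rangle-s\,q^{2(l+m)+1}|l-1,m+1\rangle+q^{l+m+1}\sqrt{1-q^{2(l+m+1)}}\,|l,m+1\rangle,\\ \tilde\pi_M(b^* )|l,m\rangle=&\ s\sqrt{1-q^{2(l+m)}}\sqrt{1-q^{2(l+m-1)}}\,|l-1,m-1\rangle+q^{l+m}\sqrt{1-q^{2(l+m)}}\,|l,m-1\rangle-s\,q^{2(l+m)+1}|l+1,m-1\rangle.\end{aligned}$$ These satisfy the algebra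 relations modulo $\mathcal K_q$, where $\mathcal K_q$ is the ideal of operators of exponential decay: the two-sided ideal of bounded operators generated by the diagonal operator $|l,m\rangle\mapsto q^l|l,m\rangle$. "Algebra elements" means the operators in the algebra generated by $\tilde\pi(a),\tilde\pi(b),\tilde\pi(b^* )$; commutators with $D_N$ are understood on the algebraic span of the basis vectors. Generalized order-one condition up to $\mathcal K_q$: there exist a Hilbert space $\mathcal H'$ of the same kind (a sum $\mathcal H_M\oplus\mathcal H_{M+1}$ with its approximate representation), an operator $D'$ on $\mathcal H'$ with bounded commutators with the algebra elements, and an antiunitary $J$ on $\mathcal H_{N,1}\oplus\mathcal H'$ with $J^2=\pm1$ and $J(D_N\oplus D')=(D_N\oplus D')J$, such that, with $\tilde\pi$ denoting also the approximate representation on $\mathcal H_{N,1}\oplus\mathcal H'$, for all generators $x,y\in\{a,b,b^*\}$ both $[J\tilde\pi(x)J^{-1},\tilde\pi(y)]$ and $[J\tilde\pi(x)J^{-1},[D_N\oplus D',\tilde\pi(y)]]$ belong to $\mathcal K_q$. The "classical" twisted Dirac operator is the operator on $\mathcal H_{N,1}$ exchanging $|l,m\rangle_N$ and $|l,m\rangle_{N+1}$ with coefficient $\sqrt{l-N}\,\sqrt{l+N+1}$ in place of $l-N$.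
   Formalization: "Compact perturbation" is read as: the difference of D_N and the classical operator is relatively compact, and D_cl = D_N(1+K) with K compact; the literal difference is not compact, since its coefficients tend to -(N+1/2). *)

theory Defs
  imports
    "HOL-Analysis.Analysis"
    "HOL-Library.Function_Algebras"
    "HOL-Library.Landau_Symbols"
begin

section \<open>The Hilbert spaces \<open>\<ell>\<^sup>2(I)\<close> and their operators\<close>

text \<open>
  A Hilbert space with orthonormal basis indexed by a set \<open>I\<close> is the set of square-summable
  coefficient families supported in \<open>I\<close>.  The Hilbert spaces below depend on a half-integer
  that is quantified inside the statement, so they are carrier sets and not types.  Operators
  are functions on coefficient families; only their values on the carrier (or on the domain)
  are relevant.
\<close>

type_synonym 'i vec = "'i \<Rightarrow> complex"
type_synonym 'i oper = "'i vec \<Rightarrow> 'i vec"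

definition scale :: "complex \<Rightarrow> 'i vec \<Rightarrow> 'i vec" where
  "scale c \<psi> = (\<lambda>i. c * \<psi> i)"

global_interpretation cvec: vector_space "scale :: complex \<Rightarrow> 'i vec \<Rightarrow> 'i vec"
  defines cvec_subspace = cvec.subspace
    and cvec_span = cvec.span
    and cvec_dim = cvec.dim
  by unfold_locales (auto simp: scale_def algebra_simps)

definition l2 :: "'i set \<Rightarrow> 'i vec set" where
  "l2 I = {\<psi>. (\<forall>i. i \<notin> I \<longrightarrow> \<psi> i = 0) \<and> (\<lambda>i. (cmod (\<psi> i))\<^sup>2) summable_on UNIV}"

definition l2norm :: "'i vec \<Rightarrow> real" where
  "l2norm \<psi> = sqrt (\<Sum>\<^sub>\<infinity>i. (cmod (\<psi> i))\<^sup>2)"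

definition l2inner :: "'i vec \<Rightarrow> 'i vec \<Rightarrow> complex" where
  "l2inner \<phi> \<psi> = (\<Sum>\<^sub>\<infinity>i. cnj (\<phi> i) * \<psi> i)"

text \<open>A basis vector whose label does not belong to the index set is replaced by zero.\<close>

definition ket :: "'i set \<Rightarrow> 'i \<Rightarrow> 'i vec" where
  "ket I i = (\<lambda>j. if i \<in> I \<and> j = i then 1 else 0)"

definition alg_span :: "'i set \<Rightarrow> 'i vec set" where
  "alg_span I = cvec_span (ket I ` I)"

text \<open>
  The operator with \<open>|i\<rangle> \<mapsto> A i\<close>.  For all \<open>A\<close> used here only finitely many
  \<open>i\<close> contribute to each component, so that the sum is finite.
\<close>

definition from_kets :: "'i set \<Rightarrow> ('i \<Rightarrow> 'i vec) \<Rightarrow> 'i oper" where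
  "from_kets I A \<psi> = (\<lambda>j. \<Sum>\<^sub>\<infinity>i\<in>I. \<psi> i * A i j)"

definition linear_on_subspace :: "'i vec set \<Rightarrow> 'i oper \<Rightarrow> bool" where
  "linear_on_subspace V T \<longleftrightarrow>
     (\<forall>\<phi>\<in>V. \<forall>\<psi>\<in>V. T (\<phi> + \<psi>) = T \<phi> + T \<psi>) \<and> (\<forall>c. \<forall>\<psi>\<in>V. T (scale c \<psi>) = scale c (T \<psi>))"

definition bounded_ops :: "'i set \<Rightarrow> 'i oper set" where
  "bounded_ops I = {T. (\<forall>\<psi>\<in>l2 I. T \<psi> \<in> l2 I) \<and> linear_on_subspace (l2 I) T \<and>
                       (\<exists>C. \<forall>\<psi>\<in>l2 I. l2norm (T \<psi>) \<le> C * l2norm \<psi>)}"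

definition norm_convergent :: "'i set \<Rightarrow> (nat \<Rightarrow> 'i vec) \<Rightarrow> bool" where
  "norm_convergent I v \<longleftrightarrow> (\<exists>\<phi>\<in>l2 I. (\<lambda>n. l2norm (v n - \<phi>)) \<longlonglongrightarrow> 0)"

definition compact_ops :: "'i set \<Rightarrow> 'i oper set" where
  "compact_ops I = {T \<in> bounded_ops I.
     \<forall>u C. (\<forall>n::nat. u n \<in> l2 I \<and> l2norm (u n) \<le> C) \<longrightarrow>
       (\<exists>r::nat \<Rightarrow> nat. strict_mono r \<and> norm_convergent I (\<lambda>n. T (u (r n))))}"

definition comm :: "'i oper \<Rightarrow> 'i oper \<Rightarrow> 'i oper" where
  "comm S T = (\<lambda>\<psi>. S (T \<psi>) - T (S \<psi>))"

text \<open>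
  The two-sided ideal of the algebra of bounded operators generated by \<open>Q\<close>; rule \<open>cong\<close>
  only identifies functions that represent the same operator on \<open>\<ell>\<^sup>2(I)\<close>.
\<close>

inductive_set op_ideal :: "'i set \<Rightarrow> 'i oper \<Rightarrow> 'i oper set" for I Q where
  gen: "Q \<in> op_ideal I Q"
| add: "S \<in> op_ideal I Q \<Longrightarrow> T \<in> op_ideal I Q \<Longrightarrow> (\<lambda>\<psi>. S \<psi> + T \<psi>) \<in> op_ideal I Q"
| left: "A \<in> bounded_ops I \<Longrightarrow> T \<in> op_ideal I Q \<Longrightarrow> A \<circ> T \<in> op_ideal I Q"
| right: "A \<in> bounded_ops I \<Longrightarrow> T \<in> op_ideal I Q \<Longrightarrow> T \<circ> A \<in> op_ideal I Q"
| cong: "T \<in> op_ideal I Q \<Longrightarrow> (\<And>\<psi>. \<psi> \<in> l2 I \<Longrightarrow> S \<psi> = T \<psi>) \<Longrightarrow> S \<in> op_ideal I Q"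

text \<open>The unital algebra generated by a set of operators.\<close>

inductive_set op_algebra :: "'i oper set \<Rightarrow> 'i oper set" for G where
  gen: "x \<in> G \<Longrightarrow> x \<in> op_algebra G"
| one: "id \<in> op_algebra G"
| add: "x \<in> op_algebra G \<Longrightarrow> y \<in> op_algebra G \<Longrightarrow> (\<lambda>\<psi>. x \<psi> + y \<psi>) \<in> op_algebra G"
| scale: "x \<in> op_algebra G \<Longrightarrow> (\<lambda>\<psi>. scale c (x \<psi>)) \<in> op_algebra G"
| mult: "x \<in> op_algebra G \<Longrightarrow> y \<in> op_algebra G \<Longrightarrow> x \<circ> y \<in> op_algebra G"

definition antiunitary :: "'i set \<Rightarrow> 'i oper \<Rightarrow> bool" where
  "antiunitary I J \<longleftrightarrow>
     J ` l2 I = l2 I \<and>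
     (\<forall>\<phi>\<in>l2 I. \<forall>\<psi>\<in>l2 I. J (\<phi> + \<psi>) = J \<phi> + J \<psi>) \<and>
     (\<forall>c. \<forall>\<psi>\<in>l2 I. J (scale c \<psi>) = scale (cnj c) (J \<psi>)) \<and>
     (\<forall>\<phi>\<in>l2 I. \<forall>\<psi>\<in>l2 I. l2inner (J \<phi>) (J \<psi>) = l2inner \<psi> \<phi>)"

definition conj_by :: "'i set \<Rightarrow> 'i oper \<Rightarrow> 'i oper \<Rightarrow> 'i oper" where
  "conj_by I J x = J \<circ> x \<circ> inv_into (l2 I) J"

text \<open>
  The direct sum \<open>\<ell>\<^sup>2(I) \<oplus> \<ell>\<^sup>2(I')\<close> is \<open>\<ell>\<^sup>2\<close> of the disjoint union \<open>I <+> I'\<close>.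
\<close>

definition dsum :: "'i oper \<Rightarrow> 'j oper \<Rightarrow> ('i + 'j) oper" where
  "dsum S T \<psi> = case_sum (S (\<psi> \<circ> Inl)) (T (\<psi> \<circ> Inr))"


section \<open>Unbounded operators\<close>

text \<open>A pair consisting of a domain and a function.\<close>

type_synonym 'i uop = "'i vec set \<times> 'i oper"

text \<open>
  The domain contains the algebraic span of the basis; in particular the operator is densely
  defined.
\<close>

definition unbounded_op :: "'i set \<Rightarrow> 'i uop \<Rightarrow> bool" where
  "unbounded_op I D \<longleftrightarrow>
     cvec_subspace (fst D) \<and> alg_span I \<subseteq> fst D \<and> fst D \<subseteq> l2 I \<and>
     (\<forall>\<psi>\<in>fst D. snd D \<psi> \<in> l2 I) \<and> linear_on_subspace (fst D) (snd D)"

text \<open>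
  The operator \<open>T\<close> on its maximal domain.  For the weighted permutations of the basis used
  below this is the closure of its restriction to the algebraic span.
\<close>

definition maximal_op :: "'i set \<Rightarrow> 'i oper \<Rightarrow> 'i uop" where
  "maximal_op I T = ({\<psi> \<in> l2 I. T \<psi> \<in> l2 I}, T)"

definition uop_dsum :: "'i uop \<Rightarrow> 'j uop \<Rightarrow> ('i + 'j) uop" where
  "uop_dsum D D' = ({\<psi>. \<psi> \<circ> Inl \<in> fst D \<and> \<psi> \<circ> Inr \<in> fst D'}, dsum (snd D) (snd D'))"

text \<open>Equality of unbounded operators \<open>JD = DJ\<close>, domains included.\<close>

definition uop_commutes :: "'i set \<Rightarrow> 'i oper \<Rightarrow> 'i uop \<Rightarrow> bool" where
  "uop_commutes I J D \<longleftrightarrow>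
     (\<forall>\<psi>\<in>l2 I. \<psi> \<in> fst D \<longleftrightarrow> J \<psi> \<in> fst D) \<and> (\<forall>\<psi>\<in>fst D. J (snd D \<psi>) = snd D (J \<psi>))"

text \<open>
  \<open>C\<close> is the bounded operator that extends the commutator of \<open>D\<close> and \<open>x\<close> on the algebraic
  span of the basis; it is unique as an operator on \<open>\<ell>\<^sup>2(I)\<close>.
\<close>

definition is_bounded_comm :: "'i set \<Rightarrow> 'i uop \<Rightarrow> 'i oper \<Rightarrow> 'i oper \<Rightarrow> bool" where
  "is_bounded_comm I D x C \<longleftrightarrow>
     C \<in> bounded_ops I \<and>
     (\<forall>\<psi>\<in>alg_span I. x \<psi> \<in> fst D \<and> C \<psi> = snd D (x \<psi>) - x (snd D \<psi>))"

definition eigenspace :: "'i uop \<Rightarrow> complex \<Rightarrow> 'i vec set" where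
  "eigenspace D \<mu> = {\<psi> \<in> fst D. snd D \<psi> = scale \<mu> \<psi>}"

definition eigenvalues :: "'i uop \<Rightarrow> complex set" where
  "eigenvalues D = {\<mu>. \<exists>\<psi>\<in>eigenspace D \<mu>. \<psi> \<noteq> 0}"

definition uop_diff :: "'i uop \<Rightarrow> 'i uop \<Rightarrow> 'i uop" where
  "uop_diff D D' = (fst D \<inter> fst D', \<lambda>\<psi>. snd D \<psi> - snd D' \<psi>)"

text \<open>\<open>A\<close> is relatively compact with respect to \<open>T\<close> (Kato's \<open>T\<close>-compactness).\<close>

definition relatively_compact :: "'i set \<Rightarrow> 'i uop \<Rightarrow> 'i uop \<Rightarrow> bool" where
  "relatively_compact I T A \<longleftrightarrow>
     fst T \<subseteq> fst A \<and>
     (\<forall>u C. (\<forall>n::nat. u n \<in> fst T \<and> l2norm (u n) \<le> C \<and> l2norm (snd T (u n)) \<le> C) \<longrightarrow>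
       (\<exists>r::nat \<Rightarrow> nat. strict_mono r \<and> norm_convergent I (\<lambda>n. snd A (u (r n)))))"


section \<open>The approximate representation\<close>

text \<open>
  \<open>(l, m)\<close> stands for \<open>|l,m\<rangle>\<^sub>M\<close>; the labels are half-integers, represented as real numbers.
\<close>

type_synonym lm = "real \<times> real"

definition half_integer :: "real \<Rightarrow> bool" where
  "half_integer x \<longleftrightarrow> 2 * x \<in> \<int>"

definition basis :: "real \<Rightarrow> lm set" where
  "basis M = {(l, m). l - \<bar>M\<bar> \<in> \<nat> \<and> l + m \<in> \<nat> \<and> m \<le> l}"

definition a_ket :: "real \<Rightarrow> real \<Rightarrow> real \<Rightarrow> lm \<Rightarrow> lm vec" where
  "a_ket q s M = (\<lambda>(l, m).
     scale (of_real (s * q powr (l + m) * sqrt (1 - q powr (2 * (l + m + 1)))))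
       (ket (basis M) (l + 1, m)) +
     scale (of_real (s * q powr (l + m - 1) * sqrt (1 - q powr (2 * (l + m)))))
       (ket (basis M) (l - 1, m)) +
     scale (of_real (q powr (2 * (l + m)))) (ket (basis M) (l, m)))"

definition b_ket :: "real \<Rightarrow> real \<Rightarrow> real \<Rightarrow> lm \<Rightarrow> lm vec" where
  "b_ket q s M = (\<lambda>(l, m).
     scale (of_real (s * sqrt (1 - q powr (2 * (l + m + 2))) * sqrt (1 - q powr (2 * (l + m + 1)))))
       (ket (basis M) (l + 1, m + 1)) -
     scale (of_real (s * q powr (2 * (l + m) + 1))) (ket (basis M) (l - 1, m + 1)) +
     scale (of_real (q powr (l + m + 1) * sqrt (1 - q powr (2 * (l + m + 1)))))
       (ket (basis M) (l, m + 1)))"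

definition bs_ket :: "real \<Rightarrow> real \<Rightarrow> real \<Rightarrow> lm \<Rightarrow> lm vec" where
  "bs_ket q s M = (\<lambda>(l, m).
     scale (of_real (s * sqrt (1 - q powr (2 * (l + m))) * sqrt (1 - q powr (2 * (l + m - 1)))))
       (ket (basis M) (l - 1, m - 1)) +
     scale (of_real (q powr (l + m) * sqrt (1 - q powr (2 * (l + m))))) (ket (basis M) (l, m - 1)) -
     scale (of_real (s * q powr (2 * (l + m) + 1))) (ket (basis M) (l + 1, m - 1)))"

datatype podles_gen = Gen_a | Gen_b | Gen_bstar

definition rep :: "real \<Rightarrow> real \<Rightarrow> real \<Rightarrow> podles_gen \<Rightarrow> lm oper" where
  "rep q s M x = from_kets (basis M)
     (case x of Gen_a \<Rightarrow> a_ket q s M | Gen_b \<Rightarrow> b_ket q s M | Gen_bstar \<Rightarrow> bs_ket q s M)"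

text \<open>The diagonal operator \<open>|l,m\<rangle> \<mapsto> q\<^sup>l |l,m\<rangle>\<close>.\<close>

definition q_diag :: "real \<Rightarrow> real \<Rightarrow> lm oper" where
  "q_diag q M = from_kets (basis M) (\<lambda>(l, m). scale (of_real (q powr l)) (ket (basis M) (l, m)))"

text \<open>The sums \<open>H\<^sub>M \<oplus> H\<^bsub>M+1\<^esub>\<close>.\<close>

definition basis2 :: "real \<Rightarrow> (lm + lm) set" where
  "basis2 M = basis M <+> basis (M + 1)"

definition rep2 :: "real \<Rightarrow> real \<Rightarrow> real \<Rightarrow> podles_gen \<Rightarrow> (lm + lm) oper" where
  "rep2 q s M x = dsum (rep q s M x) (rep q s (M + 1) x)"

definition q_diag2 :: "real \<Rightarrow> real \<Rightarrow> (lm + lm) oper" where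
  "q_diag2 q M = dsum (q_diag q M) (q_diag q (M + 1))"

text \<open>The grading is part of the data; no assertion is made about it.\<close>

definition grading :: "(lm + lm) oper" where
  "grading = dsum (\<lambda>\<psi>. \<psi>) (\<lambda>\<psi>. - \<psi>)"

definition rep_algebra :: "real \<Rightarrow> real \<Rightarrow> real \<Rightarrow> (lm + lm) oper set" where
  "rep_algebra q s M = op_algebra (range (rep2 q s M))"

definition has_bounded_comms :: "real \<Rightarrow> real \<Rightarrow> real \<Rightarrow> (lm + lm) uop \<Rightarrow> bool" where
  "has_bounded_comms q s M D \<longleftrightarrow>
     (\<forall>x\<in>rep_algebra q s M. \<exists>C. is_bounded_comm (basis2 M) D x C)"

text \<open>The sums \<open>(H\<^sub>N \<oplus> H\<^bsub>N+1\<^esub>) \<oplus> (H\<^sub>M \<oplus> H\<^bsub>M+1\<^esub>)\<close>.\<close>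

definition basis4 :: "real \<Rightarrow> real \<Rightarrow> ((lm + lm) + (lm + lm)) set" where
  "basis4 N M = basis2 N <+> basis2 M"

definition rep4 ::
  "real \<Rightarrow> real \<Rightarrow> real \<Rightarrow> real \<Rightarrow> podles_gen \<Rightarrow> ((lm + lm) + (lm + lm)) oper" where
  "rep4 q s N M x = dsum (rep2 q s N x) (rep2 q s M x)"

definition Kq4 :: "real \<Rightarrow> real \<Rightarrow> real \<Rightarrow> ((lm + lm) + (lm + lm)) oper set" where
  "Kq4 q N M = op_ideal (basis4 N M) (dsum (q_diag2 q N) (q_diag2 q M))"

definition order_one_mod_Kq :: "real \<Rightarrow> real \<Rightarrow> real \<Rightarrow> (lm + lm) uop \<Rightarrow> bool" where
  "order_one_mod_Kq q s N D \<longleftrightarrow>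
     (\<exists>M D' J.
        half_integer M \<and>
        unbounded_op (basis2 M) D' \<and> has_bounded_comms q s M D' \<and>
        antiunitary (basis4 N M) J \<and>
        (\<exists>\<epsilon>\<in>{1, -1}. \<forall>\<psi>\<in>l2 (basis4 N M). J (J \<psi>) = scale \<epsilon> \<psi>) \<and>
        uop_commutes (basis4 N M) J (uop_dsum D D') \<and>
        (\<forall>x y.
           comm (conj_by (basis4 N M) J (rep4 q s N M x)) (rep4 q s N M y) \<in> Kq4 q N M \<and>
           (\<exists>C. is_bounded_comm (basis4 N M) (uop_dsum D D') (rep4 q s N M y) C \<and>
                comm (conj_by (basis4 N M) J (rep4 q s N M x)) C \<in> Kq4 q N M)))"


section \<open>The Dirac operators\<close>

text \<open>The kets of \<open>H\<^sub>N \<oplus> H\<^bsub>N+1\<^esub>\<close> are exchanged with a coefficient depending on \<open>l\<close>.\<close>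

definition swap_op :: "real \<Rightarrow> (real \<Rightarrow> real) \<Rightarrow> (lm + lm) uop" where
  "swap_op N c = maximal_op (basis2 N) (from_kets (basis2 N)
     (case_sum (\<lambda>(l, m). scale (of_real (c l)) (ket (basis2 N) (Inr (l, m))))
               (\<lambda>(l, m). scale (of_real (c l)) (ket (basis2 N) (Inl (l, m))))))"

definition dirac :: "real \<Rightarrow> (lm + lm) uop" where
  "dirac N = swap_op N (\<lambda>l. l - N)"

definition classical_dirac :: "real \<Rightarrow> (lm + lm) uop" where
  "classical_dirac N = swap_op N (\<lambda>l. sqrt (l - N) * sqrt (l + N + 1))"

end

theory Submission
  imports Defs "HOL-Complex_Analysis.Great_Picard"
begin

text \<open>
  In the coordinates \<open>i = l + m\<close>, \<open>j = l - m\<close> every generator is a sum of three weighted shifts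
  whose weights are functions \<open>f i\<close> with \<open>f i = c + O(q\<^sup>i)\<close>, where \<open>c = 0\<close> as soon as the shift
  moves \<open>j\<close>. Since the weights do not depend on \<open>M\<close>, the commutator of \<open>D\<^sub>N\<close> with a generator
  multiplies each weight by the displacement of \<open>l\<close> and exchanges the two summands; so it is
  again of this form and bounded. For the order-one condition we take \<open>H' = H\<^bsub>N,1\<^esub>\<close>, \<open>D' = D\<^sub>N\<close> and
  for \<open>J\<close> the antilinear map \<open>|l,m\<rangle> \<mapsto> |l,-m\<rangle>\<close> on each summand, which exchanges \<open>i\<close> and \<open>j\<close>.
  An operator of the above form and a conjugated one commute up to terms of order
  \<open>q\<^bsup>i+j\<^esup> = q\<^bsup>2l\<^esup>\<close>: their leading parts act on different coordinates, and near the boundary of the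
  basis either \<open>i\<close> or \<open>j\<close> is bounded and the factor decaying in the other one is present.
  The spectral statements follow from \<open>D\<^sub>N\<^sup>2\<close> being diagonal, and the comparison with the classical
  operator from the fact that a diagonal operator with entries tending to zero along \<open>l\<close> is
  compact, because the levels have finite multiplicity.
\<close>

section \<open>Square-summable families\<close>

text \<open>Every operator is written through \<open>wshift\<close>. A commutator of two shifts
  along commuting maps is again one shift whose weight is a difference of products, and it lies in
  the ideal as soon as that weight is bounded by a multiple of q^l, since the factor q^l can be
  split off. So the order-one condition becomes a finite list of scalar estimates. The only weights
  with a nonzero limit, namely s, are the first ones of \<open>Gen_b\<close> and
  \<open>Gen_bstar\<close>; their hops (1,1) and (-1,-1) fix j, and after conjugation by J they fix
  i. The obstacle is truncation: in one order of a product the intermediate label may exist, in the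
  other it may not. For D_N this is harmless because l - N vanishes where a partner is missing; for
  the conjugated operators a term that has no counterpart must itself be shown to decay. In the
  comparison with the classical operator the coefficients differ by N + 1/2 in the limit, so the
  plain difference is not compact. Compactness is therefore expressed relative to the classical
  operator, and multiplicatively as D_classical = D_N (1 + K).\<close>

definition sq_norm :: "'i vec \<Rightarrow> real" where
  "sq_norm \<psi> = (\<Sum>\<^sub>\<infinity>i. (cmod (\<psi> i))\<^sup>2)"

lemma l2norm_eq: "l2norm \<psi> = sqrt (sq_norm \<psi>)"
  by (simp add: l2norm_def sq_norm_def)

lemma sq_norm_nonneg [simp]: "0 \<le> sq_norm \<psi>"
  unfolding sq_norm_def by (rule infsum_nonneg) simp

lemma l2norm_nonneg [simp]: "0 \<le> l2norm \<psi>"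
  by (simp add: l2norm_eq)

lemma l2norm_power2: "(l2norm \<psi>)\<^sup>2 = sq_norm \<psi>"
  by (simp add: l2norm_eq)

lemma l2_summable: "\<psi> \<in> l2 I \<Longrightarrow> (\<lambda>i. (cmod (\<psi> i))\<^sup>2) summable_on UNIV"
  by (simp add: l2_def)

lemma l2_outside: "\<psi> \<in> l2 I \<Longrightarrow> i \<notin> I \<Longrightarrow> \<psi> i = 0"
  by (simp add: l2_def)

lemma l2_finite_support:
  assumes "finite {k. \<psi> k \<noteq> 0}" "\<And>k. k \<notin> I \<Longrightarrow> \<psi> k = 0"
  shows "\<psi> \<in> l2 I"
proof -
  have "(\<lambda>i. (cmod (\<psi> i))\<^sup>2) summable_on {k. \<psi> k \<noteq> 0}"
    using assms(1) by (rule summable_on_finite)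
  then have "(\<lambda>i. (cmod (\<psi> i))\<^sup>2) summable_on UNIV"
    by (rule iffD1[OF summable_on_cong_neutral, rotated -1]) auto
  with assms(2) show ?thesis by (auto simp: l2_def)
qed

lemma zero_in_l2 [simp]: "0 \<in> l2 I"
  by (rule l2_finite_support) auto

lemma l2_dominated:
  assumes "\<psi> \<in> l2 I" "\<And>i. i \<notin> I \<Longrightarrow> \<phi> i = 0" "\<And>i. cmod (\<phi> i) \<le> C * cmod (\<psi> i)"
  shows "\<phi> \<in> l2 I" and "sq_norm \<phi> \<le> C\<^sup>2 * sq_norm \<psi>"
proof -
  have le: "(cmod (\<phi> i))\<^sup>2 \<le> C\<^sup>2 * (cmod (\<psi> i))\<^sup>2" for i
    using power_mono[OF assms(3), of i 2] by (simp add: power_mult_distrib)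
  have s: "(\<lambda>i. C\<^sup>2 * (cmod (\<psi> i))\<^sup>2) summable_on UNIV"
    using l2_summable[OF assms(1)] by (rule summable_on_cmult_right)
  have s2: "(\<lambda>i. (cmod (\<phi> i))\<^sup>2) summable_on UNIV"
    by (rule summable_on_comparison_test[OF s]) (use le in auto)
  show "\<phi> \<in> l2 I" using assms(2) s2 by (auto simp: l2_def)
  have "sq_norm \<phi> \<le> (\<Sum>\<^sub>\<infinity>i. C\<^sup>2 * (cmod (\<psi> i))\<^sup>2)"
    unfolding sq_norm_def by (rule infsum_mono[OF s2 s]) (rule le)
  also have "\<dots> = C\<^sup>2 * sq_norm \<psi>"
    unfolding sq_norm_def by (rule infsum_cmult_right')
  finally show "sq_norm \<phi> \<le> C\<^sup>2 * sq_norm \<psi>" .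
qed

text \<open>The constant 2 comes from (x + y)^2 <= 2 x^2 + 2 y^2, which replaces Minkowski's
  inequality: only boundedness and convergence to zero are derived from it.\<close>

lemma l2_add:
  assumes "\<phi> \<in> l2 I" "\<psi> \<in> l2 I"
  shows "\<phi> + \<psi> \<in> l2 I" and "l2norm (\<phi> + \<psi>) \<le> 2 * (l2norm \<phi> + l2norm \<psi>)"
proof -
  have le: "(cmod (\<phi> i + \<psi> i))\<^sup>2 \<le> 2 * (cmod (\<phi> i))\<^sup>2 + 2 * (cmod (\<psi> i))\<^sup>2" for i
  proof -
    have "(cmod (\<phi> i + \<psi> i))\<^sup>2 \<le> (cmod (\<phi> i) + cmod (\<psi> i))\<^sup>2"
      by (intro power_mono norm_triangle_ineq) auto
    also have "\<dots> \<le> 2 * (cmod (\<phi> i))\<^sup>2 + 2 * (cmod (\<psi> i))\<^sup>2"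
      using zero_le_power2[of "cmod (\<phi> i) - cmod (\<psi> i)"] by (simp add: power2_sum power2_diff)
    finally show ?thesis .
  qed
  have s1: "(\<lambda>i. 2 * (cmod (\<phi> i))\<^sup>2) summable_on UNIV"
    using l2_summable[OF assms(1)] by (rule summable_on_cmult_right)
  have s2: "(\<lambda>i. 2 * (cmod (\<psi> i))\<^sup>2) summable_on UNIV"
    using l2_summable[OF assms(2)] by (rule summable_on_cmult_right)
  have s: "(\<lambda>i. 2 * (cmod (\<phi> i))\<^sup>2 + 2 * (cmod (\<psi> i))\<^sup>2) summable_on UNIV"
    by (rule summable_on_add[OF s1 s2])
  have s3: "(\<lambda>i. (cmod (\<phi> i + \<psi> i))\<^sup>2) summable_on UNIV"
    by (rule summable_on_comparison_test[OF s]) (use le in auto)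
  show "\<phi> + \<psi> \<in> l2 I" using assms s3 by (auto simp: l2_def)
  have "sq_norm (\<phi> + \<psi>) \<le> (\<Sum>\<^sub>\<infinity>i. 2 * (cmod (\<phi> i))\<^sup>2 + 2 * (cmod (\<psi> i))\<^sup>2)"
    unfolding sq_norm_def using infsum_mono[OF s3 s le] by simp
  also have "\<dots> = 2 * sq_norm \<phi> + 2 * sq_norm \<psi>"
    unfolding sq_norm_def infsum_add[OF s1 s2] by (simp add: infsum_cmult_right')
  also have "\<dots> = 2 * (l2norm \<phi>)\<^sup>2 + 2 * (l2norm \<psi>)\<^sup>2"
    by (simp add: l2norm_power2)
  also have "\<dots> \<le> (2 * (l2norm \<phi> + l2norm \<psi>))\<^sup>2"
    by (simp add: power_mult_distrib power2_sum)
  finally have "(l2norm (\<phi> + \<psi>))\<^sup>2 \<le> (2 * (l2norm \<phi> + l2norm \<psi>))\<^sup>2"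
    by (simp only: l2norm_power2)
  then show "l2norm (\<phi> + \<psi>) \<le> 2 * (l2norm \<phi> + l2norm \<psi>)"
    by (rule power2_le_imp_le) simp
qed

lemma l2_scale:
  assumes "\<psi> \<in> l2 I"
  shows "scale c \<psi> \<in> l2 I" and "l2norm (scale c \<psi>) \<le> cmod c * l2norm \<psi>"
proof -
  have *: "cmod (scale c \<psi> i) \<le> cmod c * cmod (\<psi> i)" for i
    by (simp add: scale_def norm_mult)
  have z: "i \<notin> I \<Longrightarrow> scale c \<psi> i = 0" for i
    using l2_outside[OF assms] by (simp add: scale_def)
  show "scale c \<psi> \<in> l2 I"
    using assms z * by (rule l2_dominated(1))
  have "sq_norm (scale c \<psi>) \<le> (cmod c)\<^sup>2 * sq_norm \<psi>"
    using assms z * by (rule l2_dominated(2))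
  then have "(l2norm (scale c \<psi>))\<^sup>2 \<le> (cmod c * l2norm \<psi>)\<^sup>2"
    by (simp add: power_mult_distrib l2norm_power2)
  then show "l2norm (scale c \<psi>) \<le> cmod c * l2norm \<psi>"
    by (rule power2_le_imp_le) simp
qed

lemma minus_eq_scale: "\<phi> - \<psi> = \<phi> + scale (- 1) \<psi>"
  by (auto simp: scale_def)

lemma l2_diff:
  assumes "\<phi> \<in> l2 I" "\<psi> \<in> l2 I"
  shows "\<phi> - \<psi> \<in> l2 I" and "l2norm (\<phi> - \<psi>) \<le> 2 * (l2norm \<phi> + l2norm \<psi>)"
proof -
  show "\<phi> - \<psi> \<in> l2 I"
    unfolding minus_eq_scale by (intro l2_add(1) l2_scale(1) assms)
  have sc: "l2norm (scale (- 1) \<psi>) \<le> l2norm \<psi>"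
    using l2_scale(2)[OF assms(2), where c = "- 1"] unfolding norm_minus_cancel norm_one mult_1 .
  have "l2norm (\<phi> + scale (- 1) \<psi>) \<le> 2 * (l2norm \<phi> + l2norm (scale (- 1) \<psi>))"
    by (intro l2_add(2)[where I = I] l2_scale(1) assms)
  also have "\<dots> \<le> 2 * (l2norm \<phi> + l2norm \<psi>)"
    by (intro mult_left_mono add_left_mono sc) simp
  finally show "l2norm (\<phi> - \<psi>) \<le> 2 * (l2norm \<phi> + l2norm \<psi>)"
    by (simp only: minus_eq_scale)
qed

lemma finite_sum_le_sq_norm:
  assumes "\<psi> \<in> l2 I" "finite F"
  shows "(\<Sum>i\<in>F. (cmod (\<psi> i))\<^sup>2) \<le> sq_norm \<psi>"
  unfolding sq_norm_def by (rule finite_sum_le_infsum[OF l2_summable[OF assms(1)] assms(2)]) auto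

lemma norm_le_l2norm:
  assumes "\<psi> \<in> l2 I"
  shows "cmod (\<psi> i) \<le> l2norm \<psi>"
  using finite_sum_le_sq_norm[OF assms, of "{i}"] unfolding l2norm_eq
  by (intro real_le_rsqrt) simp

text \<open>Allows membership in l2 and a norm bound to be checked on finite subsets of the index
  set, where sums can be reindexed and split freely.\<close>

lemma l2_of_bounded_partial_sums:
  assumes "\<And>i. i \<notin> I \<Longrightarrow> \<psi> i = 0"
    and "\<And>F. finite F \<Longrightarrow> F \<subseteq> I \<Longrightarrow> (\<Sum>i\<in>F. (cmod (\<psi> i))\<^sup>2) \<le> B"
  shows "\<psi> \<in> l2 I" and "sq_norm \<psi> \<le> B"
proof -
  have *: "(\<Sum>i\<in>F. (cmod (\<psi> i))\<^sup>2) \<le> B" if "finite F" for F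
  proof -
    have "(\<Sum>i\<in>F. (cmod (\<psi> i))\<^sup>2) = (\<Sum>i\<in>F \<inter> I. (cmod (\<psi> i))\<^sup>2)"
      using that assms(1) by (intro sum.mono_neutral_right) auto
    then show ?thesis using assms(2)[of "F \<inter> I"] that by simp
  qed
  have s: "(\<lambda>i. (cmod (\<psi> i))\<^sup>2) summable_on UNIV"
    by (rule nonneg_bdd_above_summable_on) (use * in \<open>auto intro!: bdd_aboveI2[where M = B]\<close>)
  then show "\<psi> \<in> l2 I" using assms(1) by (auto simp: l2_def)
  show "sq_norm \<psi> \<le> B" unfolding sq_norm_def by (rule infsum_le_finite_sums[OF s]) (rule *)
qed

section \<open>Finitely supported vectors\<close>

lemma sum_fun_eq: "(\<Sum>n\<in>A. f n) = (\<lambda>k. \<Sum>n\<in>A. f n k)"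
  by (induction A rule: infinite_finite_induct) (auto simp: fun_eq_iff)

text \<open>A finitely supported family is the sum of its components, and combinations of kets have
  finite support. Invariance of the span thus becomes finiteness of preimages.\<close>

lemma alg_span_eq:
  fixes I :: "'i set"
  shows "alg_span I = {\<psi>. finite {k. \<psi> k \<noteq> 0} \<and> (\<forall>k. k \<notin> I \<longrightarrow> \<psi> k = 0)}"
proof (intro set_eqI iffI)
  fix \<psi> :: "'i vec"
  assume "\<psi> \<in> alg_span I"
  then have "\<psi> \<in> cvec_span (ket I ` I)" unfolding alg_span_def .
  then have "finite {k. \<psi> k \<noteq> 0} \<and> (\<forall>k. k \<notin> I \<longrightarrow> \<psi> k = 0)"
  proof (induction rule: cvec.span_induct_alt)
    case base
    then show ?case by simp
  next
    case (step c x y)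
    then obtain i where i: "i \<in> I" "x = ket I i" by auto
    have "{k. (scale c x + y) k \<noteq> 0} \<subseteq> {i} \<union> {k. y k \<noteq> 0}"
      by (auto simp: i scale_def ket_def)
    then have "finite {k. (scale c x + y) k \<noteq> 0}"
      using step by (elim finite_subset) simp
    then show ?case using step i by (auto simp: scale_def ket_def)
  qed
  then show "\<psi> \<in> {\<psi>. finite {k. \<psi> k \<noteq> 0} \<and> (\<forall>k. k \<notin> I \<longrightarrow> \<psi> k = 0)}" by simp
next
  fix \<psi> :: "'i vec"
  assume "\<psi> \<in> {\<psi>. finite {k. \<psi> k \<noteq> 0} \<and> (\<forall>k. k \<notin> I \<longrightarrow> \<psi> k = 0)}"
  then have fin: "finite {k. \<psi> k \<noteq> 0}" and sub: "{k. \<psi> k \<noteq> 0} \<subseteq> I" by auto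
  have "\<psi> = (\<Sum>k | \<psi> k \<noteq> 0. scale (\<psi> k) (ket I k))"
  proof
    fix j
    have "(\<Sum>k | \<psi> k \<noteq> 0. scale (\<psi> k) (ket I k)) j = (\<Sum>k | \<psi> k \<noteq> 0. if k = j then \<psi> j else 0)"
      unfolding sum_fun_eq using sub by (intro sum.cong) (auto simp: scale_def ket_def)
    then show "\<psi> j = (\<Sum>k | \<psi> k \<noteq> 0. scale (\<psi> k) (ket I k)) j"
      using fin by (simp add: sum.delta)
  qed
  moreover have "(\<Sum>k | \<psi> k \<noteq> 0. scale (\<psi> k) (ket I k)) \<in> cvec_span (ket I ` I)"
    using sub by (intro cvec.span_sum cvec.span_scale cvec.span_base) auto
  ultimately show "\<psi> \<in> alg_span I" by (simp add: alg_span_def)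
qed

lemma alg_span_subset_l2: "alg_span I \<subseteq> l2 I"
  by (auto simp: alg_span_eq intro: l2_finite_support)


section \<open>Bounded operators\<close>

lemma bounded_opsI:
  assumes "\<And>\<psi>. \<psi> \<in> l2 I \<Longrightarrow> T \<psi> \<in> l2 I"
    and "\<And>\<phi> \<psi>. \<phi> \<in> l2 I \<Longrightarrow> \<psi> \<in> l2 I \<Longrightarrow> T (\<phi> + \<psi>) = T \<phi> + T \<psi>"
    and "\<And>c \<psi>. \<psi> \<in> l2 I \<Longrightarrow> T (scale c \<psi>) = scale c (T \<psi>)"
    and "\<And>\<psi>. \<psi> \<in> l2 I \<Longrightarrow> l2norm (T \<psi>) \<le> C * l2norm \<psi>"
  shows "T \<in> bounded_ops I"
  unfolding bounded_ops_def linear_on_subspace_def using assms by blast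

lemma bounded_opsD:
  assumes "T \<in> bounded_ops I"
  shows "\<psi> \<in> l2 I \<Longrightarrow> T \<psi> \<in> l2 I"
    and "\<phi> \<in> l2 I \<Longrightarrow> \<psi> \<in> l2 I \<Longrightarrow> T (\<phi> + \<psi>) = T \<phi> + T \<psi>"
    and "\<psi> \<in> l2 I \<Longrightarrow> T (scale c \<psi>) = scale c (T \<psi>)"
  using assms by (auto simp: bounded_ops_def linear_on_subspace_def)

lemma bounded_ops_diff:
  assumes "T \<in> bounded_ops I" "\<phi> \<in> l2 I" "\<psi> \<in> l2 I"
  shows "T (\<phi> - \<psi>) = T \<phi> - T \<psi>"
  using assms by (simp only: minus_eq_scale bounded_opsD l2_scale)

lemma bounded_ops_bound:
  assumes "T \<in> bounded_ops I"
  obtains C where "C \<ge> 0" "\<And>\<psi>. \<psi> \<in> l2 I \<Longrightarrow> l2norm (T \<psi>) \<le> C * l2norm \<psi>"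
proof -
  obtain C where C: "\<And>\<psi>. \<psi> \<in> l2 I \<Longrightarrow> l2norm (T \<psi>) \<le> C * l2norm \<psi>"
    using assms by (auto simp: bounded_ops_def)
  \<comment> \<open>The definition of \<open>bounded_ops\<close> does not exclude a negative
    constant; the absolute value makes it usable in monotonicity arguments.\<close>
  have "l2norm (T \<psi>) \<le> \<bar>C\<bar> * l2norm \<psi>" if "\<psi> \<in> l2 I" for \<psi>
    using C[OF that] by (rule order_trans) (intro mult_right_mono; simp)
  then show thesis using that[of "\<bar>C\<bar>"] by simp
qed

lemma id_bounded: "id \<in> bounded_ops I"
  by (rule bounded_opsI[where C = 1]) simp_all

lemma add_bounded:
  assumes "S \<in> bounded_ops I" "T \<in> bounded_ops I"
  shows "(\<lambda>\<psi>. S \<psi> + T \<psi>) \<in> bounded_ops I"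
proof -
  obtain A where A: "A \<ge> 0" "\<And>\<psi>. \<psi> \<in> l2 I \<Longrightarrow> l2norm (S \<psi>) \<le> A * l2norm \<psi>"
    using bounded_ops_bound[OF assms(1)] by blast
  obtain B where B: "B \<ge> 0" "\<And>\<psi>. \<psi> \<in> l2 I \<Longrightarrow> l2norm (T \<psi>) \<le> B * l2norm \<psi>"
    using bounded_ops_bound[OF assms(2)] by blast
  have "l2norm (S \<psi> + T \<psi>) \<le> (2 * (A + B)) * l2norm \<psi>" if \<psi>: "\<psi> \<in> l2 I" for \<psi>
  proof -
    have "l2norm (S \<psi> + T \<psi>) \<le> 2 * (l2norm (S \<psi>) + l2norm (T \<psi>))"
      using assms \<psi> by (intro l2_add(2)) (auto dest: bounded_opsD)
    also have "\<dots> \<le> 2 * (A * l2norm \<psi> + B * l2norm \<psi>)"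
      using A(2)[OF \<psi>] B(2)[OF \<psi>] by simp
    finally show ?thesis by (simp add: algebra_simps)
  qed
  then show ?thesis
    using assms
    by (intro bounded_opsI[where C = "2 * (A + B)"] l2_add(1))
      (simp_all only: bounded_opsD cvec.scale_right_distrib add.assoc add.left_commute)
qed

lemma scale_bounded:
  assumes "T \<in> bounded_ops I"
  shows "(\<lambda>\<psi>. scale c (T \<psi>)) \<in> bounded_ops I"
proof -
  obtain B where B: "B \<ge> 0" "\<And>\<psi>. \<psi> \<in> l2 I \<Longrightarrow> l2norm (T \<psi>) \<le> B * l2norm \<psi>"
    using bounded_ops_bound[OF assms] by blast
  have "l2norm (scale c (T \<psi>)) \<le> (cmod c * B) * l2norm \<psi>" if \<psi>: "\<psi> \<in> l2 I" for \<psi>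
  proof -
    have "l2norm (scale c (T \<psi>)) \<le> cmod c * l2norm (T \<psi>)"
      using assms \<psi> by (intro l2_scale(2)) (auto dest: bounded_opsD)
    also have "\<dots> \<le> cmod c * (B * l2norm \<psi>)"
      by (intro mult_left_mono B(2) \<psi>) auto
    finally show ?thesis by (simp add: algebra_simps)
  qed
  then show ?thesis
    using assms
    by (intro bounded_opsI[where C = "cmod c * B"] l2_scale(1))
      (simp_all only: bounded_opsD cvec.scale_right_distrib cvec.scale_left_commute)
qed

lemma comp_bounded:
  assumes "S \<in> bounded_ops I" "T \<in> bounded_ops I"
  shows "S \<circ> T \<in> bounded_ops I"
proof -
  obtain A where A: "A \<ge> 0" "\<And>\<psi>. \<psi> \<in> l2 I \<Longrightarrow> l2norm (S \<psi>) \<le> A * l2norm \<psi>"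
    using bounded_ops_bound[OF assms(1)] by blast
  obtain B where B: "B \<ge> 0" "\<And>\<psi>. \<psi> \<in> l2 I \<Longrightarrow> l2norm (T \<psi>) \<le> B * l2norm \<psi>"
    using bounded_ops_bound[OF assms(2)] by blast
  have "l2norm (S (T \<psi>)) \<le> (A * B) * l2norm \<psi>" if \<psi>: "\<psi> \<in> l2 I" for \<psi>
  proof -
    have "l2norm (S (T \<psi>)) \<le> A * l2norm (T \<psi>)"
      using assms \<psi> by (intro A(2)) (auto dest: bounded_opsD)
    also have "\<dots> \<le> A * (B * l2norm \<psi>)"
      by (intro mult_left_mono B(2) \<psi> A(1))
    finally show ?thesis by (simp add: algebra_simps)
  qed
  then show ?thesis
    using assms by (intro bounded_opsI[where C = "A * B"]) (simp_all only: bounded_opsD o_apply)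
qed

lemma bounded_ops_cong:
  assumes "T \<in> bounded_ops I" "\<And>\<psi>. \<psi> \<in> l2 I \<Longrightarrow> S \<psi> = T \<psi>"
  shows "S \<in> bounded_ops I"
proof -
  obtain B where "B \<ge> 0" "\<And>\<psi>. \<psi> \<in> l2 I \<Longrightarrow> l2norm (T \<psi>) \<le> B * l2norm \<psi>"
    using bounded_ops_bound[OF assms(1)] by blast
  then show ?thesis using assms
    by (intro bounded_opsI[where C = B]) (simp_all only: bounded_opsD l2_add(1) l2_scale(1))
qed

lemma sum_bounded:
  assumes "\<And>n. n \<in> A \<Longrightarrow> T n \<in> bounded_ops I"
  shows "(\<lambda>\<psi>. \<Sum>n\<in>A. T n \<psi>) \<in> bounded_ops I"
proof -
  have zero: "(\<lambda>\<psi>. 0) \<in> bounded_ops I"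
    using scale_bounded[OF id_bounded, of 0 I] by simp
  show ?thesis
  proof (cases "finite A")
    case True
    then show ?thesis using assms
    proof (induction rule: finite_induct)
      case (insert x F)
      have "(\<lambda>\<psi>. T x \<psi> + (\<Sum>n\<in>F. T n \<psi>)) \<in> bounded_ops I"
        by (rule add_bounded) (use insert in auto)
      then show ?case by (simp only: sum.insert[OF insert.hyps])
    qed (simp only: sum.empty zero)
  qed (simp only: sum.infinite zero not_False_eq_True)
qed


section \<open>Weighted shifts\<close>

text \<open>The operator \<open>|g k\<rangle> \<mapsto> v k |k\<rangle>\<close>: the weight is indexed by the target.\<close>

definition wshift :: "'i set \<Rightarrow> ('i \<Rightarrow> 'i) \<Rightarrow> ('i \<Rightarrow> real) \<Rightarrow> 'i oper" where
  "wshift I g v \<psi> = (\<lambda>k. if k \<in> I \<and> g k \<in> I then of_real (v k) * \<psi> (g k) else 0)"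

lemma wshift_add: "wshift I g v (\<phi> + \<psi>) = wshift I g v \<phi> + wshift I g v \<psi>"
  by (auto simp: wshift_def algebra_simps)

lemma wshift_diff: "wshift I g v (\<phi> - \<psi>) = wshift I g v \<phi> - wshift I g v \<psi>"
  by (auto simp: wshift_def algebra_simps)

lemma wshift_scale: "wshift I g v (scale c \<psi>) = scale c (wshift I g v \<psi>)"
  by (auto simp: wshift_def scale_def algebra_simps)

lemma wshift_zero: "wshift I g v 0 = 0"
  by (auto simp: wshift_def)

lemma wshift_sum: "wshift I g v (\<Sum>n\<in>A. \<psi> n) = (\<Sum>n\<in>A. wshift I g v (\<psi> n))"
  by (induction A rule: infinite_finite_induct)
    (simp_all only: sum.infinite sum.empty sum.insert wshift_zero wshift_add not_False_eq_True)

lemma wshift_bounded: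
  assumes inj: "inj g" and C: "\<And>k. k \<in> I \<Longrightarrow> g k \<in> I \<Longrightarrow> \<bar>v k\<bar> \<le> C"
  shows "wshift I g v \<in> bounded_ops I"
proof -
  have *: "wshift I g v \<psi> \<in> l2 I \<and> sq_norm (wshift I g v \<psi>) \<le> C\<^sup>2 * sq_norm \<psi>"
    if \<psi>: "\<psi> \<in> l2 I" for \<psi>
  proof -
    have b: "(\<Sum>k\<in>F. (cmod (wshift I g v \<psi> k))\<^sup>2) \<le> C\<^sup>2 * sq_norm \<psi>" if F: "finite F" "F \<subseteq> I" for F
    proof -
      have "(\<Sum>k\<in>F. (cmod (wshift I g v \<psi> k))\<^sup>2) \<le> (\<Sum>k\<in>F. C\<^sup>2 * (cmod (\<psi> (g k)))\<^sup>2)"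
      proof (rule sum_mono)
        fix k
        show "(cmod (wshift I g v \<psi> k))\<^sup>2 \<le> C\<^sup>2 * (cmod (\<psi> (g k)))\<^sup>2"
          using C[of k] unfolding power_mult_distrib[symmetric]
          by (auto simp: wshift_def norm_mult intro!: power_mono mult_right_mono)
      qed
      also have "\<dots> = C\<^sup>2 * (\<Sum>j\<in>g ` F. (cmod (\<psi> j))\<^sup>2)"
        using inj by (subst sum.reindex) (auto simp: sum_distrib_left intro: inj_on_subset)
      also have "\<dots> \<le> C\<^sup>2 * sq_norm \<psi>"
        using F by (intro mult_left_mono finite_sum_le_sq_norm[OF \<psi>]) auto
      finally show ?thesis .
    qed
    have z: "wshift I g v \<psi> i = 0" if "i \<notin> I" for i
      using that by (simp add: wshift_def)
    show ?thesis using l2_of_bounded_partial_sums[OF z b] by blast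
  qed
  have "l2norm (wshift I g v \<psi>) \<le> \<bar>C\<bar> * l2norm \<psi>" if "\<psi> \<in> l2 I" for \<psi>
    using real_sqrt_le_mono[OF conjunct2[OF *[OF that]]] by (simp add: l2norm_eq real_sqrt_mult)
  then show ?thesis
    using * by (intro bounded_opsI[where C = "\<bar>C\<bar>"]) (simp_all only: wshift_add wshift_scale)
qed

lemma wshift_alg_span:
  assumes inj: "inj g" and "\<psi> \<in> alg_span I"
  shows "wshift I g v \<psi> \<in> alg_span I"
proof -
  have "{k. wshift I g v \<psi> k \<noteq> 0} \<subseteq> g -` {k. \<psi> k \<noteq> 0}"
    by (auto simp: wshift_def)
  then have "finite {k. wshift I g v \<psi> k \<noteq> 0}"
    using assms by (elim finite_subset) (auto simp: alg_span_eq simp del: vimage_Collect_eq intro!: finite_vimageI)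
  then show ?thesis by (auto simp: alg_span_eq wshift_def)
qed

text \<open>The test on g k records whether the intermediate label exists; all boundary terms of
  commutators originate here. The maps point from target to source, hence the order h o g.\<close>

lemma wshift_comp:
  "wshift I g v (wshift I h w \<psi>) =
    wshift I (h \<circ> g) (\<lambda>k. if g k \<in> I then v k * w (g k) else 0) \<psi>"
  by (auto simp: wshift_def fun_eq_iff)

text \<open>Only the source i = g j reaches the component j, so the infinite sum has at most one
  term. This passes from weights indexed by the source to weights indexed by the target.\<close>

lemma from_kets_shift:
  assumes "\<And>i. f (g i) = i" "\<And>i. g (f i) = i"
  shows "from_kets I (\<lambda>i. scale (of_real (u i)) (ket I (f i))) = wshift I g (\<lambda>k. u (g k))"
proof (intro ext)
  fix \<psi> :: "'a vec" and j
  have "from_kets I (\<lambda>i. scale (of_real (u i)) (ket I (f i))) \<psi> j =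
      (\<Sum>\<^sub>\<infinity>i\<in>{g j} \<inter> I. \<psi> i * scale (of_real (u i)) (ket I (f i)) j)"
    unfolding from_kets_def using assms
    by (intro infsum_cong_neutral) (auto simp: scale_def ket_def)
  also have "\<dots> = wshift I g (\<lambda>k. u (g k)) \<psi> j"
    by (auto simp: scale_def ket_def wshift_def assms Int_insert_left)
  finally show "from_kets I (\<lambda>i. scale (of_real (u i)) (ket I (f i))) \<psi> j =
    wshift I g (\<lambda>k. u (g k)) \<psi> j" .
qed

lemma from_kets_summable:
  assumes "inj f"
  shows "(\<lambda>i. \<psi> i * scale (c i) (ket I (f i)) j) summable_on I"
proof -
  have "finite (f -` {j})" using assms by (intro finite_vimageI) auto
  then have "(\<lambda>i. \<psi> i * scale (c i) (ket I (f i)) j) summable_on (f -` {j} \<inter> I)"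
    by (intro summable_on_finite) auto
  then show ?thesis
    by (rule iffD1[OF summable_on_cong_neutral, rotated -1]) (auto simp: scale_def ket_def)
qed

section \<open>Compact operators\<close>

lemma compact_ops_bounded: "T \<in> compact_ops I \<Longrightarrow> T \<in> bounded_ops I"
  by (simp add: compact_ops_def)

lemma compact_opsD:
  assumes "T \<in> compact_ops I" "\<And>n::nat. u n \<in> l2 I" "\<And>n. l2norm (u n) \<le> C"
  obtains r where "strict_mono r" "norm_convergent I (\<lambda>n. T (u (r n)))"
  using assms unfolding compact_ops_def by blast

lemma norm_convergent_bounded_op:
  assumes "A \<in> bounded_ops I" "norm_convergent I v" "\<And>n. v n \<in> l2 I"
  shows "norm_convergent I (\<lambda>n. A (v n))"
proof -
  obtain \<phi> where \<phi>: "\<phi> \<in> l2 I" "(\<lambda>n. l2norm (v n - \<phi>)) \<longlonglongrightarrow> 0"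
    using assms(2) by (auto simp: norm_convergent_def)
  obtain C where C: "C \<ge> 0" "\<And>\<psi>. \<psi> \<in> l2 I \<Longrightarrow> l2norm (A \<psi>) \<le> C * l2norm \<psi>"
    using bounded_ops_bound[OF assms(1)] by blast
  have "(\<lambda>n. l2norm (A (v n) - A \<phi>)) \<longlonglongrightarrow> 0"
  proof (rule Lim_null_comparison)
    show "\<forall>\<^sub>F n in sequentially. norm (l2norm (A (v n) - A \<phi>)) \<le> C * l2norm (v n - \<phi>)"
      using C(2)[OF l2_diff(1)[OF assms(3) \<phi>(1)]]
      by (simp add: bounded_ops_diff[OF assms(1) assms(3) \<phi>(1)])
    show "(\<lambda>n. C * l2norm (v n - \<phi>)) \<longlonglongrightarrow> 0"
      using tendsto_mult_right_zero[OF \<phi>(2)] .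
  qed
  then show ?thesis
    using bounded_opsD(1)[OF assms(1) \<phi>(1)] unfolding norm_convergent_def by blast
qed

lemma norm_convergent_add:
  assumes "norm_convergent I v" "norm_convergent I w" "\<And>n. v n \<in> l2 I" "\<And>n. w n \<in> l2 I"
  shows "norm_convergent I (\<lambda>n. v n + w n)"
proof -
  obtain \<phi> where \<phi>: "\<phi> \<in> l2 I" "(\<lambda>n. l2norm (v n - \<phi>)) \<longlonglongrightarrow> 0"
    using assms(1) by (auto simp: norm_convergent_def)
  obtain \<eta> where \<eta>: "\<eta> \<in> l2 I" "(\<lambda>n. l2norm (w n - \<eta>)) \<longlonglongrightarrow> 0"
    using assms(2) by (auto simp: norm_convergent_def)
  have "(\<lambda>n. l2norm ((v n + w n) - (\<phi> + \<eta>))) \<longlonglongrightarrow> 0"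
  proof (rule Lim_null_comparison)
    show "\<forall>\<^sub>F n in sequentially. norm (l2norm ((v n + w n) - (\<phi> + \<eta>))) \<le>
        2 * (l2norm (v n - \<phi>) + l2norm (w n - \<eta>))"
      using l2_add(2)[OF l2_diff(1)[OF assms(3) \<phi>(1)] l2_diff(1)[OF assms(4) \<eta>(1)]]
      by (simp add: add_diff_add)
    show "(\<lambda>n. 2 * (l2norm (v n - \<phi>) + l2norm (w n - \<eta>))) \<longlonglongrightarrow> 0"
      using tendsto_mult_right_zero[OF tendsto_add_zero[OF \<phi>(2) \<eta>(2)]] .
  qed
  then show ?thesis
    using l2_add(1)[OF \<phi>(1) \<eta>(1)] unfolding norm_convergent_def by blast
qed

lemma norm_convergent_subseq:
  assumes "norm_convergent I v" "strict_mono r"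
  shows "norm_convergent I (\<lambda>n. v (r n))"
proof -
  obtain \<phi> where "\<phi> \<in> l2 I" "(\<lambda>n. l2norm (v n - \<phi>)) \<longlonglongrightarrow> 0"
    using assms(1) by (auto simp: norm_convergent_def)
  then show ?thesis
    using LIMSEQ_subseq_LIMSEQ[OF _ assms(2)] unfolding norm_convergent_def by (force simp: o_def)
qed

lemma compact_ops_add:
  assumes "S \<in> compact_ops I" "T \<in> compact_ops I"
  shows "(\<lambda>\<psi>. S \<psi> + T \<psi>) \<in> compact_ops I"
  unfolding compact_ops_def
proof (intro CollectI conjI allI impI)
  show "(\<lambda>\<psi>. S \<psi> + T \<psi>) \<in> bounded_ops I"
    using assms by (intro add_bounded compact_ops_bounded)
next
  fix u :: "nat \<Rightarrow> 'a vec" and C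
  assume u: "\<forall>n. u n \<in> l2 I \<and> l2norm (u n) \<le> C"
  obtain r where r: "strict_mono r" "norm_convergent I (\<lambda>n. S (u (r n)))"
    by (rule compact_opsD[OF assms(1), of u C]) (use u in auto)
  obtain r' where r': "strict_mono r'" "norm_convergent I (\<lambda>n. T (u (r (r' n))))"
    by (rule compact_opsD[OF assms(2), of "\<lambda>n. u (r n)" C]) (use u in auto)
  have "norm_convergent I (\<lambda>n. S (u (r (r' n))) + T (u (r (r' n))))"
    using u bounded_opsD(1)[OF compact_ops_bounded[OF assms(1)]]
      bounded_opsD(1)[OF compact_ops_bounded[OF assms(2)]]
    by (intro norm_convergent_add norm_convergent_subseq[OF r(2) r'(1)] r'(2)) blast+
  then show "\<exists>r. strict_mono r \<and> norm_convergent I (\<lambda>n. S (u (r n)) + T (u (r n)))"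
    using strict_mono_o[OF r(1) r'(1)] unfolding o_def by blast
qed

lemma compact_ops_comp_left:
  assumes "A \<in> bounded_ops I" "T \<in> compact_ops I"
  shows "A \<circ> T \<in> compact_ops I"
  unfolding compact_ops_def
proof (intro CollectI conjI allI impI)
  show "A \<circ> T \<in> bounded_ops I"
    by (rule comp_bounded[OF assms(1) compact_ops_bounded[OF assms(2)]])
next
  fix u :: "nat \<Rightarrow> 'a vec" and C
  assume u: "\<forall>n. u n \<in> l2 I \<and> l2norm (u n) \<le> C"
  obtain r where r: "strict_mono r" "norm_convergent I (\<lambda>n. T (u (r n)))"
    by (rule compact_opsD[OF assms(2), of u C]) (use u in auto)
  have "norm_convergent I (\<lambda>n. A (T (u (r n))))"
    using u bounded_opsD(1)[OF compact_ops_bounded[OF assms(2)]]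
    by (intro norm_convergent_bounded_op[OF assms(1) r(2)]) blast
  then show "\<exists>r. strict_mono r \<and> norm_convergent I (\<lambda>n. (A \<circ> T) (u (r n)))"
    using r(1) by auto
qed

lemma compact_ops_comp_right:
  assumes "A \<in> bounded_ops I" "T \<in> compact_ops I"
  shows "T \<circ> A \<in> compact_ops I"
  unfolding compact_ops_def
proof (intro CollectI conjI allI impI)
  show "T \<circ> A \<in> bounded_ops I"
    by (rule comp_bounded[OF compact_ops_bounded[OF assms(2)] assms(1)])
next
  fix u :: "nat \<Rightarrow> 'a vec" and C
  assume u: "\<forall>n. u n \<in> l2 I \<and> l2norm (u n) \<le> C"
  obtain B where B: "B \<ge> 0" "\<And>\<psi>. \<psi> \<in> l2 I \<Longrightarrow> l2norm (A \<psi>) \<le> B * l2norm \<psi>"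
    using bounded_ops_bound[OF assms(1)] by blast
  have "l2norm (A (u n)) \<le> B * C" for n
    using B(2)[of "u n"] mult_left_mono[of "l2norm (u n)" C B] u B(1) by force
  moreover have "A (u n) \<in> l2 I" for n
    using bounded_opsD(1)[OF assms(1)] u by blast
  ultimately obtain r where "strict_mono r" "norm_convergent I (\<lambda>n. T (A (u (r n))))"
    using compact_opsD[OF assms(2), of "\<lambda>n. A (u n)"] by blast
  then show "\<exists>r. strict_mono r \<and> norm_convergent I (\<lambda>n. (T \<circ> A) (u (r n)))"
    by auto
qed

lemma compact_ops_cong:
  assumes "T \<in> compact_ops I" "\<And>\<psi>. \<psi> \<in> l2 I \<Longrightarrow> S \<psi> = T \<psi>"
  shows "S \<in> compact_ops I"
  unfolding compact_ops_def
proof (intro CollectI conjI allI impI)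
  show "S \<in> bounded_ops I"
    using bounded_ops_cong[OF compact_ops_bounded[OF assms(1)] assms(2)] by blast
next
  fix u :: "nat \<Rightarrow> 'a vec" and C
  assume u: "\<forall>n. u n \<in> l2 I \<and> l2norm (u n) \<le> C"
  obtain r where "strict_mono r" "norm_convergent I (\<lambda>n. T (u (r n)))"
    by (rule compact_opsD[OF assms(1), of u C]) (use u in auto)
  then show "\<exists>r. strict_mono r \<and> norm_convergent I (\<lambda>n. S (u (r n)))"
    using assms(2) u by auto
qed

text \<open>The compact operators satisfy every closure rule of \<open>op_ideal\<close>, so
  compactness of the generator suffices.\<close>

lemma op_ideal_subset_compact:
  assumes "Q \<in> compact_ops I"
  shows "op_ideal I Q \<subseteq> compact_ops I"
proof
  fix T assume "T \<in> op_ideal I Q"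
  then show "T \<in> compact_ops I"
  proof induction
    case gen
    show ?case by (rule assms)
  next
    case (add S T)
    from add.IH show ?case by (rule compact_ops_add)
  next
    case (left A T)
    from left.hyps(1) left.IH show ?case by (rule compact_ops_comp_left)
  next
    case (right A T)
    from right.hyps(1) right.IH show ?case by (rule compact_ops_comp_right)
  next
    case (cong T S)
    from cong.IH cong.hyps(2) show ?case by (rule compact_ops_cong)
  qed
qed

text \<open>A bounded sequence has a subsequence converging in each coordinate that the operator
  sees; its limit is again in l2. The image of the remainder tends to zero in norm: finitely many
  large weights are handled coordinatewise, the rest uniformly.\<close>

lemma diagonal_compact:
  assumes fin: "\<And>e. e > 0 \<Longrightarrow> finite {k \<in> I. \<bar>w k\<bar> > e}"
  shows "wshift I (\<lambda>k. k) w \<in> compact_ops I"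
  unfolding compact_ops_def
proof (intro CollectI conjI allI impI)
  define W where "W = wshift I (\<lambda>k. k) w"
  have Wapp: "W \<psi> k = (if k \<in> I then of_real (w k) * \<psi> k else 0)" for \<psi> k
    by (simp add: W_def wshift_def)
  have "\<bar>w k\<bar> \<le> 1 + (\<Sum>j\<in>{k \<in> I. \<bar>w k\<bar> > 1}. \<bar>w j\<bar>)" if "k \<in> I" for k
  proof (cases "\<bar>w k\<bar> > 1")
    case True
    then have "\<bar>w k\<bar> \<le> (\<Sum>j\<in>{k \<in> I. \<bar>w k\<bar> > 1}. \<bar>w j\<bar>)"
      using that fin[of 1] by (intro member_le_sum) auto
    then show ?thesis by simp
  next
    case False
    moreover have "0 \<le> (\<Sum>j\<in>{k \<in> I. \<bar>w k\<bar> > 1}. \<bar>w j\<bar>)"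
      by (rule sum_nonneg) simp
    ultimately show ?thesis by argo
  qed
  then show bdd: "wshift I (\<lambda>k. k) w \<in> bounded_ops I"
    by (intro wshift_bounded) (auto simp: inj_def)
  fix u :: "nat \<Rightarrow> 'a vec" and C
  assume u: "\<forall>n. u n \<in> l2 I \<and> l2norm (u n) \<le> C"
  have C0: "C \<ge> 0" using u l2norm_nonneg order_trans by blast
  have uC: "sq_norm (u n) \<le> C\<^sup>2" for n
    using u by (simp add: l2norm_power2[symmetric] power_mono)
  \<comment> \<open>I is not assumed countable; S is, as a countable union of finite sets, and this
    is what the extraction of the subsequence requires.\<close>
  define S where "S = {k \<in> I. w k \<noteq> 0}"
  have "S \<subseteq> (\<Union>n::nat. {k \<in> I. \<bar>w k\<bar> > 1 / real (Suc n)})"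
  proof
    fix k assume "k \<in> S"
    then have "k \<in> I" "\<bar>w k\<bar> > 0" by (auto simp: S_def)
    moreover obtain n where "1 / real (Suc n) < \<bar>w k\<bar>"
      using nat_approx_posE[OF \<open>\<bar>w k\<bar> > 0\<close>] by metis
    ultimately show "k \<in> (\<Union>n::nat. {k \<in> I. \<bar>w k\<bar> > 1 / real (Suc n)})" by blast
  qed
  moreover have "countable (\<Union>n::nat. {k \<in> I. \<bar>w k\<bar> > 1 / real (Suc n)})"
    by (intro countable_UN countable_finite[OF fin]) auto
  ultimately have "countable S" by (rule countable_subset)
  moreover have "cmod (u n k) \<le> C" for n k
    using norm_le_l2norm[of "u n" I k] u order_trans by blast
  ultimately obtain r where r: "strict_mono r" "\<And>k. k \<in> S \<Longrightarrow> \<exists>l. (\<lambda>n. u (r n) k) \<longlonglongrightarrow> l"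
    using function_convergent_subsequence[of S u C] by blast
  \<comment> \<open>Off S the operator vanishes, so the limit may be set to zero there.\<close>
  define \<phi> where "\<phi> k = (if k \<in> S then lim (\<lambda>n. u (r n) k) else 0)" for k
  have lim: "(\<lambda>n. u (r n) k) \<longlonglongrightarrow> \<phi> k" if "k \<in> S" for k
    using r(2)[OF that] that by (simp add: \<phi>_def convergent_def[symmetric] convergent_LIMSEQ_iff)
  have z: "\<phi> k = 0" if "k \<notin> I" for k
    using that by (simp add: \<phi>_def S_def)
  have "(\<Sum>k\<in>F. (cmod (\<phi> k))\<^sup>2) \<le> C\<^sup>2" if F: "finite F" "F \<subseteq> I" for F
  proof -
    have "(\<Sum>k\<in>F. (cmod (\<phi> k))\<^sup>2) = (\<Sum>k\<in>F \<inter> S. (cmod (\<phi> k))\<^sup>2)"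
      using F by (intro sum.mono_neutral_right) (auto simp: \<phi>_def)
    also have "\<dots> \<le> C\<^sup>2"
    proof (rule LIMSEQ_le_const2)
      show "(\<lambda>n. \<Sum>k\<in>F \<inter> S. (cmod (u (r n) k))\<^sup>2) \<longlonglongrightarrow> (\<Sum>k\<in>F \<inter> S. (cmod (\<phi> k))\<^sup>2)"
        using lim by (intro tendsto_intros) auto
      have "(\<Sum>k\<in>F \<inter> S. (cmod (u (r n) k))\<^sup>2) \<le> C\<^sup>2" for n
        using order_trans[OF finite_sum_le_sq_norm uC, of "r n" I "F \<inter> S"] u F by auto
      then show "\<exists>N. \<forall>n\<ge>N. (\<Sum>k\<in>F \<inter> S. (cmod (u (r n) k))\<^sup>2) \<le> C\<^sup>2" by blast
    qed
    finally show ?thesis .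
  qed
  note \<phi> = l2_of_bounded_partial_sums[OF z this]
  define x where "x n = u (r n) - \<phi>" for n
  have x: "x n \<in> l2 I" for n
    unfolding x_def using u \<phi>(1) by (intro l2_diff(1)) auto
  have \<phi>C: "l2norm \<phi> \<le> C"
    using real_sqrt_le_mono[OF \<phi>(2)] C0 by (simp add: l2norm_eq)
  \<comment> \<open>4 C is 2 (C + C), with the factor 2 of \<open>l2_diff\<close>.\<close>
  have xC: "l2norm (x n) \<le> 4 * C" for n
  proof -
    have "l2norm (u (r n)) \<le> C" using u by blast
    moreover have "l2norm (x n) \<le> 2 * (l2norm (u (r n)) + l2norm \<phi>)"
      unfolding x_def using u \<phi>(1) by (intro l2_diff(2)) auto
    ultimately show ?thesis using \<phi>C by argo
  qed
  have x0: "(\<lambda>n. x n k) \<longlonglongrightarrow> 0" if "k \<in> S" for k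
    using tendsto_diff[OF lim[OF that] tendsto_const[of "\<phi> k"]] by (simp add: x_def)
  \<comment> \<open>Weights above e concern finitely many labels, where coordinatewise convergence
    will suffice; all others contribute at most e^2 times the bound on the squared norm.\<close>
  have tail: "sq_norm (W (x n)) \<le> (\<Sum>k\<in>{k \<in> I. \<bar>w k\<bar> > e}. (cmod (W (x n) k))\<^sup>2) + e\<^sup>2 * (4 * C)\<^sup>2"
    if "e > 0" for e n
  proof (rule l2_of_bounded_partial_sums(2)[where I = I])
    show "W (x n) i = 0" if "i \<notin> I" for i
      using that by (simp add: Wapp)
    fix F assume F: "finite F" "F \<subseteq> I"
    let ?E = "{k \<in> I. \<bar>w k\<bar> > e}"
    have "(\<Sum>k\<in>F. (cmod (W (x n) k))\<^sup>2) =
        (\<Sum>k\<in>F \<inter> ?E. (cmod (W (x n) k))\<^sup>2) + (\<Sum>k\<in>F - ?E. (cmod (W (x n) k))\<^sup>2)"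
      by (rule sum.Int_Diff[OF F(1)])
    moreover have "(\<Sum>k\<in>F \<inter> ?E. (cmod (W (x n) k))\<^sup>2) \<le> (\<Sum>k\<in>?E. (cmod (W (x n) k))\<^sup>2)"
      using fin[OF that] by (intro sum_mono2) auto
    moreover have "(\<Sum>k\<in>F - ?E. (cmod (W (x n) k))\<^sup>2) \<le> e\<^sup>2 * (4 * C)\<^sup>2"
    proof -
      have "(\<Sum>k\<in>F - ?E. (cmod (W (x n) k))\<^sup>2) \<le> (\<Sum>k\<in>F - ?E. e\<^sup>2 * (cmod (x n k))\<^sup>2)"
        using F(2) that unfolding power_mult_distrib[symmetric]
        by (intro sum_mono power_mono) (auto simp: Wapp norm_mult intro!: mult_right_mono)
      also have "\<dots> \<le> e\<^sup>2 * sq_norm (x n)"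
        unfolding sum_distrib_left[symmetric] using F
        by (intro mult_left_mono finite_sum_le_sq_norm[OF x]) auto
      also have "\<dots> \<le> e\<^sup>2 * (4 * C)\<^sup>2"
        using power_mono[OF xC l2norm_nonneg, of n 2]
        by (intro mult_left_mono) (auto simp: l2norm_power2)
      finally show ?thesis .
    qed
    ultimately show "(\<Sum>k\<in>F. (cmod (W (x n) k))\<^sup>2) \<le>
        (\<Sum>k\<in>?E. (cmod (W (x n) k))\<^sup>2) + e\<^sup>2 * (4 * C)\<^sup>2" by argo
  qed
  have "(\<lambda>n. sq_norm (W (x n))) \<longlonglongrightarrow> 0"
  proof (rule tendstoI)
    fix d :: real assume d: "d > 0"
    \<comment> \<open>Chosen so that the tail is at most d / 2; the summand 1 keeps the denominator
      positive when C = 0.\<close>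
    define e where "e = sqrt (d / 2) / (4 * C + 1)"
    have e: "e > 0" using d C0 by (simp add: e_def add_nonneg_pos)
    have "(e * (4 * C))\<^sup>2 \<le> (e * (4 * C + 1))\<^sup>2"
      using e C0 by (intro power_mono mult_left_mono) auto
    also have "\<dots> = d / 2" using d C0 by (simp add: e_def)
    finally have e2: "e\<^sup>2 * (4 * C)\<^sup>2 \<le> d / 2" by (simp add: power_mult_distrib)
    have "(\<lambda>n. \<Sum>k\<in>{k \<in> I. \<bar>w k\<bar> > e}. (cmod (W (x n) k))\<^sup>2) \<longlonglongrightarrow>
        (\<Sum>k\<in>{k \<in> I. \<bar>w k\<bar> > e}. (cmod (of_real (w k) * 0))\<^sup>2)"
    proof (intro tendsto_sum tendsto_power tendsto_norm)
      fix k assume "k \<in> {k \<in> I. \<bar>w k\<bar> > e}"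
      then have "k \<in> S" "k \<in> I" using e by (auto simp: S_def)
      then show "(\<lambda>n. W (x n) k) \<longlonglongrightarrow> of_real (w k) * 0"
        using x0 by (auto simp only: Wapp if_True intro!: tendsto_intros)
    qed
    then have "\<forall>\<^sub>F n in sequentially. (\<Sum>k\<in>{k \<in> I. \<bar>w k\<bar> > e}. (cmod (W (x n) k))\<^sup>2) < d / 2"
      using d by (intro order_tendstoD) auto
    then show "\<forall>\<^sub>F n in sequentially. dist (sq_norm (W (x n))) 0 < d"
    proof eventually_elim
      case (elim n)
      then show ?case using tail[OF e, of n] e2 by simp
    qed
  qed
  then have "(\<lambda>n. l2norm (W (x n))) \<longlonglongrightarrow> 0"
    unfolding l2norm_eq using tendsto_real_sqrt by fastforce
  moreover have "W (x n) = W (u (r n)) - W \<phi>" for n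
    unfolding x_def W_def by (rule wshift_diff)
  moreover have "W \<phi> \<in> l2 I"
    using bounded_opsD(1)[OF bdd \<phi>(1)] by (simp add: W_def)
  ultimately have "norm_convergent I (\<lambda>n. W (u (r n)))"
    unfolding norm_convergent_def by auto
  then show "\<exists>r. strict_mono r \<and> norm_convergent I (\<lambda>n. wshift I (\<lambda>k. k) w (u (r n)))"
    using r(1) unfolding W_def by blast
qed

section \<open>Basis labels\<close>

text \<open>The hop is run backwards because \<open>wshift\<close> computes the source label from
  the target label.\<close>

definition hop_inv :: "real \<times> real \<Rightarrow> lm \<Rightarrow> lm" where
  "hop_inv d = (\<lambda>(l, m). (l - fst d, m - snd d))"

definition hop_inv2 :: "real \<times> real \<Rightarrow> lm + lm \<Rightarrow> lm + lm" where
  "hop_inv2 d = map_sum (hop_inv d) (hop_inv d)"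

definition hop_inv4 :: "real \<times> real \<Rightarrow> (lm + lm) + (lm + lm) \<Rightarrow> (lm + lm) + (lm + lm)" where
  "hop_inv4 d = map_sum (hop_inv2 d) (hop_inv2 d)"

text \<open>Exchanges the two summands and keeps the label. The result need not belong to the basis:
  at the lowest level the partner is missing.\<close>

definition flip :: "lm + lm \<Rightarrow> lm + lm" where
  "flip = case_sum Inr Inl"

definition flip4 :: "(lm + lm) + (lm + lm) \<Rightarrow> (lm + lm) + (lm + lm)" where
  "flip4 = map_sum flip flip"

definition label2 :: "lm + lm \<Rightarrow> lm" where
  "label2 = case_sum id id"

definition label4 :: "(lm + lm) + (lm + lm) \<Rightarrow> lm" where
  "label4 = case_sum label2 label2"

definition level :: "lm \<Rightarrow> real" where
  "level = fst"

definition ipos :: "lm \<Rightarrow> real" where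
  "ipos k = fst k + snd k"

definition jpos :: "lm \<Rightarrow> real" where
  "jpos k = fst k - snd k"

lemma label2_simps [simp]: "label2 (Inl k) = k" "label2 (Inr k) = k"
  by (simp_all add: label2_def)

lemma label4_simps [simp]: "label4 (Inl k) = label2 k" "label4 (Inr k) = label2 k"
  by (simp_all add: label4_def)

lemma flip_simps [simp]: "flip (Inl k) = Inr k" "flip (Inr k) = Inl k" "flip (flip z) = z"
    "label2 (flip z) = label2 z"
  by (auto simp: flip_def label2_def split: sum.splits)

lemma flip4_simps [simp]: "flip4 (Inl z) = Inl (flip z)" "flip4 (Inr z) = Inr (flip z)"
    "flip4 (flip4 k) = k" "label4 (flip4 k) = label4 k"
  by (auto simp: flip4_def label4_def map_sum_def split: sum.splits)

lemma hop_inv_simps [simp]: "hop_inv d (l, m) = (l - fst d, m - snd d)"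
  by (simp add: hop_inv_def)

lemma hop_inv2_simps [simp]: "hop_inv2 d (Inl k) = Inl (hop_inv d k)" "hop_inv2 d (Inr k) = Inr (hop_inv d k)"
    "label2 (hop_inv2 d z) = hop_inv d (label2 z)"
  by (auto simp: hop_inv2_def label2_def split: sum.splits)

lemma hop_inv4_simps [simp]: "hop_inv4 d (Inl z) = Inl (hop_inv2 d z)" "hop_inv4 d (Inr z) = Inr (hop_inv2 d z)"
    "label4 (hop_inv4 d k) = hop_inv d (label4 k)"
  by (auto simp: hop_inv4_def label4_def split: sum.splits)

lemma level_simps [simp]: "level (l, m) = l" "level (hop_inv d k) = level k - fst d"
  by (auto simp: level_def hop_inv_def split: prod.splits)

lemma ipos_simps [simp]: "ipos (l, m) = l + m" "ipos (hop_inv d k) = ipos k - (fst d + snd d)"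
  by (auto simp: ipos_def hop_inv_def split: prod.splits)

lemma jpos_simps [simp]: "jpos (l, m) = l - m" "jpos (hop_inv d k) = jpos k - (fst d - snd d)"
  by (auto simp: jpos_def hop_inv_def split: prod.splits)

lemma level_eq: "level k = (ipos k + jpos k) / 2"
  by (simp add: level_def ipos_def jpos_def)

lemma inj_hop_inv: "inj (hop_inv d)"
  by (auto simp: inj_def hop_inv_def)

lemma inj_hop_inv2: "inj (hop_inv2 d)"
  unfolding hop_inv2_def by (intro sum.inj_map inj_hop_inv)

lemma inj_hop_inv4: "inj (hop_inv4 d)"
  unfolding hop_inv4_def by (intro sum.inj_map inj_hop_inv2)

lemma inj_flip: "inj flip"
  by (rule inj_on_inverseI[of _ flip]) simp

lemma inj_flip4: "inj flip4"
  by (rule inj_on_inverseI[of _ flip4]) simp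

lemma flip_hop_inv2: "flip (hop_inv2 d z) = hop_inv2 d (flip z)"
  by (cases z) auto

lemma flip4_hop_inv4: "flip4 (hop_inv4 d k) = hop_inv4 d (flip4 k)"
  by (cases k) (auto simp: flip_hop_inv2)

lemma hop_inv4_commute: "hop_inv4 d (hop_inv4 d' k) = hop_inv4 d' (hop_inv4 d k)"
proof -
  have "hop_inv d (hop_inv d' k) = hop_inv d' (hop_inv d k)" for k
    by (cases k) auto
  then have "hop_inv2 d (hop_inv2 d' k) = hop_inv2 d' (hop_inv2 d k)" for k
    by (cases k) auto
  then show ?thesis by (cases k) auto
qed

text \<open>The labels are determined by the natural numbers a = l - |M| and b = l + m, which are
  bounded by R and 2 R.\<close>

lemma finite_basis_below: "finite {k \<in> basis M. level k \<le> R}"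
proof -
  have "{k \<in> basis M. level k \<le> R} \<subseteq>
      (\<lambda>(a, b). (\<bar>M\<bar> + real a, real b - \<bar>M\<bar> - real a)) ` ({..nat \<lceil>R\<rceil>} \<times> {..nat \<lceil>2 * R\<rceil>})"
  proof
    fix k assume "k \<in> {k \<in> basis M. level k \<le> R}"
    then obtain l m where k: "k = (l, m)" "l - \<bar>M\<bar> \<in> \<nat>" "l + m \<in> \<nat>" "m \<le> l" "l \<le> R"
      by (auto simp: basis_def level_def)
    obtain a b where ab: "l - \<bar>M\<bar> = real a" "l + m = real b"
      using k(2,3) by (metis Nats_cases)
    have "real a \<le> R" "real b \<le> 2 * R"
      using ab k(4,5) by (simp_all add: algebra_simps)
    then have "a \<le> nat \<lceil>R\<rceil>" "b \<le> nat \<lceil>2 * R\<rceil>"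
      by (simp_all add: le_nat_iff le_ceiling_iff)
    moreover have "k = (\<bar>M\<bar> + real a, real b - \<bar>M\<bar> - real a)"
      using ab k(1) by (simp add: algebra_simps)
    ultimately show "k \<in> (\<lambda>(a, b). (\<bar>M\<bar> + real a, real b - \<bar>M\<bar> - real a)) `
        ({..nat \<lceil>R\<rceil>} \<times> {..nat \<lceil>2 * R\<rceil>})" by force
  qed
  then show ?thesis by (rule finite_subset) simp
qed

lemma finite_basis2_below: "finite {k \<in> basis2 M. level (label2 k) \<le> R}"
proof -
  have "{k \<in> basis2 M. level (label2 k) \<le> R} \<subseteq>
      {k \<in> basis M. level k \<le> R} <+> {k \<in> basis (M + 1). level k \<le> R}"
    by (auto simp: basis2_def)
  then show ?thesis by (rule finite_subset) (simp add: finite_basis_below)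
qed

lemma finite_basis4_below: "finite {k \<in> basis4 N M. level (label4 k) \<le> R}"
proof -
  have "{k \<in> basis4 N M. level (label4 k) \<le> R} \<subseteq>
      {k \<in> basis2 N. level (label2 k) \<le> R} <+> {k \<in> basis2 M. level (label2 k) \<le> R}"
    by (auto simp: basis4_def)
  then show ?thesis by (rule finite_subset) (simp add: finite_basis2_below)
qed

text \<open>The definition of \<open>basis\<close> gives only l - m >= 0. Integrality follows from l
  - m = 2|M| + 2(l - |M|) - (l + m) and 2 M being an integer.\<close>

lemma half_integer_basis:
  assumes "half_integer M" "k \<in> basis M"
  shows "ipos k \<in> \<nat>" "jpos k \<in> \<nat>" "level k - \<bar>M\<bar> \<in> \<nat>"
proof -
  obtain l m where k: "k = (l, m)" "l - \<bar>M\<bar> \<in> \<nat>" "l + m \<in> \<nat>" "m \<le> l"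
    using assms(2) by (auto simp: basis_def)
  show "ipos k \<in> \<nat>" "level k - \<bar>M\<bar> \<in> \<nat>" using k by auto
  have "2 * \<bar>M\<bar> \<in> \<int>" using assms(1) by (auto simp: half_integer_def abs_if)
  moreover have "l - \<bar>M\<bar> \<in> \<int>" "l + m \<in> \<int>" using k Nats_subset_Ints by blast+
  ultimately have "2 * \<bar>M\<bar> + 2 * (l - \<bar>M\<bar>) - (l + m) \<in> \<int>"
    by (blast intro: Ints_diff Ints_add Ints_mult Ints_numeral)
  moreover have "2 * \<bar>M\<bar> + 2 * (l - \<bar>M\<bar>) - (l + m) = l - m" by simp
  ultimately show "jpos k \<in> \<nat>" using k by (simp add: Nats_altdef2)
qed

text \<open>Unlike the definition, this description is symmetric in i and j, so invariance of the
  basis under m -> -m is immediate.\<close>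

lemma basis_iff:
  assumes "half_integer M"
  shows "k \<in> basis M \<longleftrightarrow> ipos k \<in> \<nat> \<and> jpos k \<in> \<nat> \<and> level k - \<bar>M\<bar> \<in> \<nat>"
proof
  assume "ipos k \<in> \<nat> \<and> jpos k \<in> \<nat> \<and> level k - \<bar>M\<bar> \<in> \<nat>"
  then show "k \<in> basis M"
    by (cases k) (auto simp: basis_def Nats_altdef2)
qed (use half_integer_basis[OF assms] in blast)

lemma half_integer_plus1: "half_integer N \<Longrightarrow> half_integer (N + 1)"
  by (auto simp: half_integer_def algebra_simps intro!: Ints_add)

lemma basis2_ipos: "half_integer N \<Longrightarrow> k \<in> basis2 N \<Longrightarrow> ipos (label2 k) \<in> \<nat>"
  by (auto simp: basis2_def basis_iff half_integer_plus1)

lemma basis2_level: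
  assumes "half_integer N" "N > 0" "k \<in> basis2 N"
  shows "level (label2 k) - N \<in> \<nat>"
proof -
  have "x - (N + 1) \<in> \<nat> \<Longrightarrow> x - N \<in> \<nat>" for x :: real
    using Nats_add[OF _ Nats_1, of "x - (N + 1)"] by simp
  then show ?thesis using assms by (auto simp: basis2_def basis_iff half_integer_plus1)
qed


section \<open>Generators as sums of weighted shifts\<close>

text \<open>The entries follow the order of the summands in \<open>a_ket\<close>,
  \<open>b_ket\<close> and \<open>bs_ket\<close>, and \<open>coeffs\<close> below is aligned with
  them.\<close>

fun hops :: "podles_gen \<Rightarrow> (real \<times> real) list" where
  "hops Gen_a = [(1, 0), (- 1, 0), (0, 0)]"
| "hops Gen_b = [(1, 1), (- 1, 1), (0, 1)]"
| "hops Gen_bstar = [(- 1, - 1), (0, - 1), (1, - 1)]"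

text \<open>The matrix elements of the generators depend on the source only through \<open>i = l + m\<close>.\<close>

fun coeffs :: "real \<Rightarrow> real \<Rightarrow> podles_gen \<Rightarrow> (real \<Rightarrow> real) list" where
  "coeffs q s Gen_a =
     [\<lambda>i. s * q powr i * sqrt (1 - q powr (2 * (i + 1))),
      \<lambda>i. s * q powr (i - 1) * sqrt (1 - q powr (2 * i)),
      \<lambda>i. q powr (2 * i)]"
| "coeffs q s Gen_b =
     [\<lambda>i. s * sqrt (1 - q powr (2 * (i + 2))) * sqrt (1 - q powr (2 * (i + 1))),
      \<lambda>i. - (s * q powr (2 * i + 1)),
      \<lambda>i. q powr (i + 1) * sqrt (1 - q powr (2 * (i + 1)))]"
| "coeffs q s Gen_bstar =
     [\<lambda>i. s * sqrt (1 - q powr (2 * i)) * sqrt (1 - q powr (2 * (i - 1))),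
      \<lambda>i. q powr i * sqrt (1 - q powr (2 * i)),
      \<lambda>i. - (s * q powr (2 * i + 1))]"

abbreviation hop :: "podles_gen \<Rightarrow> nat \<Rightarrow> real \<times> real" where
  "hop x n \<equiv> hops x ! n"

abbreviation coeff :: "real \<Rightarrow> real \<Rightarrow> podles_gen \<Rightarrow> nat \<Rightarrow> real \<Rightarrow> real" where
  "coeff q s x n \<equiv> coeffs q s x ! n"

lemma less_3_cases: "n < (3::nat) \<Longrightarrow> n = 0 \<or> n = 1 \<or> n = 2"
  by auto

lemma hop_Ints:
  assumes "n < 3"
  shows "fst (hop x n) \<in> \<int>" "snd (hop x n) \<in> \<int>"
  using less_3_cases[OF assms] by (cases x; auto)+

text \<open>For P = (1 - t)(1 - u) in [0,1] one has 1 - t - u <= P <= sqrt P <= 1.\<close>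

lemma sqrt_prod_near_1:
  assumes "0 \<le> t" "t \<le> 1" "0 \<le> u" "u \<le> (1::real)"
  shows "\<bar>sqrt (1 - t) * sqrt (1 - u) - 1\<bar> \<le> t + u"
proof -
  have p: "0 \<le> (1 - t) * (1 - u)" "(1 - t) * (1 - u) \<le> 1"
    using assms by (auto intro: mult_le_one)
  have "(1 - t) * (1 - u) \<le> sqrt ((1 - t) * (1 - u))"
    using p by (intro real_le_rsqrt) (simp add: power2_eq_square mult_left_le)
  moreover have "sqrt ((1 - t) * (1 - u)) \<le> 1" using p by simp
  moreover have "1 - t - u \<le> (1 - t) * (1 - u)" using assms by (simp add: algebra_simps)
  ultimately show ?thesis by (simp add: real_sqrt_mult[symmetric])
qed

text \<open>The condition on the hop says that it leaves \<open>j = l - m\<close> unchanged.\<close>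

lemma coeff_asymptotics:
  assumes q: "0 < q" "q < 1" and s: "s > 0" and n: "n < 3"
  obtains c C where "c = 0 \<or> fst (hop x n) = snd (hop x n)" "C \<ge> 0"
    "\<And>i. i \<in> \<nat> \<Longrightarrow> \<bar>coeff q s x n i - c\<bar> \<le> C * q powr i"
proof -
  have mono: "q powr y \<le> q powr x" if "x \<le> y" for x y
    using q that by (intro powr_mono') auto
  have le1: "q powr y \<le> 1" if "0 \<le> y" for y using mono[OF that] q by simp
  have shift: "q powr (i - 1) = q powr i / q" for i using q by (simp add: powr_diff)
  have dec: "\<bar>A * q powr y * sqrt (1 - q powr z)\<bar> \<le> B * q powr i"
    if "\<bar>A\<bar> * q powr y \<le> B * q powr i" "0 \<le> z" for A B y z i
  proof -
    have "\<bar>A * q powr y * sqrt (1 - q powr z)\<bar> \<le> \<bar>A\<bar> * q powr y * 1"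
      unfolding abs_mult using le1[OF that(2)] by (intro mult_mono) auto
    then show ?thesis using that(1) by simp
  qed
  have prod: "\<bar>s * sqrt (1 - q powr y) * sqrt (1 - q powr z) - s\<bar> \<le> s * (q powr y + q powr z)"
    if "0 \<le> y" "0 \<le> z" for y z
  proof -
    have "s * sqrt (1 - q powr y) * sqrt (1 - q powr z) - s = s * (sqrt (1 - q powr y) * sqrt (1 - q powr z) - 1)"
      by (simp add: algebra_simps)
    then show ?thesis
      using sqrt_prod_near_1[of "q powr y" "q powr z"] le1 that s by (simp add: abs_mult)
  qed
  define goal where "goal c C \<longleftrightarrow> (c = 0 \<or> fst (hop x n) = snd (hop x n)) \<and> C \<ge> 0 \<and>
    (\<forall>i. 0 \<le> i \<longrightarrow> i \<in> \<nat> \<longrightarrow> \<bar>coeff q s x n i - c\<bar> \<le> C * q powr i)" for c C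
  consider "x = Gen_a" "n = 0" | "x = Gen_a" "n = 1" | "x = Gen_a" "n = 2"
    | "x = Gen_b" "n = 0" | "x = Gen_b" "n = 1" | "x = Gen_b" "n = 2"
    | "x = Gen_bstar" "n = 0" | "x = Gen_bstar" "n = 1" | "x = Gen_bstar" "n = 2"
    using n less_3_cases by (cases x) auto
  then have "\<exists>c C. goal c C"
  proof cases
    case 1
    have "goal 0 s"
      unfolding goal_def 1 using s by (auto intro!: dec)
    then show ?thesis by blast
  next
    case 2
    have "goal 0 (s / q)"
      unfolding goal_def 2
    proof (intro conjI allI impI)
      fix i :: real assume "0 \<le> i"
      then show "\<bar>coeff q s Gen_a 1 i - 0\<bar> \<le> s / q * q powr i"
        using dec[of s "i - 1" "s / q" i "2 * i"] s q by (simp add: shift)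
    qed (use s q in auto)
    then show ?thesis by blast
  next
    case 3
    have "goal 0 1"
      unfolding goal_def 3 by (auto intro!: mono)
    then show ?thesis by blast
  next
    case 4
    \<comment> \<open>The leading hop of \<open>Gen_b\<close> has limit s; each of the two square
      roots costs one q^i.\<close>
    have "goal s (s * 2)"
      unfolding goal_def 4
    proof (intro conjI allI impI)
      fix i :: real assume i: "0 \<le> i"
      have "\<bar>coeff q s Gen_b 0 i - s\<bar> \<le> s * (q powr (2 * (i + 2)) + q powr (2 * (i + 1)))"
        using prod[of "2 * (i + 2)" "2 * (i + 1)"] i by simp
      also have "\<dots> \<le> s * (q powr i + q powr i)"
        using s i by (intro mult_left_mono add_mono mono) auto
      finally show "\<bar>coeff q s Gen_b 0 i - s\<bar> \<le> s * 2 * q powr i" by simp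
    qed (use s in auto)
    then show ?thesis by blast
  next
    case 5
    have "goal 0 s"
      unfolding goal_def 5 using s by (auto intro!: mono)
    then show ?thesis by blast
  next
    case 6
    have "goal 0 1"
      unfolding goal_def 6
    proof (intro conjI allI impI)
      fix i :: real assume "0 \<le> i"
      then show "\<bar>coeff q s Gen_b 2 i - 0\<bar> \<le> 1 * q powr i"
        using dec[of 1 "i + 1" 1 i "2 * (i + 1)"] mono[of i "i + 1"] by simp
    qed auto
    then show ?thesis by blast
  next
    case 7
    have "goal s (s * (1 + 1 / q))"
      unfolding goal_def 7
    proof (intro conjI allI impI)
      fix i :: real assume i: "0 \<le> i" "i \<in> \<nat>"
      show "\<bar>coeff q s Gen_bstar 0 i - s\<bar> \<le> s * (1 + 1 / q) * q powr i"
      \<comment> \<open>At i = 0 the exponent 2 (i - 1) is negative and \<open>prod\<close> does not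
        apply, but the coefficient is 0 there and the deviation is just s. Restricting i to natural
        numbers leaves i >= 1 otherwise; the 1 / q in the constant comes from q^(i - 1).\<close>
      proof (cases "i = 0")
        case True
        then show ?thesis using s q by simp
      next
        case False
        then have i1: "1 \<le> i" using i(2) by (auto elim!: Nats_cases)
        have "\<bar>coeff q s Gen_bstar 0 i - s\<bar> \<le> s * (q powr (2 * i) + q powr (2 * (i - 1)))"
          using prod[of "2 * i" "2 * (i - 1)"] i1 by simp
        also have "\<dots> \<le> s * (q powr i + q powr (i - 1))"
          using s i1 by (intro mult_left_mono add_mono mono) auto
        finally show ?thesis by (simp add: shift algebra_simps)
      qed
    qed (use s q in auto)
    then show ?thesis by blast
  next
    case 8
    have "goal 0 1"
      unfolding goal_def 8 using dec[of 1 _ 1] by auto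
    then show ?thesis by blast
  next
    case 9
    have "goal 0 s"
      unfolding goal_def 9 using s by (auto intro!: mono)
    then show ?thesis by blast
  qed
  then obtain c C where g: "goal c C" by blast
  show thesis
  proof (rule that)
    show "c = 0 \<or> fst (hop x n) = snd (hop x n)" "C \<ge> 0" using g by (auto simp: goal_def)
    show "\<bar>coeff q s x n i - c\<bar> \<le> C * q powr i" if "i \<in> \<nat>" for i
      using g that by (simp add: goal_def Nats_altdef2)
  qed
qed

section \<open>From matrix elements to weighted shifts\<close>

lemma has_sum_sum_lessThan:
  fixes f :: "nat \<Rightarrow> 'i \<Rightarrow> complex"
  assumes "\<And>n. n < p \<Longrightarrow> (f n has_sum S n) I"
  shows "((\<lambda>i. \<Sum>n<p. f n i) has_sum (\<Sum>n<p. S n)) I"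
  using assms by (induction p) (auto intro!: has_sum_add)

text \<open>Each hop is injective, so for a fixed component every one of the p families is summable
  and the infinite sum splits.\<close>

lemma from_kets_sum_shifts:
  assumes "\<And>n i. n < p \<Longrightarrow> f n (g n i) = i" "\<And>n i. n < p \<Longrightarrow> g n (f n i) = i"
  shows "from_kets I (\<lambda>i. \<Sum>n<p. scale (of_real (u n i)) (ket I (f n i))) \<psi> =
    (\<Sum>n<(p::nat). wshift I (g n) (\<lambda>k. u n (g n k)) \<psi>)"
proof
  fix j
  have inj: "inj (f n)" if "n < p" for n
    using assms(2)[OF that] by (rule inj_on_inverseI)
  have "((\<lambda>i. \<psi> i * scale (of_real (u n i)) (ket I (f n i)) j) has_sum
      wshift I (g n) (\<lambda>k. u n (g n k)) \<psi> j) I" if n: "n < p" for n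
  proof -
    have "(\<Sum>\<^sub>\<infinity>i\<in>I. \<psi> i * scale (of_real (u n i)) (ket I (f n i)) j) =
        wshift I (g n) (\<lambda>k. u n (g n k)) \<psi> j"
      using fun_cong[OF fun_cong[OF from_kets_shift[of "f n" "g n" I "u n"]], of \<psi> j] assms[OF n]
      unfolding from_kets_def by blast
    with has_sum_infsum[OF from_kets_summable[OF inj[OF n]]] show ?thesis by metis
  qed
  then have "((\<lambda>i. \<Sum>n<p. \<psi> i * scale (of_real (u n i)) (ket I (f n i)) j) has_sum
      (\<Sum>n<p. wshift I (g n) (\<lambda>k. u n (g n k)) \<psi> j)) I"
    by (rule has_sum_sum_lessThan)
  then show "from_kets I (\<lambda>i. \<Sum>n<p. scale (of_real (u n i)) (ket I (f n i))) \<psi> j =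
      (\<Sum>n<p. wshift I (g n) (\<lambda>k. u n (g n k)) \<psi>) j"
    unfolding from_kets_def sum_fun_eq sum_distrib_left[symmetric] by (rule infsumI)
qed

definition hop_fwd :: "real \<times> real \<Rightarrow> lm \<Rightarrow> lm" where
  "hop_fwd d = (\<lambda>(l, m). (l + fst d, m + snd d))"

lemma hop_fwd_inv [simp]: "hop_fwd d (hop_inv d k) = k" "hop_inv d (hop_fwd d k) = k"
  by (auto simp: hop_fwd_def hop_inv_def split: prod.splits)

lemma lessThan_3: "(\<Sum>n<3. f n) = f 0 + f 1 + f (2::nat)"
  by (simp add: eval_nat_numeral)

lemma rep_eq:
  "rep q s M x \<psi> = (\<Sum>n<3. wshift (basis M) (hop_inv (hop x n))
     (\<lambda>k. coeff q s x n (ipos (hop_inv (hop x n) k))) \<psi>)"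
proof -
  let ?A = "\<lambda>k. \<Sum>n<3. scale (of_real (coeff q s x n (ipos k))) (ket (basis M) (hop_fwd (hop x n) k))"
  have a: "a_ket q s M k = ?A k" if "x = Gen_a" for k
    using that by (cases k) (simp only: lessThan_3 a_ket_def, simp add: hop_fwd_def)
  have b: "b_ket q s M k = ?A k" if "x = Gen_b" for k
    using that by (cases k) (simp only: lessThan_3 b_ket_def, simp add: hop_fwd_def)
  have bs: "bs_ket q s M k = ?A k" if "x = Gen_bstar" for k
    using that by (cases k) (simp only: lessThan_3 bs_ket_def, simp add: hop_fwd_def)
  have "(case x of Gen_a \<Rightarrow> a_ket q s M | Gen_b \<Rightarrow> b_ket q s M | Gen_bstar \<Rightarrow> bs_ket q s M) = ?A"
  proof
    fix k
    show "(case x of Gen_a \<Rightarrow> a_ket q s M | Gen_b \<Rightarrow> b_ket q s M | Gen_bstar \<Rightarrow> bs_ket q s M) k = ?A k"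
      using a[of k] b[of k] bs[of k] by (cases x) (simp_all only: podles_gen.case simp_thms)
  qed
  then have "rep q s M x = from_kets (basis M) ?A" unfolding rep_def by (rule arg_cong)
  then show ?thesis
    using from_kets_sum_shifts[of 3 "\<lambda>n. hop_fwd (hop x n)" "\<lambda>n. hop_inv (hop x n)" "basis M"
        "\<lambda>n k. coeff q s x n (ipos k)" \<psi>] by simp
qed

text \<open>Keeps direct sums within the class of weighted shifts, so that all later estimates can
  be made on \<open>basis2\<close> and \<open>basis4\<close> at once.\<close>

lemma dsum_wshift:
  "dsum (wshift I g v) (wshift I' g' v') = wshift (I <+> I') (map_sum g g') (case_sum v v')"
proof (intro ext)
  fix \<psi> k
  show "dsum (wshift I g v) (wshift I' g' v') \<psi> k =
      wshift (I <+> I') (map_sum g g') (case_sum v v') \<psi> k"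
    by (cases k) (auto simp: dsum_def wshift_def)
qed

lemma dsum_sum:
  "dsum (\<lambda>\<psi>. \<Sum>n\<in>A. S n \<psi>) (\<lambda>\<psi>. \<Sum>n\<in>A. T n \<psi>) \<psi> = (\<Sum>n\<in>A. dsum (S n) (T n) \<psi>)"
proof
  fix k
  show "dsum (\<lambda>\<psi>. \<Sum>n\<in>A. S n \<psi>) (\<lambda>\<psi>. \<Sum>n\<in>A. T n \<psi>) \<psi> k = (\<Sum>n\<in>A. dsum (S n) (T n) \<psi>) k"
    unfolding sum_fun_eq by (cases k) (simp_all add: dsum_def)
qed

lemma rep2_eq:
  "rep2 q s M x \<psi> = (\<Sum>n<3. wshift (basis2 M) (hop_inv2 (hop x n))
     (\<lambda>k. coeff q s x n (ipos (label2 (hop_inv2 (hop x n) k)))) \<psi>)"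
proof -
  have "rep2 q s M x \<psi> = (\<Sum>n<3. dsum
      (wshift (basis M) (hop_inv (hop x n)) (\<lambda>k. coeff q s x n (ipos (hop_inv (hop x n) k))))
      (wshift (basis (M + 1)) (hop_inv (hop x n)) (\<lambda>k. coeff q s x n (ipos (hop_inv (hop x n) k)))) \<psi>)"
    unfolding rep2_def rep_eq[abs_def] by (rule dsum_sum)
  also have "\<dots> = (\<Sum>n<3. wshift (basis2 M) (hop_inv2 (hop x n))
     (\<lambda>k. coeff q s x n (ipos (label2 (hop_inv2 (hop x n) k)))) \<psi>)"
    unfolding dsum_wshift basis2_def hop_inv2_def[symmetric]
    by (intro sum.cong refl arg_cong2[where f = "wshift _ _"] ext) (auto split: sum.splits)
  finally show ?thesis .
qed

lemma rep4_eq: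
  "rep4 q s N M x \<psi> = (\<Sum>n<3. wshift (basis4 N M) (hop_inv4 (hop x n))
     (\<lambda>k. coeff q s x n (ipos (label4 (hop_inv4 (hop x n) k)))) \<psi>)"
proof -
  have "rep4 q s N M x \<psi> = (\<Sum>n<3. dsum
      (wshift (basis2 N) (hop_inv2 (hop x n)) (\<lambda>k. coeff q s x n (ipos (label2 (hop_inv2 (hop x n) k)))))
      (wshift (basis2 M) (hop_inv2 (hop x n)) (\<lambda>k. coeff q s x n (ipos (label2 (hop_inv2 (hop x n) k))))) \<psi>)"
    unfolding rep4_def rep2_eq[abs_def] by (rule dsum_sum)
  also have "\<dots> = (\<Sum>n<3. wshift (basis4 N M) (hop_inv4 (hop x n))
     (\<lambda>k. coeff q s x n (ipos (label4 (hop_inv4 (hop x n) k)))) \<psi>)"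
    unfolding dsum_wshift basis4_def hop_inv4_def[symmetric]
    by (intro sum.cong refl arg_cong2[where f = "wshift _ _"] ext) (auto split: sum.splits)
  finally show ?thesis .
qed

lemma q_diag_eq: "q_diag q M = wshift (basis M) (\<lambda>k. k) (\<lambda>k. q powr level k)"
proof -
  have "q_diag q M = from_kets (basis M) (\<lambda>k. scale (of_real (q powr level k)) (ket (basis M) k))"
    unfolding q_diag_def by (intro arg_cong[where f = "from_kets _"]) (auto simp: fun_eq_iff)
  then show ?thesis
    using from_kets_shift[of "\<lambda>k. k" "\<lambda>k. k" "basis M" "\<lambda>k. q powr level k"] by metis
qed

lemma q_diag4_eq:
  "dsum (q_diag2 q N) (q_diag2 q M) =
    wshift (basis4 N M) (\<lambda>k. k) (\<lambda>k. q powr level (label4 k))"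
proof -
  have "map_sum (map_sum (\<lambda>k. k) (\<lambda>k. k)) (map_sum (\<lambda>k. k) (\<lambda>k. k)) = (\<lambda>k :: (lm + lm) + (lm + lm). k)"
    by (auto simp: fun_eq_iff map_sum_def split: sum.splits)
  then show ?thesis
    unfolding q_diag2_def q_diag_eq dsum_wshift basis4_def basis2_def
    by (simp only:) (intro arg_cong2[where f = "wshift _"] refl ext, auto simp: label4_def label2_def split: sum.splits)
qed

text \<open>On natural arguments a coefficient is at most |c| + C, as q^i <= 1. The factor r covers
  both uses: 1 for a generator and the displacement of l for its commutator with D.\<close>

lemma term_bounded:
  assumes "0 < q" "q < 1" "s > 0" "n < 3" "inj g" "\<And>k. k \<in> I \<Longrightarrow> ipos (lab k) \<in> \<nat>"
  shows "wshift I g (\<lambda>k. r * coeff q s x n (ipos (lab (g k)))) \<in> bounded_ops I"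
proof -
  obtain c C where c: "C \<ge> 0" "\<And>i. i \<in> \<nat> \<Longrightarrow> \<bar>coeff q s x n i - c\<bar> \<le> C * q powr i"
    using coeff_asymptotics[OF assms(1-4), of x] by metis
  have *: "\<bar>coeff q s x n i\<bar> \<le> \<bar>c\<bar> + C" if "i \<in> \<nat>" for i
  proof -
    have "q powr i \<le> q powr 0"
      using that assms by (intro powr_mono') (auto simp: Nats_altdef2)
    then have "C * q powr i \<le> C"
      using mult_left_mono[OF _ c(1), of "q powr i" 1] assms by simp
    then show ?thesis using c(2)[OF that] by argo
  qed
  show ?thesis
  proof (rule wshift_bounded[OF assms(5)])
    fix k assume "g k \<in> I"
    then show "\<bar>r * coeff q s x n (ipos (lab (g k)))\<bar> \<le> \<bar>r\<bar> * (\<bar>c\<bar> + C)"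
      unfolding abs_mult by (intro mult_left_mono * assms(6)) auto
  qed
qed

lemma rep2_bounded:
  assumes "half_integer N" "0 < q" "q < 1" "s > 0"
  shows "rep2 q s N x \<in> bounded_ops (basis2 N)"
  unfolding rep2_eq[abs_def]
proof (rule sum_bounded)
  fix n :: nat assume "n \<in> {..<3}"
  then show "wshift (basis2 N) (hop_inv2 (hop x n))
      (\<lambda>k. coeff q s x n (ipos (label2 (hop_inv2 (hop x n) k)))) \<in> bounded_ops (basis2 N)"
    using term_bounded[OF assms(2-4), of n "hop_inv2 (hop x n)" "basis2 N" label2 1 x]
      inj_hop_inv2 basis2_ipos[OF assms(1)] by simp
qed

lemma alg_span_sum:
  assumes "\<And>n. n \<in> A \<Longrightarrow> \<psi> n \<in> alg_span I"
  shows "(\<Sum>n\<in>A. \<psi> n) \<in> alg_span I"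
  using assms unfolding alg_span_def by (rule cvec.span_sum)

lemma rep2_alg_span:
  assumes "\<psi> \<in> alg_span (basis2 N)"
  shows "rep2 q s N x \<psi> \<in> alg_span (basis2 N)"
  unfolding rep2_eq by (intro alg_span_sum wshift_alg_span inj_hop_inv2 assms)


section \<open>The Dirac operator\<close>

lemma snd_swap_op: "snd (swap_op N c) = wshift (basis2 N) flip (\<lambda>k. c (level (label2 k)))"
proof -
  have "case_sum (\<lambda>(l, m). scale (of_real (c l)) (ket (basis2 N) (Inr (l, m))))
      (\<lambda>(l, m). scale (of_real (c l)) (ket (basis2 N) (Inl (l, m)))) =
      (\<lambda>k. scale (of_real (c (level (label2 k)))) (ket (basis2 N) (flip k)))"
    by (auto simp: fun_eq_iff split: sum.splits)
  then show ?thesis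
    using from_kets_shift[of flip flip "basis2 N" "\<lambda>k. c (level (label2 k))"]
    by (simp add: swap_op_def maximal_op_def)
qed

lemma fst_swap_op:
  "fst (swap_op N c) = {\<psi> \<in> l2 (basis2 N). snd (swap_op N c) \<psi> \<in> l2 (basis2 N)}"
  by (simp add: swap_op_def maximal_op_def)

lemma alg_span_subset_swap_dom: "alg_span (basis2 N) \<subseteq> fst (swap_op N c)"
  using alg_span_subset_l2 wshift_alg_span[OF inj_flip] by (fastforce simp: fst_swap_op snd_swap_op)

lemma unbounded_swap_op: "unbounded_op (basis2 N) (swap_op N c)"
proof -
  have "cvec_subspace (fst (swap_op N c))"
    unfolding cvec.subspace_def fst_swap_op snd_swap_op
    by (simp add: wshift_add wshift_scale wshift_zero l2_add(1) l2_scale(1))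
  then show ?thesis
    unfolding unbounded_op_def linear_on_subspace_def
    using alg_span_subset_swap_dom
    by (simp add: fst_swap_op snd_swap_op wshift_add wshift_scale subset_iff)
qed

section \<open>Commutators of the Dirac operator with the algebra\<close>

lemma snd_dirac: "snd (dirac N) = wshift (basis2 N) flip (\<lambda>k. level (label2 k) - N)"
  by (simp add: dirac_def snd_swap_op)

text \<open>Every label of the second summand also occurs in the first, and the first has in
  addition only the level l = N.\<close>

lemma basis2_flip:
  assumes "half_integer N" "N > 0" "k \<in> basis2 N" "flip k \<notin> basis2 N"
  shows "level (label2 k) = N"
proof (cases k)
  case (Inl z)
  then have z: "z \<in> basis N" "z \<notin> basis (N + 1)" using assms by (auto simp: basis2_def)
  then obtain t :: nat where t: "level z - N = real t"
    using assms by (auto simp: basis_iff elim!: Nats_cases)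
  have "t = 0"
  proof (rule ccontr)
    assume "t \<noteq> 0"
    then have "level z - (N + 1) = real (t - 1)" using t by (simp add: of_nat_diff)
    then have "level z - (N + 1) \<in> \<nat>" by (metis of_nat_in_Nats)
    then show False using z assms by (simp add: basis_iff half_integer_plus1)
  qed
  then show ?thesis using t Inl by simp
next
  case (Inr z)
  then have "z \<in> basis (N + 1)" using assms by (auto simp: basis2_def)
  then have "level z - (N + 1) + 1 \<in> \<nat>"
    using assms by (intro Nats_add) (auto simp: basis_iff half_integer_plus1)
  then have "z \<in> basis N"
    using \<open>z \<in> basis (N + 1)\<close> assms by (simp add: basis_iff half_integer_plus1)
  then show ?thesis using assms Inr by (auto simp: basis2_def)
qed

text \<open>
  The matrix elements of \<open>D\<close> vanish on the lowest level, where one of the two summands is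
  missing; so the boundary does not contribute to the commutator.
\<close>

lemma dirac_comm_wshift:
  assumes N: "half_integer N" "N > 0" and v: "\<And>k. v (flip k) = v k"
  shows "snd (dirac N) (wshift (basis2 N) (hop_inv2 d) v \<psi>) -
      wshift (basis2 N) (hop_inv2 d) v (snd (dirac N) \<psi>) =
    wshift (basis2 N) (hop_inv2 d \<circ> flip) (\<lambda>k. fst d * v k) \<psi>"
proof
  fix k
  let ?I = "basis2 N" and ?g = "hop_inv2 d"
  \<comment> \<open>The two products carry the factors level - N and level - fst d - N, whose
    difference is fst d. If truncation removes one of the two terms while the right-hand side
    remains, \<open>z1\<close> or \<open>z2\<close> shows that its factor was zero anyway.\<close>
  have z1: "level (label2 k) = N" if "k \<in> ?I" "flip k \<notin> ?I"
    using basis2_flip[OF N that] .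
  have z2: "level (label2 k) - fst d = N" if "flip (?g k) \<in> ?I" "?g k \<notin> ?I"
    using basis2_flip[OF N, of "flip (?g k)"] that by simp
  show "(snd (dirac N) (wshift ?I ?g v \<psi>) - wshift ?I ?g v (snd (dirac N) \<psi>)) k =
      wshift ?I (?g \<circ> flip) (\<lambda>k. fst d * v k) \<psi> k"
    using z1 z2 unfolding snd_dirac
    by (auto simp: wshift_def v flip_hop_inv2[symmetric] algebra_simps)
qed

text \<open>An explicit formula on all coefficient families, which serves as the bounded extension
  of the commutator from the algebraic span.\<close>

definition dirac_comm :: "real \<Rightarrow> real \<Rightarrow> real \<Rightarrow> podles_gen \<Rightarrow> (lm + lm) oper" where
  "dirac_comm q s N x \<psi> = (\<Sum>n<3. wshift (basis2 N) (hop_inv2 (hop x n) \<circ> flip)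
     (\<lambda>k. fst (hop x n) * coeff q s x n (ipos (label2 (hop_inv2 (hop x n) k)))) \<psi>)"

lemma dirac_comm_eq:
  assumes "half_integer N" "N > 0"
  shows "snd (dirac N) (rep2 q s N x \<psi>) - rep2 q s N x (snd (dirac N) \<psi>) = dirac_comm q s N x \<psi>"
proof -
  have "snd (dirac N) (rep2 q s N x \<psi>) = (\<Sum>n<3. snd (dirac N) (wshift (basis2 N) (hop_inv2 (hop x n))
     (\<lambda>k. coeff q s x n (ipos (label2 (hop_inv2 (hop x n) k)))) \<psi>))"
    unfolding rep2_eq snd_dirac by (rule wshift_sum)
  then show ?thesis
    unfolding rep2_eq[of q s N x "snd (dirac N) \<psi>"] dirac_comm_def
    by (simp only: sum_subtractf[symmetric])
      (intro sum.cong refl dirac_comm_wshift[OF assms]; simp)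
qed

lemma dirac_comm_bounded:
  assumes "half_integer N" "0 < q" "q < 1" "s > 0"
  shows "dirac_comm q s N x \<in> bounded_ops (basis2 N)"
  unfolding dirac_comm_def[abs_def]
proof (rule sum_bounded)
  fix n :: nat assume "n \<in> {..<3}"
  then show "wshift (basis2 N) (hop_inv2 (hop x n) \<circ> flip)
     (\<lambda>k. fst (hop x n) * coeff q s x n (ipos (label2 (hop_inv2 (hop x n) k)))) \<in> bounded_ops (basis2 N)"
    using term_bounded[OF assms(2-4), of n "hop_inv2 (hop x n) \<circ> flip" "basis2 N" label2
        "fst (hop x n)" x] inj_compose[OF inj_hop_inv2 inj_flip] basis2_ipos[OF assms(1)] by simp
qed

lemma is_bounded_comm_dirac:
  assumes "half_integer N" "N > 0" "0 < q" "q < 1" "s > 0"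
  shows "is_bounded_comm (basis2 N) (dirac N) (rep2 q s N x) (dirac_comm q s N x)"
  unfolding is_bounded_comm_def
proof (intro conjI ballI)
  show "dirac_comm q s N x \<in> bounded_ops (basis2 N)"
    using assms by (intro dirac_comm_bounded)
  fix \<psi> assume "\<psi> \<in> alg_span (basis2 N)"
  then show "rep2 q s N x \<psi> \<in> fst (dirac N)"
    using rep2_alg_span alg_span_subset_swap_dom unfolding dirac_def by blast
  show "dirac_comm q s N x \<psi> = snd (dirac N) (rep2 q s N x \<psi>) - rep2 q s N x (snd (dirac N) \<psi>)"
    using dirac_comm_eq[OF assms(1,2)] by metis
qed

text \<open>Induction over the algebra with the claim strengthened by boundedness of x and
  invariance of the span. Products use the Leibniz rule [D, xy] = [D, x] y + x [D, y], which needs y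
  to preserve the span and x to be bounded.\<close>

lemma dirac_bounded_comms:
  assumes "half_integer N" "N > 0" "0 < q" "q < 1" "s > 0"
  shows "has_bounded_comms q s N (dirac N)"
proof -
  let ?I = "basis2 N" and ?D = "snd (dirac N)"
  have D_span: "?D \<psi> \<in> alg_span ?I" if "\<psi> \<in> alg_span ?I" for \<psi>
    unfolding snd_dirac using inj_flip that by (rule wshift_alg_span)
  have sub: "alg_span ?I \<subseteq> fst (dirac N)" unfolding dirac_def by (rule alg_span_subset_swap_dom)
  have sl: "\<psi> \<in> l2 ?I" if "\<psi> \<in> alg_span ?I" for \<psi> using that alg_span_subset_l2 by blast
  have sp: "cvec_subspace (alg_span ?I)"
    unfolding alg_span_def by (rule cvec.subspace_span)
  have "x \<in> bounded_ops ?I \<and> (\<forall>\<psi>\<in>alg_span ?I. x \<psi> \<in> alg_span ?I) \<and>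
      (\<exists>C. is_bounded_comm ?I (dirac N) x C)" if "x \<in> rep_algebra q s N" for x
    using that unfolding rep_algebra_def
  proof induction
    case (gen x)
    then show ?case
      using rep2_bounded[OF assms(1,3-5)] rep2_alg_span is_bounded_comm_dirac[OF assms] by blast
  next
    case one
    have "(\<lambda>\<psi>. 0) \<in> bounded_ops ?I"
      using scale_bounded[OF id_bounded, of 0 ?I] by simp
    then have "is_bounded_comm ?I (dirac N) id (\<lambda>\<psi>. 0)"
      using sub by (auto simp: is_bounded_comm_def)
    then show ?case using id_bounded[of ?I] by (metis id_apply)
  next
    case (add x y)
    then obtain C C' where C: "is_bounded_comm ?I (dirac N) x C" "is_bounded_comm ?I (dirac N) y C'"
      by blast
    have span: "x \<psi> + y \<psi> \<in> alg_span ?I" if "\<psi> \<in> alg_span ?I" for \<psi>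
      using add.IH that cvec.subspace_add[OF sp] by blast
    have "is_bounded_comm ?I (dirac N) (\<lambda>\<psi>. x \<psi> + y \<psi>) (\<lambda>\<psi>. C \<psi> + C' \<psi>)"
      unfolding is_bounded_comm_def
    proof (intro conjI ballI)
      show "(\<lambda>\<psi>. C \<psi> + C' \<psi>) \<in> bounded_ops ?I"
        using C by (intro add_bounded) (auto simp: is_bounded_comm_def)
      fix \<psi> assume \<psi>: "\<psi> \<in> alg_span ?I"
      show "x \<psi> + y \<psi> \<in> fst (dirac N)" using span[OF \<psi>] sub by blast
      have "C \<psi> = ?D (x \<psi>) - x (?D \<psi>)" "C' \<psi> = ?D (y \<psi>) - y (?D \<psi>)"
        using C \<psi> by (auto simp: is_bounded_comm_def)
      moreover have "?D (x \<psi> + y \<psi>) = ?D (x \<psi>) + ?D (y \<psi>)"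
        unfolding snd_dirac by (rule wshift_add)
      ultimately show "C \<psi> + C' \<psi> = ?D (x \<psi> + y \<psi>) - (x (?D \<psi>) + y (?D \<psi>))"
        by (simp only: add_diff_add)
    qed
    then show ?case using add.IH span add_bounded by blast
  next
    case (scale x c)
    then obtain C where C: "is_bounded_comm ?I (dirac N) x C" by blast
    have span: "scale c (x \<psi>) \<in> alg_span ?I" if "\<psi> \<in> alg_span ?I" for \<psi>
      using scale.IH that cvec.subspace_scale[OF sp] by blast
    have "is_bounded_comm ?I (dirac N) (\<lambda>\<psi>. scale c (x \<psi>)) (\<lambda>\<psi>. scale c (C \<psi>))"
      unfolding is_bounded_comm_def
    proof (intro conjI ballI)
      show "(\<lambda>\<psi>. scale c (C \<psi>)) \<in> bounded_ops ?I"
        using C by (intro scale_bounded) (auto simp: is_bounded_comm_def)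
      fix \<psi> assume \<psi>: "\<psi> \<in> alg_span ?I"
      show "scale c (x \<psi>) \<in> fst (dirac N)" using span[OF \<psi>] sub by blast
      have "C \<psi> = ?D (x \<psi>) - x (?D \<psi>)"
        using C \<psi> by (auto simp: is_bounded_comm_def)
      moreover have "?D (scale c (x \<psi>)) = scale c (?D (x \<psi>))"
        unfolding snd_dirac by (rule wshift_scale)
      ultimately show "scale c (C \<psi>) = ?D (scale c (x \<psi>)) - scale c (x (?D \<psi>))"
        by (simp only: cvec.scale_right_diff_distrib)
    qed
    then show ?case using scale.IH span scale_bounded by blast
  next
    case (mult x y)
    then obtain C C' where C: "is_bounded_comm ?I (dirac N) x C" "is_bounded_comm ?I (dirac N) y C'"
      by blast
    have x: "x \<in> bounded_ops ?I" and y: "y \<in> bounded_ops ?I" using mult.IH by blast+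
    have xs: "x \<psi> \<in> alg_span ?I" and ys: "y \<psi> \<in> alg_span ?I" if "\<psi> \<in> alg_span ?I" for \<psi>
      using mult.IH that by blast+
    have "is_bounded_comm ?I (dirac N) (x \<circ> y) (\<lambda>\<psi>. (C \<circ> y) \<psi> + (x \<circ> C') \<psi>)"
      unfolding is_bounded_comm_def
    proof (intro conjI ballI)
      show "(\<lambda>\<psi>. (C \<circ> y) \<psi> + (x \<circ> C') \<psi>) \<in> bounded_ops ?I"
        using C x y by (intro add_bounded comp_bounded) (auto simp: is_bounded_comm_def)
      fix \<psi> assume \<psi>: "\<psi> \<in> alg_span ?I"
      show "(x \<circ> y) \<psi> \<in> fst (dirac N)" using xs ys \<psi> sub by auto
      have "C (y \<psi>) = ?D (x (y \<psi>)) - x (?D (y \<psi>))" "C' \<psi> = ?D (y \<psi>) - y (?D \<psi>)"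
        using C \<psi> ys[OF \<psi>] by (auto simp: is_bounded_comm_def)
      \<comment> \<open>x is known to be linear only on l2; both arguments lie in the span, hence in
        l2.\<close>
      moreover have "x (?D (y \<psi>) - y (?D \<psi>)) = x (?D (y \<psi>)) - x (y (?D \<psi>))"
        using \<psi> by (intro bounded_ops_diff[OF x] sl D_span ys)
      ultimately show "(C \<circ> y) \<psi> + (x \<circ> C') \<psi> = ?D ((x \<circ> y) \<psi>) - (x \<circ> y) (?D \<psi>)"
        by (simp only: o_apply) simp
    qed
    moreover have "(x \<circ> y) \<psi> \<in> alg_span ?I" if "\<psi> \<in> alg_span ?I" for \<psi>
      unfolding o_apply by (intro xs ys that)
    ultimately show ?case using comp_bounded[OF x y] by blast
  qed
  then show ?thesis unfolding has_bounded_comms_def by blast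
qed

section \<open>Commutators in the ideal of exponential decay\<close>

text \<open>The shift factors as Q o A, where A is the shift with weights v / q^w, bounded by
  hypothesis.\<close>

lemma wshift_in_op_ideal:
  assumes "0 < q" "inj g" "\<And>k. k \<in> I \<Longrightarrow> g k \<in> I \<Longrightarrow> \<bar>v k\<bar> \<le> C * q powr w k"
  shows "wshift I g v \<in> op_ideal I (wshift I (\<lambda>k. k) (\<lambda>k. q powr w k))"
proof -
  let ?Q = "wshift I (\<lambda>k. k) (\<lambda>k. q powr w k)" and ?A = "wshift I g (\<lambda>k. v k / q powr w k)"
  have "?A \<in> bounded_ops I"
  proof (rule wshift_bounded[OF assms(2)])
    fix k assume "k \<in> I" "g k \<in> I"
    then show "\<bar>v k / q powr w k\<bar> \<le> C"
      using assms(1) assms(3)[of k] by (simp add: abs_divide divide_le_eq)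
  qed
  then have QA: "?Q \<circ> ?A \<in> op_ideal I ?Q"
    by (rule op_ideal.right[OF _ op_ideal.gen])
  have "wshift I g v \<psi> = (?Q \<circ> ?A) \<psi>" for \<psi>
    using assms(1) by (auto simp: wshift_def fun_eq_iff simp flip: of_real_mult)
  then show ?thesis by (rule op_ideal.cong[OF QA])
qed

lemma op_ideal_sum:
  assumes "0 < q" "\<And>n. n < (p::nat) \<Longrightarrow> T n \<in> op_ideal I (wshift I (\<lambda>k. k) (\<lambda>k. q powr w k))"
  shows "(\<lambda>\<psi>. \<Sum>n<p. T n \<psi>) \<in> op_ideal I (wshift I (\<lambda>k. k) (\<lambda>k. q powr w k))"
  using assms(2)
proof (induction p)
  case 0
  \<comment> \<open>The zero operator is not provided by a rule of the ideal; it is the shift with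
    zero weights.\<close>
  have z: "wshift I (\<lambda>k. k) (\<lambda>k. 0) \<in> op_ideal I (wshift I (\<lambda>k. k) (\<lambda>k. q powr w k))"
    using assms(1) by (rule wshift_in_op_ideal[where C = 0]) auto
  have "(\<Sum>n<0. T n \<psi>) = wshift I (\<lambda>k. k) (\<lambda>k. 0) \<psi>" for \<psi>
    by (simp add: wshift_def fun_eq_iff)
  then show ?case by (rule op_ideal.cong[OF z])
next
  case (Suc p)
  have "(\<lambda>\<psi>. (\<Sum>n<p. T n \<psi>) + T p \<psi>) \<in> op_ideal I (wshift I (\<lambda>k. k) (\<lambda>k. q powr w k))"
    using Suc by (intro op_ideal.add) auto
  then show ?case unfolding sum.lessThan_Suc .
qed

text \<open>
  Here \<open>f\<close> is a coefficient of a generator and \<open>f'\<close> one of a conjugated generator, with shifts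
  \<open>(p, r)\<close> and \<open>(p', r')\<close> of the pair \<open>(i, j)\<close>; \<open>G\<close> and \<open>H\<close> say that the intermediate label
  belongs to the basis. The limits \<open>c\<close> and \<open>c'\<close> of the coefficients commute, and each remaining
  contribution decays in \<open>i\<close> and in \<open>j\<close>.
\<close>

lemma cross_commutator_decay:
  fixes f f' :: "real \<Rightarrow> real"
  assumes q: "0 < q" "q < 1"
    and c: "c = 0 \<or> r = 0" "C \<ge> 0" "\<And>i. i \<in> \<nat> \<Longrightarrow> \<bar>f i - c\<bar> \<le> C * q powr i"
    and c': "c' = 0 \<or> p' = 0" "C' \<ge> 0" "\<And>j. j \<in> \<nat> \<Longrightarrow> \<bar>f' j - c'\<bar> \<le> C' * q powr j"
  obtains K where "\<And>i j G H. 0 \<le> i \<Longrightarrow> 0 \<le> j \<Longrightarrow> i - p - p' \<in> \<nat> \<Longrightarrow> j - r - r' \<in> \<nat> \<Longrightarrow>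
      (G \<Longrightarrow> i - p \<in> \<nat>) \<Longrightarrow> (H \<Longrightarrow> j - r' \<in> \<nat>) \<Longrightarrow>
      (\<not> G \<Longrightarrow> i - p < 0 \<or> j - r < 0 \<or> i + j \<le> B) \<Longrightarrow>
      (\<not> H \<Longrightarrow> i - p' < 0 \<or> j - r' < 0 \<or> i + j \<le> B) \<Longrightarrow>
      \<bar>(if H then f' (j - r') * f (i - p - p') else 0) - (if G then f (i - p) * f' (j - r - r') else 0)\<bar>
        \<le> K * q powr (i + j)"
proof -
  \<comment> \<open>R exceeds every displacement and the threshold B, so all shifted arguments are
    at least i - R or j - R. Each of the two products will be bounded by A A' q^(i - R) q^(j - R),
    which explains the factors 2 and q^(-2R) in K.\<close>
  define R where "R = \<bar>p\<bar> + \<bar>p'\<bar> + \<bar>r\<bar> + \<bar>r'\<bar> + \<bar>B\<bar>"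
  define A where "A = \<bar>c\<bar> + C"
  define A' where "A' = \<bar>c'\<bar> + C'"
  define K where "K = 2 * A * A' * q powr (- 2 * R)"
  have A0: "0 \<le> A" "C \<le> A" and A0': "0 \<le> A'" "C' \<le> A'" using c(2) c'(2) by (auto simp: A_def A'_def)
  have mono: "q powr y \<le> q powr x" if "x \<le> y" for x y
    using q that by (intro powr_mono') auto
  have ge1: "1 \<le> q powr x" if "x \<le> 0" for x using mono[OF that] q by simp
  have le1: "q powr x \<le> 1" if "0 \<le> x" for x using mono[OF that] q by simp
  have fA: "\<bar>f x\<bar> \<le> A" if "x \<in> \<nat>" for x
  proof -
    have "C * q powr x \<le> C" using le1[of x] that c(2) by (simp add: mult_left_le Nats_altdef2)
    then show ?thesis using c(3)[OF that] unfolding A_def by argo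
  qed
  have fA': "\<bar>f' x\<bar> \<le> A'" if "x \<in> \<nat>" for x
  proof -
    have "C' * q powr x \<le> C'" using le1[of x] that c'(2) by (simp add: mult_left_le Nats_altdef2)
    then show ?thesis using c'(3)[OF that] unfolding A'_def by argo
  qed
  show thesis
  proof (rule that[of K])
    fix i j G H
    assume ij: "0 \<le> i" "0 \<le> j" "i - p - p' \<in> \<nat>" "j - r - r' \<in> \<nat>"
      and G: "G \<Longrightarrow> i - p \<in> \<nat>" "\<not> G \<Longrightarrow> i - p < 0 \<or> j - r < 0 \<or> i + j \<le> B"
      and H: "H \<Longrightarrow> j - r' \<in> \<nat>" "\<not> H \<Longrightarrow> i - p' < 0 \<or> j - r' < 0 \<or> i + j \<le> B"
    define Ei where "Ei = q powr (i - R)"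
    define Ej where "Ej = q powr (j - R)"
    define M where "M = A * A' * (Ei * Ej)"
    have KM: "K * q powr (i + j) = 2 * M"
    proof -
      have "q powr (- 2 * R) * q powr (i + j) = Ei * Ej"
        unfolding Ei_def Ej_def powr_add[symmetric] by (simp add: algebra_simps)
      then show ?thesis by (simp add: K_def M_def mult.assoc)
    qed
    have E0: "0 \<le> Ei" "0 \<le> Ej" by (simp_all add: Ei_def Ej_def)
    have M0: "0 \<le> M" using A0 A0' E0 by (simp add: M_def)
    have fE: "\<bar>f x - c\<bar> \<le> A * Ei" if "x \<in> \<nat>" "i - R \<le> x" for x
      using c(3)[OF that(1)] mult_mono[OF A0(2) mono[OF that(2)]] A0 c(2) unfolding Ei_def by fastforce
    have fE': "\<bar>f' x - c'\<bar> \<le> A' * Ej" if "x \<in> \<nat>" "j - R \<le> x" for x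
      using c'(3)[OF that(1)] mult_mono[OF A0'(2) mono[OF that(2)]] A0' c'(2) unfolding Ej_def by fastforce
    have R: "i - R \<le> i - p" "i - R \<le> i - p - p'" "j - R \<le> j - r'" "j - R \<le> j - r - r'"
      by (auto simp: R_def)
    have prodM: "\<bar>x * y\<bar> \<le> M" "\<bar>y * x\<bar> \<le> M" if "\<bar>x\<bar> \<le> A * Ei" "\<bar>y\<bar> \<le> A' * Ej" for x y
    proof -
      have "\<bar>x * y\<bar> \<le> (A * Ei) * (A' * Ej)"
        unfolding abs_mult using that A0 E0 by (intro mult_mono) auto
      then show "\<bar>x * y\<bar> \<le> M" "\<bar>y * x\<bar> \<le> M" by (simp_all add: M_def mult_ac)
    qed
    show "\<bar>(if H then f' (j - r') * f (i - p - p') else 0) -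
        (if G then f (i - p) * f' (j - r - r') else 0)\<bar> \<le> K * q powr (i + j)"
    proof (cases "G \<and> H")
      case True
      then have n: "i - p \<in> \<nat>" "j - r' \<in> \<nat>" using G H by auto
      note F1 = fE[OF n(1) R(1)] and F2 = fE[OF ij(3) R(2)]
        and G1 = fE'[OF n(2) R(3)] and G2 = fE'[OF ij(4) R(4)]
      have "\<bar>f' (j - r') * f (i - p - p') - f (i - p) * f' (j - r - r')\<bar> \<le> 2 * M"
      proof (cases "c = 0")
        case c0: True
        show ?thesis
        proof (cases "c' = 0")
          case True
          have "\<bar>f' (j - r') * f (i - p - p')\<bar> \<le> M" "\<bar>f (i - p) * f' (j - r - r')\<bar> \<le> M"
            using prodM(2)[of "f (i - p - p')" "f' (j - r')"]
              prodM(1)[of "f (i - p)" "f' (j - r - r')"] F1 F2 G1 G2 c0 True by simp_all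
          then show ?thesis by argo
        next
          case False
          then have p': "p' = 0" using c' by blast
          \<comment> \<open>With p' = 0 both products contain f (i - p), so c' cancels and only
            deviations from the limits remain.\<close>
          have "f' (j - r') * f (i - p - p') - f (i - p) * f' (j - r - r') =
              f (i - p) * (f' (j - r') - c') - f (i - p) * (f' (j - r - r') - c')"
            by (simp add: p' algebra_simps)
          moreover have "\<bar>f (i - p) * (f' (j - r') - c')\<bar> \<le> M"
            "\<bar>f (i - p) * (f' (j - r - r') - c')\<bar> \<le> M"
            using F1 G1 G2 c0 by (auto intro!: prodM(1))
          ultimately show ?thesis by argo
        qed
      next
        case False
        then have r: "r = 0" using c by blast
        show ?thesis
        proof (cases "p' = 0")
          case True
          \<comment> \<open>With r = 0 and p' = 0 the two products are equal.\<close>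
          then show ?thesis using M0 by (simp add: r mult.commute)
        next
          case False
          then have c0': "c' = 0" using c' by blast
          have "f' (j - r') * f (i - p - p') - f (i - p) * f' (j - r - r') =
              f' (j - r') * (f (i - p - p') - c) - f' (j - r') * (f (i - p) - c)"
            by (simp add: r algebra_simps)
          moreover have "\<bar>f' (j - r') * (f (i - p - p') - c)\<bar> \<le> M"
            "\<bar>f' (j - r') * (f (i - p) - c)\<bar> \<le> M"
            using F1 F2 G1 c0' by (auto intro!: prodM(2))
          ultimately show ?thesis by argo
        qed
      qed
      then show ?thesis using True KM by simp
    next
      case False
      have nn: "0 \<le> i - p - p'" "0 \<le> j - r - r'" using ij by (auto simp: Nats_altdef2)
      \<comment> \<open>If an intermediate i-coordinate is negative while i and i - p - p' are not,
        then p' cannot be 0, hence c' = 0, and i is below a displacement. The same holds for j with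
        r and c. The remaining way to leave the basis has i + j <= B.\<close>
      have "(c' = 0 \<and> i \<le> R) \<or> (c = 0 \<and> j \<le> R) \<or> i + j \<le> R"
      proof -
        have "(p' \<noteq> 0 \<and> i \<le> R) \<or> (r \<noteq> 0 \<and> j \<le> R) \<or> i + j \<le> R"
          using False G(2) H(2) nn ij(1,2) unfolding R_def by auto
        then show ?thesis using c(1) c'(1) by blast
      qed
      \<comment> \<open>In a bounded coordinate the factor \<open>Ei\<close> or \<open>Ej\<close> is
        at least 1, so the plain bound A or A' already has the required form there; the limit in the
        other coordinate is zero, which supplies the decay.\<close>
      then have bnd: "\<bar>f x * f' y\<bar> \<le> M"
        if x: "x \<in> \<nat>" "i - R \<le> x" and y: "y \<in> \<nat>" "j - R \<le> y" for x y
      proof (elim disjE conjE)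
        assume "c' = 0" "i \<le> R"
        then have "1 \<le> Ei" using ge1[of "i - R"] by (simp add: Ei_def)
        then have "\<bar>f x\<bar> \<le> A * Ei" using fA[OF x(1)] mult_left_mono[of 1 Ei A] A0 by simp
        then show ?thesis using fE'[OF y] \<open>c' = 0\<close> by (intro prodM(1)) auto
      next
        assume "c = 0" "j \<le> R"
        then have "1 \<le> Ej" using ge1[of "j - R"] by (simp add: Ej_def)
        then have "\<bar>f' y\<bar> \<le> A' * Ej" using fA'[OF y(1)] mult_left_mono[of 1 Ej A'] A0' by simp
        then show ?thesis using fE[OF x] \<open>c = 0\<close> by (intro prodM(1)) auto
      next
        assume "i + j \<le> R"
        moreover have "0 \<le> R" by (simp add: R_def)
        ultimately have "1 \<le> Ei * Ej"
          using ge1[of "(i - R) + (j - R)"] by (simp add: Ei_def Ej_def powr_add[symmetric])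
        then have "A * A' * 1 \<le> M" unfolding M_def using A0 A0' by (intro mult_left_mono) auto
        moreover have "\<bar>f x * f' y\<bar> \<le> A * A'"
          unfolding abs_mult using fA[OF x(1)] fA'[OF y(1)] A0 by (intro mult_mono) auto
        ultimately show ?thesis by simp
      qed
      have "\<bar>if H then f' (j - r') * f (i - p - p') else 0\<bar> \<le> M"
        using bnd[OF ij(3) R(2) _ R(3)] H(1) M0 by (auto simp: mult.commute)
      moreover have "\<bar>if G then f (i - p) * f' (j - r - r') else 0\<bar> \<le> M"
        using bnd[OF _ R(1) ij(4) R(4)] G(1) M0 by auto
      ultimately show ?thesis unfolding KM by argo
    qed
  qed
qed

text \<open>The coordinates of z' are integral, so only a sign condition can fail: i, j, or the
  lower bound on l, for which the larger value N + 1 is used in both summands. z' need not be in the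
  same summand as z, so that hops combined with \<open>flip\<close> are included.\<close>

lemma leave_basis2:
  assumes N: "half_integer N" "N > 0" and d: "fst d \<in> \<int>" "snd d \<in> \<int>"
    and z: "z \<in> basis2 N" "label2 z' = hop_inv d (label2 z)" "z' \<notin> basis2 N"
  shows "ipos (label2 z') < 0 \<or> jpos (label2 z') < 0 \<or>
    ipos (label2 z) + jpos (label2 z) \<le> 2 * (N + 1 + \<bar>fst d\<bar>)"
proof -
  have lev: "level (label2 z) - N \<in> \<int>"
    using basis2_level[OF N z(1)] Nats_subset_Ints by blast
  have "ipos (label2 z) \<in> \<int>" "jpos (label2 z) \<in> \<int>"
    using z(1) N Nats_subset_Ints by (auto simp: basis2_def basis_iff half_integer_plus1)
  then have ij: "ipos (label2 z') \<in> \<int>" "jpos (label2 z') \<in> \<int>"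
    using d by (auto simp: z(2))
  have l': "level (label2 z') - N \<in> \<int>" "level (label2 z') - (N + 1) \<in> \<int>"
  proof -
    have "level (label2 z') - N = (level (label2 z) - N) - fst d"
      "level (label2 z') - (N + 1) = (level (label2 z) - N) - fst d - 1" by (simp_all add: z(2))
    then show "level (label2 z') - N \<in> \<int>" "level (label2 z') - (N + 1) \<in> \<int>"
      using lev d by (metis Ints_diff, metis Ints_diff Ints_1)
  qed
  have "ipos (label2 z') < 0 \<or> jpos (label2 z') < 0 \<or> level (label2 z') < N + 1"
  proof (cases z')
    case (Inl w)
    then have "w \<notin> basis N" using z(3) by (auto simp: basis2_def)
    then show ?thesis using ij l' N Inl by (auto simp: basis_iff Nats_altdef2)
  next
    case (Inr w)
    then have "w \<notin> basis (N + 1)" using z(3) by (auto simp: basis2_def)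
    then show ?thesis using ij l' N Inr by (auto simp: basis_iff half_integer_plus1 Nats_altdef2)
  qed
  moreover have "ipos (label2 z) + jpos (label2 z) = 2 * level (label2 z)"
    by (simp add: level_def ipos_def jpos_def)
  moreover have "level (label2 z') = level (label2 z) - fst d" by (simp add: z(2))
  ultimately show ?thesis by argo
qed

lemma leave_basis4:
  assumes N: "half_integer N" "N > 0" and d: "fst d \<in> \<int>" "snd d \<in> \<int>"
    and k: "k \<in> basis4 N N" "label4 k' = hop_inv d (label4 k)" "isl k' = isl k" "k' \<notin> basis4 N N"
  shows "ipos (label4 k') < 0 \<or> jpos (label4 k') < 0 \<or>
    ipos (label4 k) + jpos (label4 k) \<le> 2 * (N + 1 + \<bar>fst d\<bar>)"
  using k leave_basis2[OF N d] by (cases k; cases k') (auto simp: basis4_def)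

lemma basis4_pos:
  assumes "half_integer N" "k \<in> basis4 N N"
  shows "ipos (label4 k) \<in> \<nat>" "jpos (label4 k) \<in> \<nat>"
  using assms by (auto simp: basis4_def basis2_def basis_iff half_integer_plus1)

abbreviation decay4 :: "real \<Rightarrow> real \<Rightarrow> ((lm + lm) + (lm + lm)) oper" where
  "decay4 q N \<equiv> wshift (basis4 N N) (\<lambda>k. k) (\<lambda>k. q powr level (label4 k))"

text \<open>g is kept abstract, being a hop for a generator and a hop followed by an exchange of
  summands for its commutator with D. Only its effect on labels and its commuting with hops
  matter.\<close>

lemma cross_commutator_in_ideal:
  fixes N q s r :: real and x y :: podles_gen and n n' :: nat
  defines "d \<equiv> hop y n" and "d' \<equiv> (fst (hop x n'), - snd (hop x n'))"
  assumes N: "half_integer N" "N > 0" and q: "0 < q" "q < 1" and s: "s > 0" and n: "n < 3" "n' < 3"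
    and g: "inj g" "\<And>k. label4 (g k) = hop_inv d (label4 k)" "\<And>k. isl (g k) = isl k"
      "\<And>k. g (hop_inv4 d' k) = hop_inv4 d' (g k)"
  defines "X \<equiv> wshift (basis4 N N) (hop_inv4 d') (\<lambda>k. coeff q s x n' (jpos (label4 (hop_inv4 d' k))))"
    and "Y \<equiv> wshift (basis4 N N) g (\<lambda>k. r * coeff q s y n (ipos (label4 (g k))))"
  shows "(\<lambda>\<psi>. X (Y \<psi>) - Y (X \<psi>)) \<in> op_ideal (basis4 N N) (decay4 q N)"
proof -
  let ?I = "basis4 N N" and ?h = "hop_inv4 d'"
  obtain c C where c: "c = 0 \<or> fst d = snd d" "C \<ge> 0"
    "\<And>i. i \<in> \<nat> \<Longrightarrow> \<bar>coeff q s y n i - c\<bar> \<le> C * q powr i"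
    using coeff_asymptotics[OF q s n(1), of y] unfolding d_def by metis
  obtain c' C' where c': "c' = 0 \<or> fst (hop x n') = snd (hop x n')" "C' \<ge> 0"
    "\<And>i. i \<in> \<nat> \<Longrightarrow> \<bar>coeff q s x n' i - c'\<bar> \<le> C' * q powr i"
    using coeff_asymptotics[OF q s n(2), of x] by metis
  have dZ: "fst d \<in> \<int>" "snd d \<in> \<int>" "fst d' \<in> \<int>" "snd d' \<in> \<int>"
    using hop_Ints n by (auto simp: d_def d'_def)
  define f where "f = (\<lambda>i. r * coeff q s y n i)"
  define f' where "f' = coeff q s x n'"
  define p where "p = fst d + snd d"
  define t where "t = fst d - snd d"
  define p' where "p' = fst d' + snd d'"
  define t' where "t' = fst d' - snd d'"
  \<comment> \<open>The sum of the thresholds of \<open>leave_basis4\<close> for the two hops, so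
    that a single B serves both.\<close>
  define B where "B = 2 * (N + 1 + \<bar>fst d\<bar>) + 2 * (N + 1 + \<bar>fst d'\<bar>)"
  \<comment> \<open>Because d' is mirrored, p' is the displacement of j under the original hop of x;
    the alternative for the limit of x thus becomes a condition on p'.\<close>
  have pre1: "r * c = 0 \<or> t = 0" "\<bar>r\<bar> * C \<ge> 0" "c' = 0 \<or> p' = 0"
    using c(1,2) c'(1) by (auto simp: t_def p'_def d'_def)
  have pre2: "\<bar>f i - r * c\<bar> \<le> \<bar>r\<bar> * C * q powr i" if "i \<in> \<nat>" for i
  proof -
    have "\<bar>f i - r * c\<bar> = \<bar>r\<bar> * \<bar>coeff q s y n i - c\<bar>"
      by (simp add: f_def abs_mult[symmetric] algebra_simps)
    then show ?thesis using mult_left_mono[OF c(3)[OF that], of "\<bar>r\<bar>"] by (simp add: mult.assoc)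
  qed
  have pre3: "\<bar>f' j - c'\<bar> \<le> C' * q powr j" if "j \<in> \<nat>" for j
    unfolding f'_def using that by (rule c'(3))
  obtain K where K: "\<And>i j G H. 0 \<le> i \<Longrightarrow> 0 \<le> j \<Longrightarrow> i - p - p' \<in> \<nat> \<Longrightarrow> j - t - t' \<in> \<nat> \<Longrightarrow>
      (G \<Longrightarrow> i - p \<in> \<nat>) \<Longrightarrow> (H \<Longrightarrow> j - t' \<in> \<nat>) \<Longrightarrow>
      (\<not> G \<Longrightarrow> i - p < 0 \<or> j - t < 0 \<or> i + j \<le> B) \<Longrightarrow>
      (\<not> H \<Longrightarrow> i - p' < 0 \<or> j - t' < 0 \<or> i + j \<le> B) \<Longrightarrow>
      \<bar>(if H then f' (j - t') * f (i - p - p') else 0) - (if G then f (i - p) * f' (j - t - t') else 0)\<bar>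
        \<le> K * q powr (i + j)"
    by (rule cross_commutator_decay[OF q pre1(1,2) pre2 pre1(3) c'(2), of f' p t' B])
      (assumption, erule pre3, erule that)
  \<comment> \<open>Both orders of the product are shifts along the same map, since g commutes with
    the hop; this is the difference of their weights.\<close>
  define \<delta> where "\<delta> k = (if ?h k \<in> ?I then f' (jpos (label4 (?h k))) * f (ipos (label4 (g (?h k)))) else 0) -
      (if g k \<in> ?I then f (ipos (label4 (g k))) * f' (jpos (label4 (?h (g k)))) else 0)" for k
  have eq: "X (Y \<psi>) - Y (X \<psi>) = wshift ?I (g \<circ> ?h) \<delta> \<psi>" for \<psi>
    unfolding X_def Y_def wshift_comp
    by (auto simp: wshift_def fun_eq_iff \<delta>_def f_def f'_def g(4) algebra_simps)
  have "wshift ?I (g \<circ> ?h) \<delta> \<in> op_ideal ?I (decay4 q N)"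
  proof (rule wshift_in_op_ideal)
    show "inj (g \<circ> ?h)" using inj_compose[OF g(1) inj_hop_inv4] .
    fix k assume k: "k \<in> ?I" "(g \<circ> ?h) k \<in> ?I"
    let ?i = "ipos (label4 k)" and ?j = "jpos (label4 k)"
    have ij: "0 \<le> ?i" "0 \<le> ?j" using basis4_pos[OF N(1) k(1)] by (auto simp: Nats_altdef2)
    have lab: "ipos (label4 (g k)) = ?i - p" "jpos (label4 (g k)) = ?j - t"
      "ipos (label4 (?h k)) = ?i - p'" "jpos (label4 (?h k)) = ?j - t'"
      "ipos (label4 (g (?h k))) = ?i - p - p'" "jpos (label4 (g (?h k))) = ?j - t - t'"
      "jpos (label4 (?h (g k))) = ?j - t - t'"
      by (simp_all add: g(2) p_def t_def p'_def t'_def)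
    have "isl (?h k) = isl k" by (cases k) auto
    have "\<bar>\<delta> k\<bar> \<le> K * q powr (?i + ?j)"
      unfolding \<delta>_def lab
    proof (rule K[OF ij])
      show "?i - p - p' \<in> \<nat>" "?j - t - t' \<in> \<nat>"
        using basis4_pos[OF N(1) k(2)] by (simp_all add: lab)
      show "?i - p \<in> \<nat>" if "g k \<in> ?I" using basis4_pos(1)[OF N(1) that] by (simp add: lab)
      show "?j - t' \<in> \<nat>" if "?h k \<in> ?I" using basis4_pos(2)[OF N(1) that] by (simp only: lab)
      have "0 \<le> N + 1 + \<bar>fst d\<bar>" "0 \<le> N + 1 + \<bar>fst d'\<bar>" using N by auto
      then show "?i - p < 0 \<or> ?j - t < 0 \<or> ?i + ?j \<le> B" if "g k \<notin> ?I"
        using leave_basis4[OF N dZ(1,2) k(1) g(2,3) that] unfolding lab B_def by argo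
      show "?i - p' < 0 \<or> ?j - t' < 0 \<or> ?i + ?j \<le> B" if "?h k \<notin> ?I"
        using leave_basis4[OF N dZ(3,4) k(1) _ \<open>isl (?h k) = isl k\<close> that]
          \<open>0 \<le> N + 1 + \<bar>fst d\<bar>\<close> unfolding lab B_def by (simp only: hop_inv4_simps) argo
    qed
    \<comment> \<open>The estimate gives q^(2l), while the ideal is generated by q^l; l >= 0
      suffices to pass from one to the other.\<close>
    also have "\<dots> \<le> \<bar>K\<bar> * q powr level (label4 k)"
      using q ij by (intro mult_mono powr_mono') (auto simp: level_eq)
    finally show "\<bar>\<delta> k\<bar> \<le> \<bar>K\<bar> * q powr level (label4 k)" .
  qed (rule q)
  then show ?thesis by (rule op_ideal.cong) (rule eq)
qed

section \<open>The antiunitary operator\<close>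

definition mirror :: "lm \<Rightarrow> lm" where
  "mirror = (\<lambda>(l, m). (l, - m))"

definition mirror2 :: "lm + lm \<Rightarrow> lm + lm" where
  "mirror2 = map_sum mirror mirror"

definition mirror4 :: "(lm + lm) + (lm + lm) \<Rightarrow> (lm + lm) + (lm + lm)" where
  "mirror4 = map_sum mirror2 mirror2"

lemma mirror_simps [simp]: "mirror (mirror k) = k" "ipos (mirror k) = jpos k"
    "jpos (mirror k) = ipos k" "level (mirror k) = level k"
    "mirror (hop_inv d (mirror k)) = hop_inv (fst d, - snd d) k"
  by (cases k; simp add: mirror_def)+

lemma mirror2_simps [simp]: "mirror2 (Inl k) = Inl (mirror k)" "mirror2 (Inr k) = Inr (mirror k)"
    "mirror2 (mirror2 z) = z" "label2 (mirror2 z) = mirror (label2 z)"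
    "mirror2 (hop_inv2 d (mirror2 z)) = hop_inv2 (fst d, - snd d) z"
    "flip (mirror2 z) = mirror2 (flip z)"
  by (cases z; simp add: mirror2_def)+

lemma mirror4_simps [simp]: "mirror4 (Inl z) = Inl (mirror2 z)" "mirror4 (Inr z) = Inr (mirror2 z)"
    "mirror4 (mirror4 k) = k" "label4 (mirror4 k) = mirror (label4 k)"
    "mirror4 (hop_inv4 d (mirror4 k)) = hop_inv4 (fst d, - snd d) k"
  by (cases k; simp add: mirror4_def)+

lemma mirror_basis: "half_integer M \<Longrightarrow> mirror k \<in> basis M \<longleftrightarrow> k \<in> basis M"
  by (auto simp: basis_iff)

lemma Plus_iff: "Inl x \<in> A <+> B \<longleftrightarrow> x \<in> A" "Inr y \<in> A <+> B \<longleftrightarrow> y \<in> B"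
  by auto

lemma mirror2_basis2: "half_integer N \<Longrightarrow> mirror2 z \<in> basis2 N \<longleftrightarrow> z \<in> basis2 N"
  by (cases z) (simp_all add: basis2_def Plus_iff mirror_basis half_integer_plus1)

lemma mirror4_basis4: "half_integer N \<Longrightarrow> mirror4 k \<in> basis4 N N \<longleftrightarrow> k \<in> basis4 N N"
  by (cases k) (simp_all add: basis4_def Plus_iff mirror2_basis2)

lemma bij_involution: "(\<And>k. \<mu> (\<mu> k) = k) \<Longrightarrow> bij \<mu>"
  by (rule bij_betw_byWitness[where f' = \<mu>]) auto

lemma conj_l2:
  assumes "\<And>k. \<mu> (\<mu> k) = k" "\<And>k. \<mu> k \<in> I \<longleftrightarrow> k \<in> I" "\<psi> \<in> l2 I"
  shows "(\<lambda>k. cnj (\<psi> (\<mu> k))) \<in> l2 I"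
proof -
  have "(\<lambda>k. (cmod (\<psi> (\<mu> k)))\<^sup>2) summable_on UNIV"
    using summable_on_reindex_bij_betw[OF bij_involution[of \<mu>, OF assms(1)], of "\<lambda>k. (cmod (\<psi> k))\<^sup>2"]
      l2_summable[OF assms(3)] by blast
  then show ?thesis using assms(2,3) by (auto simp: l2_def)
qed

definition conj2 :: "(lm + lm) oper" where
  "conj2 \<psi> = (\<lambda>k. cnj (\<psi> (mirror2 k)))"

definition conj4 :: "((lm + lm) + (lm + lm)) oper" where
  "conj4 \<psi> = (\<lambda>k. cnj (\<psi> (mirror4 k)))"

lemma conj4_conj4 [simp]: "conj4 (conj4 \<psi>) = \<psi>"
  by (simp add: conj4_def)

lemma conj2_l2: "half_integer N \<Longrightarrow> \<psi> \<in> l2 (basis2 N) \<Longrightarrow> conj2 \<psi> \<in> l2 (basis2 N)"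
  unfolding conj2_def by (rule conj_l2) (auto simp: mirror2_basis2)

lemma conj4_l2: "half_integer N \<Longrightarrow> \<psi> \<in> l2 (basis4 N N) \<Longrightarrow> conj4 \<psi> \<in> l2 (basis4 N N)"
  unfolding conj4_def by (rule conj_l2) (auto simp: mirror4_basis4)

lemma antiunitary_conj4:
  assumes "half_integer N"
  shows "antiunitary (basis4 N N) conj4"
proof -
  have "conj4 ` l2 (basis4 N N) = l2 (basis4 N N)"
  proof
    show "l2 (basis4 N N) \<subseteq> conj4 ` l2 (basis4 N N)"
      using conj4_l2[OF assms] conj4_conj4 by (metis image_eqI subsetI)
  qed (use conj4_l2[OF assms] in blast)
  moreover have "conj4 (\<phi> + \<psi>) = conj4 \<phi> + conj4 \<psi>" for \<phi> \<psi>
    by (auto simp: conj4_def)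
  moreover have "conj4 (scale c \<psi>) = scale (cnj c) (conj4 \<psi>)" for c \<psi>
    by (auto simp: conj4_def scale_def)
  moreover have "l2inner (conj4 \<phi>) (conj4 \<psi>) = l2inner \<psi> \<phi>" for \<phi> \<psi>
    using infsum_reindex_bij_betw[OF bij_involution[of mirror4, OF mirror4_simps(3)],
        of "\<lambda>k. cnj (\<psi> k) * \<phi> k"]
    by (simp add: l2inner_def conj4_def mult.commute)
  ultimately show ?thesis unfolding antiunitary_def by blast
qed

text \<open>The mirror commutes with \<open>flip\<close>, preserves levels and basis membership, and
  the weights are real; hence J can be taken without phase factors.\<close>

lemma dirac_conj2:
  assumes "half_integer N"
  shows "snd (dirac N) (conj2 \<psi>) = conj2 (snd (dirac N) \<psi>)"
  using mirror2_basis2[OF assms] unfolding snd_dirac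
  by (auto simp: wshift_def conj2_def fun_eq_iff)

lemma dirac_dom_conj2:
  assumes "half_integer N" "\<psi> \<in> fst (dirac N)"
  shows "conj2 \<psi> \<in> fst (dirac N)"
  using assms(2) conj2_l2[OF assms(1)] dirac_conj2[OF assms(1)]
  by (auto simp: dirac_def fst_swap_op)

lemma conj4_comps: "conj4 \<psi> \<circ> Inl = conj2 (\<psi> \<circ> Inl)" "conj4 \<psi> \<circ> Inr = conj2 (\<psi> \<circ> Inr)"
  by (auto simp: conj4_def conj2_def)

lemma dsum_comps: "dsum S T \<psi> \<circ> Inl = S (\<psi> \<circ> Inl)" "dsum S T \<psi> \<circ> Inr = T (\<psi> \<circ> Inr)"
  by (auto simp: dsum_def)

lemma sum_fun_eqI: "f \<circ> Inl = g \<circ> Inl \<Longrightarrow> f \<circ> Inr = g \<circ> Inr \<Longrightarrow> f = g"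
  by (metis sum.exhaust ext o_apply)

lemma uop_commutes_conj4:
  assumes "half_integer N"
  shows "uop_commutes (basis4 N N) conj4 (uop_dsum (dirac N) (dirac N))"
proof -
  have dom: "conj4 \<psi> \<in> fst (uop_dsum (dirac N) (dirac N))"
    if "\<psi> \<in> fst (uop_dsum (dirac N) (dirac N))" for \<psi>
    using that dirac_dom_conj2[OF assms] by (simp add: uop_dsum_def conj4_comps)
  have "conj4 (dsum (snd (dirac N)) (snd (dirac N)) \<psi>) =
      dsum (snd (dirac N)) (snd (dirac N)) (conj4 \<psi>)" for \<psi>
    by (rule sum_fun_eqI) (simp_all only: conj4_comps dsum_comps dirac_conj2[OF assms])
  then have "conj4 (snd (uop_dsum (dirac N) (dirac N)) \<psi>) =
      snd (uop_dsum (dirac N) (dirac N)) (conj4 \<psi>)" for \<psi>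
    by (simp only: uop_dsum_def snd_conv)
  moreover have "\<psi> \<in> fst (uop_dsum (dirac N) (dirac N)) \<longleftrightarrow>
      conj4 \<psi> \<in> fst (uop_dsum (dirac N) (dirac N))" for \<psi>
    using dom[of \<psi>] dom[of "conj4 \<psi>"] by auto
  ultimately show ?thesis unfolding uop_commutes_def by blast
qed


section \<open>The order-one condition\<close>

definition dirac_comm4 :: "real \<Rightarrow> real \<Rightarrow> real \<Rightarrow> podles_gen \<Rightarrow> ((lm + lm) + (lm + lm)) oper" where
  "dirac_comm4 q s N x = dsum (dirac_comm q s N x) (dirac_comm q s N x)"

lemma dirac_comm4_eq:
  "dirac_comm4 q s N x \<psi> = (\<Sum>n<3. wshift (basis4 N N) (hop_inv4 (hop x n) \<circ> flip4)
     (\<lambda>k. fst (hop x n) * coeff q s x n (ipos (label4 ((hop_inv4 (hop x n) \<circ> flip4) k)))) \<psi>)"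
proof -
  let ?W = "\<lambda>n. wshift (basis2 N) (hop_inv2 (hop x n) \<circ> flip)
     (\<lambda>k. fst (hop x n) * coeff q s x n (ipos (label2 (hop_inv2 (hop x n) k))))"
  have m: "map_sum (hop_inv2 d \<circ> flip) (hop_inv2 d \<circ> flip) = hop_inv4 d \<circ> flip4" for d
    by (simp only: hop_inv4_def flip4_def map_sum.comp)
  have "dirac_comm4 q s N x \<psi> = (\<Sum>n<3. dsum (?W n) (?W n) \<psi>)"
    unfolding dirac_comm4_def dirac_comm_def[abs_def] by (rule dsum_sum)
  also have "\<dots> = (\<Sum>n<3. wshift (basis4 N N) (hop_inv4 (hop x n) \<circ> flip4)
     (\<lambda>k. fst (hop x n) * coeff q s x n (ipos (label4 ((hop_inv4 (hop x n) \<circ> flip4) k)))) \<psi>)"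
    unfolding dsum_wshift basis4_def m
    by (intro sum.cong refl arg_cong2[where f = "wshift _ _"] ext) (auto split: sum.splits)
  finally show ?thesis .
qed

lemma dirac_comm4_bounded:
  assumes "half_integer N" "0 < q" "q < 1" "s > 0"
  shows "dirac_comm4 q s N x \<in> bounded_ops (basis4 N N)"
  unfolding dirac_comm4_eq[abs_def]
proof (rule sum_bounded)
  fix n :: nat assume n: "n \<in> {..<3}"
  show "wshift (basis4 N N) (hop_inv4 (hop x n) \<circ> flip4)
     (\<lambda>k. fst (hop x n) * coeff q s x n (ipos (label4 ((hop_inv4 (hop x n) \<circ> flip4) k))))
     \<in> bounded_ops (basis4 N N)"
    using n by (intro term_bounded assms(2-4) inj_compose[OF inj_hop_inv4 inj_flip4]
        basis4_pos(1)[OF assms(1)]) auto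
qed

lemma rep4_bounded:
  assumes "half_integer N" "0 < q" "q < 1" "s > 0"
  shows "rep4 q s N N x \<in> bounded_ops (basis4 N N)"
  unfolding rep4_eq[abs_def]
proof (rule sum_bounded)
  fix n :: nat assume n: "n \<in> {..<3}"
  then show "wshift (basis4 N N) (hop_inv4 (hop x n))
     (\<lambda>k. coeff q s x n (ipos (label4 (hop_inv4 (hop x n) k)))) \<in> bounded_ops (basis4 N N)"
    using term_bounded[OF assms(2-4), of n "hop_inv4 (hop x n)" "basis4 N N" label4 1 x]
      inj_hop_inv4 basis4_pos(1)[OF assms(1)] by simp
qed

lemma alg_span_comps:
  assumes "\<psi> \<in> alg_span (basis4 N M)"
  shows "\<psi> \<circ> Inl \<in> alg_span (basis2 N)" "\<psi> \<circ> Inr \<in> alg_span (basis2 M)"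
proof -
  have "finite (Inl -` {k. \<psi> k \<noteq> 0})" "finite (Inr -` {k. \<psi> k \<noteq> 0})"
    using assms by (auto simp: alg_span_eq intro!: finite_vimageI simp del: vimage_Collect_eq)
  then show "\<psi> \<circ> Inl \<in> alg_span (basis2 N)" "\<psi> \<circ> Inr \<in> alg_span (basis2 M)"
    using assms by (auto simp: alg_span_eq basis4_def vimage_def)
qed

lemma is_bounded_comm_dirac4:
  assumes "half_integer N" "N > 0" "0 < q" "q < 1" "s > 0"
  shows "is_bounded_comm (basis4 N N) (uop_dsum (dirac N) (dirac N)) (rep4 q s N N x)
    (dirac_comm4 q s N x)"
  unfolding is_bounded_comm_def
proof (intro conjI ballI)
  show "dirac_comm4 q s N x \<in> bounded_ops (basis4 N N)"
    using assms by (intro dirac_comm4_bounded)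
  fix \<psi> assume \<psi>: "\<psi> \<in> alg_span (basis4 N N)"
  have "rep2 q s N x \<chi>' \<in> fst (dirac N)" if "\<chi>' \<in> alg_span (basis2 N)" for \<chi>'
    using that is_bounded_comm_dirac[OF assms] by (auto simp: is_bounded_comm_def)
  then show "rep4 q s N N x \<psi> \<in> fst (uop_dsum (dirac N) (dirac N))"
    using alg_span_comps[OF \<psi>] by (simp add: uop_dsum_def rep4_def dsum_comps)
  have diff: "(f - g) \<circ> h = (f \<circ> h) - (g \<circ> h)" for f g :: "_ \<Rightarrow> complex" and h :: "lm + lm \<Rightarrow> _"
    by auto
  show "dirac_comm4 q s N x \<psi> = snd (uop_dsum (dirac N) (dirac N)) (rep4 q s N N x \<psi>) -
      rep4 q s N N x (snd (uop_dsum (dirac N) (dirac N)) \<psi>)"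
    by (rule sum_fun_eqI)
      (simp_all only: uop_dsum_def snd_conv dirac_comm4_def rep4_def diff dsum_comps
        dirac_comm_eq[OF assms(1,2)])
qed

text \<open>This is J x J^(-1) in explicit form: mirroring exchanges i and j and reverses the m-part
  of each hop, while the real coefficients are unaffected by conjugation.\<close>

definition opposite_rep :: "real \<Rightarrow> real \<Rightarrow> real \<Rightarrow> podles_gen \<Rightarrow> ((lm + lm) + (lm + lm)) oper" where
  "opposite_rep q s N x \<psi> = (\<Sum>n<3. wshift (basis4 N N) (hop_inv4 (fst (hop x n), - snd (hop x n)))
     (\<lambda>k. coeff q s x n (jpos (label4 (hop_inv4 (fst (hop x n), - snd (hop x n)) k)))) \<psi>)"

lemma conj4_sum: "conj4 (\<Sum>n\<in>A. f n) = (\<Sum>n\<in>A. conj4 (f n))"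
  unfolding sum_fun_eq by (auto simp: conj4_def)

text \<open>J is its own inverse. The restriction to l2 is needed because \<open>inv_into\<close>
  inverts J only there.\<close>

lemma conj_by_rep4:
  assumes "half_integer N" "\<psi> \<in> l2 (basis4 N N)"
  shows "conj_by (basis4 N N) conj4 (rep4 q s N N x) \<psi> = opposite_rep q s N x \<psi>"
proof -
  have "inj_on conj4 (l2 (basis4 N N))" by (rule inj_on_inverseI[of _ conj4]) simp
  then have "inv_into (l2 (basis4 N N)) conj4 \<psi> = conj4 \<psi>"
    using inv_into_f_f[of conj4 "l2 (basis4 N N)" "conj4 \<psi>"] conj4_l2[OF assms] by simp
  then have "conj_by (basis4 N N) conj4 (rep4 q s N N x) \<psi> = conj4 (rep4 q s N N x (conj4 \<psi>))"
    by (simp add: conj_by_def)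
  also have "\<dots> = opposite_rep q s N x \<psi>"
    unfolding rep4_eq conj4_sum opposite_rep_def
  proof (intro sum.cong refl ext)
    fix n k
    have m: "hop_inv4 d (mirror4 k) = mirror4 (hop_inv4 (fst d, - snd d) k)" for d
      by (metis mirror4_simps(3,5))
    show "conj4 (wshift (basis4 N N) (hop_inv4 (hop x n))
        (\<lambda>k. coeff q s x n (ipos (label4 (hop_inv4 (hop x n) k)))) (conj4 \<psi>)) k =
      wshift (basis4 N N) (hop_inv4 (fst (hop x n), - snd (hop x n)))
        (\<lambda>k. coeff q s x n (jpos (label4 (hop_inv4 (fst (hop x n), - snd (hop x n)) k)))) \<psi> k"
      by (simp add: conj4_def wshift_def m mirror4_basis4[OF assms(1)] del: hop_inv4_simps mirror4_simps(5))
  qed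
  finally show ?thesis .
qed

text \<open>Expanding both operators gives nine elementary commutators. The expansion is valid on l2
  only, hence rule \<open>cong\<close>, and boundedness of Y keeps its values in l2.\<close>

lemma opposite_commutator_in_ideal:
  assumes N: "half_integer N" "N > 0" and q: "0 < q" "q < 1" and s: "s > 0"
    and Y: "Y \<in> bounded_ops (basis4 N N)"
      "\<And>\<psi>. Y \<psi> = (\<Sum>n<3. wshift (basis4 N N) (g n) (\<lambda>k. r n * coeff q s y n (ipos (label4 (g n k)))) \<psi>)"
    and g: "\<And>n. inj (g n)" "\<And>n k. label4 (g n k) = hop_inv (hop y n) (label4 k)"
      "\<And>n k. isl (g n k) = isl k" "\<And>n d k. g n (hop_inv4 d k) = hop_inv4 d (g n k)"
  shows "comm (conj_by (basis4 N N) conj4 (rep4 q s N N x)) Y \<in> Kq4 q N N"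
proof -
  define X where "X n = wshift (basis4 N N) (hop_inv4 (fst (hop x n), - snd (hop x n)))
     (\<lambda>k. coeff q s x n (jpos (label4 (hop_inv4 (fst (hop x n), - snd (hop x n)) k))))" for n
  define Z where "Z n = wshift (basis4 N N) (g n) (\<lambda>k. r n * coeff q s y n (ipos (label4 (g n k))))" for n
  have "(\<lambda>\<psi>. \<Sum>n'<3. (\<lambda>\<psi>. \<Sum>n<3. X n' (Z n \<psi>) - Z n (X n' \<psi>)) \<psi>) \<in> op_ideal (basis4 N N) (decay4 q N)"
    unfolding X_def Z_def
    by (intro op_ideal_sum cross_commutator_in_ideal N q s g; simp)
  then have I: "(\<lambda>\<psi>. \<Sum>n'<3. \<Sum>n<3. X n' (Z n \<psi>) - Z n (X n' \<psi>)) \<in> Kq4 q N N"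
    unfolding Kq4_def q_diag4_eq .
  have "comm (conj_by (basis4 N N) conj4 (rep4 q s N N x)) Y \<psi> =
      (\<Sum>n'<3. \<Sum>n<3. X n' (Z n \<psi>) - Z n (X n' \<psi>))" if \<psi>: "\<psi> \<in> l2 (basis4 N N)" for \<psi>
  proof -
    have o: "opposite_rep q s N x \<phi> = (\<Sum>n'<3. X n' \<phi>)" for \<phi>
      by (simp only: opposite_rep_def X_def)
    have "comm (conj_by (basis4 N N) conj4 (rep4 q s N N x)) Y \<psi> =
        opposite_rep q s N x (Y \<psi>) - Y (opposite_rep q s N x \<psi>)"
      using bounded_opsD(1)[OF Y(1) \<psi>] by (simp only: comm_def conj_by_rep4[OF N(1)] \<psi>)
    also have "\<dots> = (\<Sum>n'<3. \<Sum>n<3. X n' (Z n \<psi>)) - (\<Sum>n<3. \<Sum>n'<3. Z n (X n' \<psi>))"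
      unfolding o Y(2) Z_def[symmetric] by (simp only: X_def Z_def wshift_sum)
    also have "(\<Sum>n<3. \<Sum>n'<3. Z n (X n' \<psi>)) = (\<Sum>n'<3. \<Sum>n<3. Z n (X n' \<psi>))"
      by (rule sum.swap)
    finally show ?thesis by (simp only: sum_subtractf)
  qed
  then show ?thesis using I unfolding Kq4_def by (rule op_ideal.cong[rotated])
qed

lemma isl_hop_inv4: "isl (hop_inv4 d k) = isl k"
  by (cases k) auto

lemma isl_flip4: "isl (flip4 k) = isl k"
  by (cases k) auto

lemma dirac_order_one:
  assumes N: "half_integer N" "N > 0" and q: "0 < q" "q < 1" and s: "s > 0"
  shows "order_one_mod_Kq q s N (dirac N)"
proof -
  have 1: "comm (conj_by (basis4 N N) conj4 (rep4 q s N N x)) (rep4 q s N N y) \<in> Kq4 q N N" for x y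
    by (rule opposite_commutator_in_ideal[OF N q s rep4_bounded[OF N(1) q s],
          where g = "\<lambda>n. hop_inv4 (hop y n)" and r = "\<lambda>n. 1" and y = y])
      (simp_all only: rep4_eq mult_1 inj_hop_inv4 hop_inv4_simps isl_hop_inv4 hop_inv4_commute)
  \<comment> \<open>\<open>flip4\<close> changes neither labels nor the outer summand and commutes
    with hops, so the commutator with D meets the same hypotheses, with the displacement of l as the
    factor r.\<close>
  have 2: "comm (conj_by (basis4 N N) conj4 (rep4 q s N N x)) (dirac_comm4 q s N y) \<in> Kq4 q N N" for x y
    by (rule opposite_commutator_in_ideal[OF N q s dirac_comm4_bounded[OF N(1) q s],
          where g = "\<lambda>n. hop_inv4 (hop y n) \<circ> flip4" and r = "\<lambda>n. fst (hop y n)" and y = y])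
      (simp_all only: dirac_comm4_eq inj_compose[OF inj_hop_inv4 inj_flip4] o_apply hop_inv4_simps
        flip4_simps isl_hop_inv4 isl_flip4 flip4_hop_inv4 hop_inv4_commute)
  have sq: "conj4 (conj4 \<psi>) = scale 1 \<psi>" for \<psi> by simp
  show ?thesis
    unfolding order_one_mod_Kq_def
  proof (rule exI[of _ N], rule exI[of _ "dirac N"], rule exI[of _ conj4], intro conjI allI)
    show "unbounded_op (basis2 N) (dirac N)"
      unfolding dirac_def by (rule unbounded_swap_op)
    show "\<exists>\<epsilon>\<in>{1, -1}. \<forall>\<psi>\<in>l2 (basis4 N N). conj4 (conj4 \<psi>) = scale \<epsilon> \<psi>"
      using sq by blast
    show "\<exists>C. is_bounded_comm (basis4 N N) (uop_dsum (dirac N) (dirac N)) (rep4 q s N N y) C \<and>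
        comm (conj_by (basis4 N N) conj4 (rep4 q s N N x)) C \<in> Kq4 q N N" for x y
      using is_bounded_comm_dirac4[OF N q s] 2 by blast
  qed (rule N dirac_bounded_comms[OF N q s] antiunitary_conj4[OF N(1)]
      uop_commutes_conj4[OF N(1)] 1)+
qed

section \<open>Compactness of operators of exponential decay\<close>

lemma level_diagonal_compact:
  assumes "\<And>R. finite {k \<in> I. level (lab k) \<le> R}"
    and "\<And>e. e > 0 \<Longrightarrow> \<exists>R. \<forall>k\<in>I. level (lab k) > R \<longrightarrow> \<bar>w k\<bar> \<le> e"
  shows "wshift I (\<lambda>k. k) w \<in> compact_ops I"
proof (rule diagonal_compact)
  fix e :: real assume "e > 0"
  then obtain R where "\<forall>k\<in>I. level (lab k) > R \<longrightarrow> \<bar>w k\<bar> \<le> e" using assms(2) by blast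
  then have "{k \<in> I. \<bar>w k\<bar> > e} \<subseteq> {k \<in> I. level (lab k) \<le> R}" by force
  then show "finite {k \<in> I. \<bar>w k\<bar> > e}" using assms(1) by (rule finite_subset)
qed

text \<open>The entries q^l of the generator tend to zero along levels of finite multiplicity, and
  the rest of the ideal inherits compactness. The threshold for q^l <= e is log_q e, as q <
  1.\<close>

lemma Kq4_subset_compact:
  assumes "0 < q" "q < 1"
  shows "Kq4 q N M \<subseteq> compact_ops (basis4 N M)"
proof -
  have "wshift (basis4 N M) (\<lambda>k. k) (\<lambda>k. q powr level (label4 k)) \<in> compact_ops (basis4 N M)"
  proof (rule level_diagonal_compact[OF finite_basis4_below])
    fix e :: real assume e: "e > 0"
    have "\<bar>q powr x\<bar> \<le> e" if "x > log q e" for x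
    proof -
      have "q powr x \<le> q powr (log q e)"
        using that assms by (intro powr_mono') auto
      then show ?thesis using e assms by simp
    qed
    then show "\<exists>R. \<forall>k\<in>basis4 N M. level (label4 k) > R \<longrightarrow> \<bar>q powr level (label4 k)\<bar> \<le> e"
      by blast
  qed
  then show ?thesis
    unfolding Kq4_def q_diag4_eq by (rule op_ideal_subset_compact)
qed


section \<open>The spectrum\<close>

lemma dirac_apply:
  "snd (dirac N) \<psi> k = (if k \<in> basis2 N \<and> flip k \<in> basis2 N
     then of_real (level (label2 k) - N) * \<psi> (flip k) else 0)"
  by (simp add: snd_dirac wshift_def)

text \<open>Applying D twice on the pair k, \<open>flip\<close> k multiplies by (l - N)^2. If the
  partner is missing, D gives 0 at k, so \<mu> = 0, and also l = N.\<close>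

lemma eigenspace_dirac_support:
  assumes N: "half_integer N" "N > 0" and \<psi>: "\<psi> \<in> eigenspace (dirac N) \<mu>" "\<psi> k \<noteq> 0"
  shows "k \<in> basis2 N" "\<mu>\<^sup>2 = (of_real (level (label2 k) - N))\<^sup>2"
proof -
  have \<psi>l: "\<psi> \<in> l2 (basis2 N)" and eq: "snd (dirac N) \<psi> = scale \<mu> \<psi>"
    using \<psi>(1) by (auto simp: eigenspace_def dirac_def fst_swap_op)
  show k: "k \<in> basis2 N" using l2_outside[OF \<psi>l] \<psi>(2) by blast
  have ev: "\<mu> * \<psi> j = (if j \<in> basis2 N \<and> flip j \<in> basis2 N
     then of_real (level (label2 j) - N) * \<psi> (flip j) else 0)" for j
    using fun_cong[OF eq, of j] unfolding dirac_apply by (simp add: scale_def)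
  show "\<mu>\<^sup>2 = (of_real (level (label2 k) - N))\<^sup>2"
  proof (cases "flip k \<in> basis2 N")
    case True
    let ?w = "complex_of_real (level (label2 k) - N)"
    have 1: "\<mu> * \<psi> k = ?w * \<psi> (flip k)" and 2: "\<mu> * \<psi> (flip k) = ?w * \<psi> k"
      using ev[of k] ev[of "flip k"] k True by simp_all
    have "\<mu>\<^sup>2 * \<psi> k = \<mu> * (?w * \<psi> (flip k))" by (simp only: power2_eq_square mult.assoc 1)
    also have "\<dots> = ?w * (\<mu> * \<psi> (flip k))" by (rule mult.left_commute)
    also have "\<dots> = ?w\<^sup>2 * \<psi> k" by (simp only: 2 power2_eq_square mult.assoc)
    finally show ?thesis using \<psi>(2) by simp
  next
    case False
    then have "\<mu> = 0" using ev[of k] \<psi>(2) by simp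
    then show ?thesis using basis2_flip[OF N k False] by simp
  qed
qed

text \<open>The unnormalized vector \<open>|l,m>\<close> of the first summand plus \<sigma> times
  that of the second. At l = N the second part is absent and both signs give the same kernel
  vector.\<close>

definition eigenket :: "real \<Rightarrow> real \<Rightarrow> real \<Rightarrow> real \<Rightarrow> (lm + lm) vec" where
  "eigenket N \<sigma> l m = case_sum (\<lambda>z. if z = (l, m) then 1 else 0)
     (\<lambda>z. if z = (l, m) \<and> z \<in> basis (N + 1) then of_real \<sigma> else 0)"

lemma basis_Suc_subset:
  assumes "half_integer N" "N > 0"
  shows "basis (N + 1) \<subseteq> basis N"
proof
  fix z assume z: "z \<in> basis (N + 1)"
  then have "level z - (N + 1) + 1 \<in> \<nat>"
    using assms by (intro Nats_add) (auto simp: basis_iff half_integer_plus1)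
  then show "z \<in> basis N"
    using z assms by (simp add: basis_iff half_integer_plus1)
qed

lemma eigenket_in_eigenspace:
  assumes N: "half_integer N" "N > 0" and \<sigma>: "\<sigma> \<in> {1, - 1}" and lm: "(l, m) \<in> basis N"
  shows "eigenket N \<sigma> l m \<in> eigenspace (dirac N) (of_real (\<sigma> * (l - N)))"
proof -
  let ?e = "eigenket N \<sigma> l m"
  have "{k. ?e k \<noteq> 0} \<subseteq> {Inl (l, m), Inr (l, m)}"
  proof
    fix k assume "k \<in> {k. ?e k \<noteq> 0}"
    then show "k \<in> {Inl (l, m), Inr (l, m)}"
      by (cases k) (auto simp: eigenket_def split: if_splits)
  qed
  then have "finite {k. ?e k \<noteq> 0}" by (rule finite_subset) simp
  then have e: "?e \<in> alg_span (basis2 N)"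
    using lm by (auto simp: alg_span_eq eigenket_def basis2_def split: sum.splits if_splits)
  \<comment> \<open>Without a partner D annihilates the ket, so the claimed eigenvalue must be
    0.\<close>
  have l: "l = N" if "(l, m) \<notin> basis (N + 1)"
    using basis2_flip[OF N, of "Inl (l, m)"] lm that by (simp add: basis2_def Plus_iff)
  have "snd (dirac N) ?e k = scale (of_real (\<sigma> * (l - N))) ?e k" for k
  proof (cases k)
    case (Inl z)
    then show ?thesis
      using l lm by (auto simp: dirac_apply scale_def eigenket_def basis2_def Plus_iff)
  next
    case (Inr z)
    then show ?thesis
      using \<sigma> lm by (auto simp: dirac_apply scale_def eigenket_def basis2_def Plus_iff)
  qed
  then have "snd (dirac N) ?e = scale (of_real (\<sigma> * (l - N))) ?e" by (rule ext)
  moreover have "?e \<in> fst (dirac N)"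
    using e alg_span_subset_swap_dom unfolding dirac_def by blast
  ultimately show ?thesis unfolding eigenspace_def by blast
qed

lemma double_level_Nats:
  assumes "half_integer N" "N > 0" "l - N \<in> \<nat>"
  shows "2 * l \<in> \<nat>"
proof -
  have "2 * N \<in> \<nat>" using assms by (simp add: half_integer_def Nats_altdef2)
  then have "2 * N + 2 * (l - N) \<in> \<nat>"
    using Nats_mult[OF Nats_numeral assms(3)] by (rule Nats_add)
  then show ?thesis by (simp add: algebra_simps)
qed

lemma eigenvalues_dirac:
  assumes N: "half_integer N" "N > 0"
  shows "eigenvalues (dirac N) = {of_real (\<sigma> * (l - N)) | \<sigma> l. \<sigma> \<in> {1, -1} \<and> l - N \<in> \<nat>}"
proof (intro set_eqI iffI)
  fix \<mu> assume "\<mu> \<in> eigenvalues (dirac N)"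
  then obtain \<psi> where \<psi>: "\<psi> \<in> eigenspace (dirac N) \<mu>" "\<psi> \<noteq> 0"
    by (auto simp: eigenvalues_def)
  then obtain k where "\<psi> k \<noteq> 0" by (auto simp: fun_eq_iff)
  note k = eigenspace_dirac_support[OF N \<psi>(1) this]
  have "\<mu> = of_real (1 * (level (label2 k) - N)) \<or> \<mu> = of_real (- 1 * (level (label2 k) - N))"
    using k(2) by (simp add: power2_eq_iff)
  then show "\<mu> \<in> {of_real (\<sigma> * (l - N)) | \<sigma> l. \<sigma> \<in> {1, -1} \<and> l - N \<in> \<nat>}"
    using basis2_level[OF N k(1)] by blast
next
  fix \<mu> :: complex
  assume "\<mu> \<in> {of_real (\<sigma> * (l - N)) | \<sigma> l. \<sigma> \<in> {1, -1} \<and> l - N \<in> \<nat>}"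
  then obtain \<sigma> l where \<mu>: "\<mu> = of_real (\<sigma> * (l - N))" "\<sigma> \<in> {1, -1}" "l - N \<in> \<nat>" by blast
  \<comment> \<open>The label m = l is available at every level, since then j = 0 and i = 2
    l.\<close>
  have "l + l \<in> \<nat>" using double_level_Nats[OF N \<mu>(3)] by simp
  then have "(l, l) \<in> basis N" using N \<mu>(3) by (simp add: basis_iff)
  then have "eigenket N \<sigma> l l \<in> eigenspace (dirac N) \<mu>"
    unfolding \<mu>(1) by (rule eigenket_in_eigenspace[OF N \<mu>(2)])
  moreover have "eigenket N \<sigma> l l (Inl (l, l)) \<noteq> 0" by (simp add: eigenket_def)
  ultimately show "\<mu> \<in> eigenvalues (dirac N)"
    unfolding eigenvalues_def by (metis (mono_tags, lifting) mem_Collect_eq zero_fun_apply)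
qed

text \<open>The values are m = t - l with t = 0, ..., 2l; this also covers half-integral l.\<close>

lemma card_basis_level:
  assumes N: "half_integer N" "N > 0" and l: "l - N \<in> \<nat>"
  shows "finite {m. (l, m) \<in> basis N}" "real (card {m. (l, m) \<in> basis N}) = 2 * l + 1"
proof -
  obtain T :: nat where T: "2 * l = real T"
    using double_level_Nats[OF N l] by (rule Nats_cases)
  have "{m. (l, m) \<in> basis N} = (\<lambda>t. real t - l) ` {..T}"
  proof (intro set_eqI iffI)
    fix m assume "m \<in> {m. (l, m) \<in> basis N}"
    then have m: "l + m \<in> \<nat>" "l - m \<in> \<nat>" using N by (auto simp: basis_iff)
    then obtain t where t: "l + m = real t" by (auto elim: Nats_cases)
    have "0 \<le> l - m" using m(2) by (simp add: Nats_altdef2)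
    then have "t \<le> T" using t T by simp
    then show "m \<in> (\<lambda>t. real t - l) ` {..T}" using t by (intro image_eqI[of _ _ t]) auto
  next
    fix m assume "m \<in> (\<lambda>t. real t - l) ` {..T}"
    then obtain t where t: "m = real t - l" "t \<le> T" by auto
    have "l + m = real t" "l - m = real (T - t)" using t T by (simp_all add: of_nat_diff)
    then have "l + m \<in> \<nat>" "l - m \<in> \<nat>" by simp_all
    then show "m \<in> {m. (l, m) \<in> basis N}" using N l by (simp add: basis_iff)
  qed
  moreover have "inj_on (\<lambda>t. real t - l) {..T}" by (auto simp: inj_on_def)
  ultimately show "finite {m. (l, m) \<in> basis N}" "real (card {m. (l, m) \<in> basis N}) = 2 * l + 1"
    using T by (simp_all add: card_image)
qed

text \<open>Eigenvectors live on level l, and the eigenvalue equation determines their second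
  component from the first; so the eigenkets of that level form a basis. At l = N there is no second
  component, and the eigenvalue 0 has multiplicity 2N + 1 although both signs yield it.\<close>

lemma dim_eigenspace_dirac:
  assumes N: "half_integer N" "N > 0" and \<sigma>: "\<sigma> \<in> {1, - 1}" and l: "l - N \<in> \<nat>"
  shows "real (cvec_dim (eigenspace (dirac N) (of_real (\<sigma> * (l - N))))) = 2 * l + 1"
proof -
  define Ms where "Ms = {m. (l, m) \<in> basis N}"
  define e where "e = eigenket N \<sigma> l"
  let ?V = "eigenspace (dirac N) (of_real (\<sigma> * (l - N)))"
  have fin: "finite Ms" using card_basis_level(1)[OF N l] by (simp add: Ms_def)
  have eInl: "e m (Inl (l, m')) = (if m' = m then 1 else 0)" for m m'
    by (simp add: e_def eigenket_def)
  have inj: "inj_on e Ms"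
    by (rule inj_onI) (metis eInl zero_neq_one)
  \<comment> \<open>The first components of the eigenkets are Kronecker deltas; this yields
    independence as well as the expansion coefficients.\<close>
  have coord: "(\<Sum>m\<in>Ms. scale (c m) (e m)) (Inl (l, m')) = c m'" if "m' \<in> Ms" for c m'
    using that fin unfolding sum_fun_eq by (simp add: scale_def eInl if_distrib[of "\<lambda>x. _ * x"] cong: if_cong)
  have sub: "e ` Ms \<subseteq> ?V"
    using eigenket_in_eigenspace[OF N \<sigma>] by (auto simp: e_def Ms_def)
  have "cvec.independent (e ` Ms)"
  proof (rule cvec.independent_if_scalars_zero)
    show "finite (e ` Ms)" using fin by simp
    fix f x assume "(\<Sum>x\<in>e ` Ms. scale (f x) x) = 0" "x \<in> e ` Ms"
    then obtain m where m: "m \<in> Ms" "x = e m" "(\<Sum>m\<in>Ms. scale (f (e m)) (e m)) = 0"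
      using inj by (auto simp: sum.reindex)
    then show "f x = 0" using coord[OF m(1), of "\<lambda>m. f (e m)"] by simp
  qed
  moreover have "?V \<subseteq> cvec_span (e ` Ms)"
  proof
    fix \<psi> assume \<psi>: "\<psi> \<in> ?V"
    have lev: "level (label2 k) = l" if "\<psi> k \<noteq> 0" for k
    proof -
      note k = eigenspace_dirac_support[OF N \<psi> that]
      have "complex_of_real ((\<sigma> * (l - N))\<^sup>2) = of_real ((level (label2 k) - N)\<^sup>2)"
        using k(2) by simp
      then have "(\<sigma> * (l - N))\<^sup>2 = (level (label2 k) - N)\<^sup>2" by (simp only: of_real_eq_iff)
      then have "(l - N)\<^sup>2 = (level (label2 k) - N)\<^sup>2" using \<sigma> by (auto simp: power_mult_distrib)
      moreover have "0 \<le> l - N" "0 \<le> level (label2 k) - N"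
        using l basis2_level[OF N k(1)] by (auto simp: Nats_altdef2)
      ultimately have "l - N = level (label2 k) - N" by (rule power2_eq_imp_eq)
      then show ?thesis by simp
    qed
    have "\<psi> k = (\<Sum>m\<in>Ms. scale (\<psi> (Inl (l, m))) (e m)) k" for k
    proof (cases "\<exists>m\<in>Ms. label2 k = (l, m)")
      case False
      have "\<psi> k = 0"
      proof (rule ccontr)
        assume "\<psi> k \<noteq> 0"
        then have "level (label2 k) = l" "k \<in> basis2 N"
          using lev eigenspace_dirac_support[OF N \<psi>] by auto
        moreover from this have "label2 k \<in> basis N"
          using basis_Suc_subset[OF N] by (auto simp: basis2_def)
        ultimately show False using False by (cases "label2 k") (auto simp: Ms_def)
      qed
      moreover have "e m k = 0" if "m \<in> Ms" for m
        using False that by (cases k) (auto simp: e_def eigenket_def)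
      ultimately show ?thesis unfolding sum_fun_eq by (simp add: scale_def)
    next
      case True
      then obtain m where m: "m \<in> Ms" "label2 k = (l, m)" by blast
      show ?thesis
      proof (cases k)
        case (Inl z)
        then show ?thesis using coord[OF m(1), of "\<lambda>m. \<psi> (Inl (l, m))"] m(2) by simp
      next
        case (Inr z)
        then have z: "z = (l, m)" using m(2) by simp
        have "(\<Sum>m\<in>Ms. scale (\<psi> (Inl (l, m))) (e m)) (Inr (l, m)) =
            (\<Sum>m'\<in>Ms. if m' = m then \<psi> (Inl (l, m)) * e m (Inr (l, m)) else 0)"
          unfolding sum_fun_eq by (intro sum.cong) (auto simp: scale_def e_def eigenket_def)
        then have sum: "(\<Sum>m\<in>Ms. scale (\<psi> (Inl (l, m))) (e m)) (Inr (l, m)) =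
            \<psi> (Inl (l, m)) * e m (Inr (l, m))"
          using fin m(1) by simp
        show ?thesis
        proof (cases "z \<in> basis (N + 1)")
          case False
          then have "k \<notin> basis2 N" using Inr by (simp add: basis2_def Plus_iff)
          then have "\<psi> k = 0" using eigenspace_dirac_support(1)[OF N \<psi>] by blast
          then show ?thesis using False sum unfolding Inr z by (simp add: e_def eigenket_def)
        next
          case True
          have mem: "Inr z \<in> basis2 N" "Inl z \<in> basis2 N"
            using True basis_Suc_subset[OF N] by (auto simp: basis2_def)
          have "l - (N + 1) \<in> \<nat>" using True N by (simp add: z basis_iff half_integer_plus1)
          \<comment> \<open>A label of the second summand has l >= N + 1, so the eigenvalue equation
            may be divided by l - N.\<close>
          then have "l - N \<noteq> 0" by (auto simp: Nats_altdef2)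
          have "snd (dirac N) \<psi> (Inr z) = scale (of_real (\<sigma> * (l - N))) \<psi> (Inr z)"
            using \<psi> by (simp add: eigenspace_def)
          then have "of_real (l - N) * \<psi> (Inl z) = of_real (l - N) * (of_real \<sigma> * \<psi> (Inr z))"
            using mem by (simp add: dirac_apply scale_def z mult_ac)
          then have "\<psi> (Inl z) = of_real \<sigma> * \<psi> (Inr z)"
            using \<open>l - N \<noteq> 0\<close> by (simp only: mult_cancel_left of_real_eq_0_iff) blast
          \<comment> \<open>Here \<sigma>^2 = 1 is used.\<close>
          then have "\<psi> (Inr z) = \<psi> (Inl z) * of_real \<sigma>" using \<sigma> by auto
          then show ?thesis using sum True unfolding Inr z by (simp add: e_def eigenket_def)
        qed
      qed
    qed
    then have "\<psi> = (\<Sum>m\<in>Ms. scale (\<psi> (Inl (l, m))) (e m))" by (rule ext)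
    moreover have "(\<Sum>m\<in>Ms. scale (\<psi> (Inl (l, m))) (e m)) \<in> cvec_span (e ` Ms)"
      by (intro cvec.span_sum cvec.span_scale cvec.span_base imageI)
    ultimately show "\<psi> \<in> cvec_span (e ` Ms)" by simp
  qed
  ultimately have "cvec_dim ?V = card (e ` Ms)"
    using sub by (intro cvec.dim_unique) auto
  then show ?thesis
    using card_basis_level(2)[OF N l] card_image[OF inj] by (simp add: Ms_def)
qed


section \<open>Comparison with the classical operator\<close>

text \<open>For t = sqrt (1 + a / x) >= 1 both deviations are at most t - 1: the second is (t - 1) /
  t, and t - 1 <= t^2 - 1 = a / x.\<close>

lemma sqrt_ratio_bounds:
  fixes x a :: real
  assumes "0 < x" "0 \<le> a"
  shows "\<bar>sqrt x * sqrt (x + a) / x - 1\<bar> \<le> a / x" "\<bar>x / (sqrt x * sqrt (x + a)) - 1\<bar> \<le> a / x"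
proof -
  define t where "t = sqrt ((x + a) / x)"
  have t2: "t\<^sup>2 = 1 + a / x" using assms by (simp add: t_def add_divide_distrib)
  have t1: "1 \<le> t" using assms by (simp add: t_def)
  have "sqrt x * sqrt (x + a) = x * t"
  proof -
    have "x * t = sqrt x * (sqrt x * t)" using assms by simp
    also have "sqrt x * t = sqrt (x + a)"
      unfolding t_def using assms by (simp add: real_sqrt_divide)
    finally show ?thesis by simp
  qed
  then have eqs: "sqrt x * sqrt (x + a) / x = t" "x / (sqrt x * sqrt (x + a)) = 1 / t"
    using assms by simp_all
  have b: "t - 1 \<le> a / x"
  proof -
    have "t * 1 \<le> t * t" using t1 by (intro mult_left_mono) auto
    then show ?thesis using t2 by (simp add: power2_eq_square)
  qed
  have "1 - 1 / t = (t - 1) / t" using t1 by (simp add: diff_divide_distrib)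
  also have "\<dots> \<le> t - 1" using t1 by (simp add: divide_le_eq mult_left_mono mult_le_cancel_left1)
  finally have "1 - 1 / t \<le> t - 1" .
  moreover have "1 / t \<le> 1" using t1 by simp
  ultimately show "\<bar>sqrt x * sqrt (x + a) / x - 1\<bar> \<le> a / x" "\<bar>x / (sqrt x * sqrt (x + a)) - 1\<bar> \<le> a / x"
    unfolding eqs using t1 b by simp_all
qed

text \<open>Nothing is asked at l = N, because finitely many labels do not affect compactness; for l
  - N > a / e the entries are below e.\<close>

lemma level_perturbation_compact:
  assumes a: "0 \<le> a" and w: "\<And>k. k \<in> basis2 N \<Longrightarrow> level (label2 k) > N \<Longrightarrow> \<bar>w k\<bar> \<le> a / (level (label2 k) - N)"
  shows "wshift (basis2 N) (\<lambda>k. k) w \<in> compact_ops (basis2 N)"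
proof (rule level_diagonal_compact[OF finite_basis2_below])
  fix e :: real assume e: "e > 0"
  have "\<bar>w k\<bar> \<le> e" if k: "k \<in> basis2 N" "level (label2 k) > N + a / e" for k
  proof -
    have "0 \<le> a / e" using a e by simp
    then have g: "level (label2 k) - N > a / e" "level (label2 k) > N" using k(2) by auto
    then have "a \<le> e * (level (label2 k) - N)" using e by (simp add: divide_less_eq mult.commute)
    then have "a / (level (label2 k) - N) \<le> e" using g(2) by (simp add: divide_le_eq)
    then show ?thesis using w[OF k(1) g(2)] by simp
  qed
  then show "\<exists>R. \<forall>k\<in>basis2 N. level (label2 k) > R \<longrightarrow> \<bar>w k\<bar> \<le> e" by blast
qed

definition classical_coeff :: "real \<Rightarrow> real \<Rightarrow> real" where
  "classical_coeff N l = sqrt (l - N) * sqrt (l + N + 1)"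

lemma snd_classical: "snd (classical_dirac N) = wshift (basis2 N) flip (\<lambda>k. classical_coeff N (level (label2 k)))"
  by (simp add: classical_dirac_def snd_swap_op classical_coeff_def)

lemma classical_coeff_bounds:
  assumes "N > 0" "l > N"
  shows "\<bar>classical_coeff N l / (l - N) - 1\<bar> \<le> (2 * N + 1) / (l - N)"
    "\<bar>(l - N) / classical_coeff N l - 1\<bar> \<le> (2 * N + 1) / (l - N)"
    "classical_coeff N l \<noteq> 0" "classical_coeff N N = 0"
proof -
  have "l + N + 1 = (l - N) + (2 * N + 1)" by simp
  then have c: "classical_coeff N l = sqrt (l - N) * sqrt ((l - N) + (2 * N + 1))"
    by (simp only: classical_coeff_def)
  show "\<bar>classical_coeff N l / (l - N) - 1\<bar> \<le> (2 * N + 1) / (l - N)"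
    "\<bar>(l - N) / classical_coeff N l - 1\<bar> \<le> (2 * N + 1) / (l - N)"
    unfolding c using assms by (intro sqrt_ratio_bounds; simp)+
  show "classical_coeff N l \<noteq> 0" "classical_coeff N N = 0"
    using assms by (simp_all add: classical_coeff_def)
qed

text \<open>The difference equals E D_classical with E diagonal and compact, its entries (l - N) / c
  - 1 being O(1 / (l - N)), where c is the classical coefficient. So graph-bounded sequences are
  mapped by E applied to bounded ones.\<close>

lemma relatively_compact_difference:
  assumes N: "half_integer N" "N > 0"
  shows "relatively_compact (basis2 N) (classical_dirac N) (uop_diff (dirac N) (classical_dirac N))"
proof -
  let ?I = "basis2 N"
  let ?c = "classical_coeff N"
  \<comment> \<open>At l = N the quotient would be 0 / 0; the entry is set to 0 explicitly.\<close>
  define E where "E = wshift ?I (\<lambda>k. k)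
    (\<lambda>k. if level (label2 k) = N then 0 else (level (label2 k) - N) / ?c (level (label2 k)) - 1)"
  have E: "E \<in> compact_ops ?I"
    unfolding E_def using classical_coeff_bounds[OF N(2)] N(2)
    by (intro level_perturbation_compact[of "2 * N + 1"]) auto
  have lev: "level (label2 k) = N \<or> level (label2 k) > N" if "k \<in> ?I" for k
    using basis2_level[OF N that] by (auto simp: Nats_altdef2)
  have eq: "snd (dirac N) \<psi> - snd (classical_dirac N) \<psi> = E (snd (classical_dirac N) \<psi>)" for \<psi>
  proof
    fix k
    show "(snd (dirac N) \<psi> - snd (classical_dirac N) \<psi>) k = E (snd (classical_dirac N) \<psi>) k"
    proof (cases "k \<in> ?I \<and> level (label2 k) > N")
      case True
      let ?x = "level (label2 k) - N" and ?y = "\<psi> (flip k)" and ?b = "?c (level (label2 k))"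
      have r: "(?x / ?b - 1) * ?b = ?x - ?b"
        using classical_coeff_bounds(3)[OF N(2), of "level (label2 k)"] True
        by (simp add: field_simps)
      have "of_real (?x / ?b - 1) * (of_real ?b * ?y) = of_real ((?x / ?b - 1) * ?b) * ?y"
        by (simp only: of_real_mult mult.assoc)
      also have "\<dots> = of_real ?x * ?y - of_real ?b * ?y"
        unfolding r by (simp only: of_real_diff left_diff_distrib)
      finally show ?thesis
        using True by (simp add: snd_dirac snd_classical E_def wshift_def
            del: of_real_diff of_real_mult of_real_divide)
    next
      case False
      then show ?thesis
        \<comment> \<open>The fact about l = N carries the premise l > N for an l not occurring in
          it; N + 1 discharges it.\<close>
        using lev[of k] classical_coeff_bounds(4)[OF N(2), of "N + 1"]
        by (auto simp: snd_dirac snd_classical E_def wshift_def)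
    qed
  qed
  have dom: "fst (classical_dirac N) \<subseteq> fst (dirac N)"
  proof
    fix \<psi> assume "\<psi> \<in> fst (classical_dirac N)"
    then have \<psi>: "\<psi> \<in> l2 ?I" "snd (classical_dirac N) \<psi> \<in> l2 ?I"
      by (auto simp: classical_dirac_def fst_swap_op)
    \<comment> \<open>D = D_classical + E D_classical with E bounded also gives the inclusion of
      domains.\<close>
    have "snd (dirac N) \<psi> = snd (classical_dirac N) \<psi> + E (snd (classical_dirac N) \<psi>)"
      unfolding eq[symmetric] by simp
    then have "snd (dirac N) \<psi> \<in> l2 ?I"
      using \<psi>(2) bounded_opsD(1)[OF compact_ops_bounded[OF E] \<psi>(2)] l2_add(1) by metis
    then show "\<psi> \<in> fst (dirac N)" using \<psi>(1) by (simp add: dirac_def fst_swap_op)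
  qed
  show ?thesis
    unfolding relatively_compact_def
  proof (intro conjI allI impI)
    show "fst (classical_dirac N) \<subseteq> fst (uop_diff (dirac N) (classical_dirac N))"
      using dom by (simp add: uop_diff_def)
    fix u :: "nat \<Rightarrow> (lm + lm) vec" and C
    assume u: "\<forall>n. u n \<in> fst (classical_dirac N) \<and> l2norm (u n) \<le> C \<and>
      l2norm (snd (classical_dirac N) (u n)) \<le> C"
    then have "snd (classical_dirac N) (u n) \<in> l2 ?I" for n
      by (simp add: classical_dirac_def fst_swap_op)
    then obtain r where "strict_mono r" "norm_convergent ?I (\<lambda>n. E (snd (classical_dirac N) (u (r n))))"
      using compact_opsD[OF E, of "\<lambda>n. snd (classical_dirac N) (u n)" C] u by blast
    then show "\<exists>r. strict_mono r \<and>
        norm_convergent ?I (\<lambda>n. snd (uop_diff (dirac N) (classical_dirac N)) (u (r n)))"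
      by (auto simp: uop_diff_def eq)
  qed
qed

text \<open>Here the quotient is inverted and placed on the right: K has the entries c / (l - N) -
  1, where c is the classical coefficient. Both operators have maximal domain and 1 + K preserves
  l2, so the two domain conditions coincide.\<close>

lemma classical_compact_perturbation:
  assumes N: "half_integer N" "N > 0"
  shows "\<exists>K\<in>compact_ops (basis2 N).
    fst (classical_dirac N) = {\<psi> \<in> l2 (basis2 N). \<psi> + K \<psi> \<in> fst (dirac N)} \<and>
    (\<forall>\<psi>\<in>fst (classical_dirac N). snd (classical_dirac N) \<psi> = snd (dirac N) (\<psi> + K \<psi>))"
proof -
  let ?I = "basis2 N"
  define K where "K = wshift ?I (\<lambda>k. k)
    (\<lambda>k. if level (label2 k) = N then 0 else classical_coeff N (level (label2 k)) / (level (label2 k) - N) - 1)"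
  have K: "K \<in> compact_ops ?I"
    unfolding K_def using classical_coeff_bounds[OF N(2)] N(2)
    by (intro level_perturbation_compact[of "2 * N + 1"]) auto
  have eq: "snd (classical_dirac N) \<psi> = snd (dirac N) (\<psi> + K \<psi>)" for \<psi>
  proof
    fix k
    show "snd (classical_dirac N) \<psi> k = snd (dirac N) (\<psi> + K \<psi>) k"
    proof (cases "level (label2 k) = N")
      case True
      then show ?thesis
        using classical_coeff_bounds(4)[OF N(2), of "N + 1"]
        by (simp add: snd_dirac snd_classical wshift_def)
    next
      case False
      then have "complex_of_real (level (label2 k) - N) *
          (\<psi> (flip k) + of_real (classical_coeff N (level (label2 k)) / (level (label2 k) - N) - 1) * \<psi> (flip k)) =
        of_real (classical_coeff N (level (label2 k))) * \<psi> (flip k)"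
        by (simp add: field_simps)
      then show ?thesis
        using False by (simp add: snd_dirac snd_classical K_def wshift_def del: of_real_diff of_real_divide)
    qed
  qed
  have "\<psi> + K \<psi> \<in> l2 ?I" if "\<psi> \<in> l2 ?I" for \<psi>
    using that bounded_opsD(1)[OF compact_ops_bounded[OF K] that] by (rule l2_add(1))
  then have "fst (classical_dirac N) = {\<psi> \<in> l2 ?I. \<psi> + K \<psi> \<in> fst (dirac N)}"
    using eq by (auto simp: classical_dirac_def dirac_def fst_swap_op)
  then show ?thesis using K eq by blast
qed

text \<open>With x = l - N, b = N + 1/2 and X = sqrt x sqrt (x + 2b), the identity (x + b)^2 - X^2 =
  b^2 gives x + b - X = b^2 / (x + b + X) <= b^2 / x.\<close>

lemma classical_coeff_expansion:
  assumes "N > 0"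
  shows "(\<lambda>l. sqrt (l - N) * sqrt (l + N + 1) - (l - N) * (1 + (N + 1 / 2) / (l - N)))
    \<in> O[at_top](\<lambda>l. (l - N) * (1 / (l - N)\<^sup>2))"
proof (rule bigoI)
  show "\<forall>\<^sub>F l in at_top. norm (sqrt (l - N) * sqrt (l + N + 1) - (l - N) * (1 + (N + 1 / 2) / (l - N)))
      \<le> (N + 1 / 2)\<^sup>2 * norm ((l - N) * (1 / (l - N)\<^sup>2))"
    using eventually_gt_at_top[of N]
  proof eventually_elim
    case (elim l)
    define x where "x = l - N"
    define b where "b = N + 1 / 2"
    define X where "X = sqrt x * sqrt (x + 2 * b)"
    have x: "0 < x" and b: "0 < b" using elim assms by (simp_all add: x_def b_def)
    have X: "0 \<le> X" "X\<^sup>2 = x * (x + 2 * b)"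
      using x b by (simp_all add: X_def power_mult_distrib)
    have "(x + b - X) * (x + b + X) = (x + b)\<^sup>2 - X\<^sup>2" by (simp add: power2_eq_square algebra_simps)
    also have "\<dots> = b\<^sup>2" unfolding X(2) by (simp add: power2_eq_square algebra_simps)
    finally have prod: "(x + b - X) * (x + b + X) = b\<^sup>2" .
    have "\<bar>X - (x + b)\<bar> * x \<le> \<bar>X - (x + b)\<bar> * (x + b + X)"
      using b X(1) by (intro mult_left_mono) auto
    also have "\<dots> = \<bar>(x + b - X) * (x + b + X)\<bar>"
      using b X(1) x by (simp add: abs_mult abs_minus_commute)
    finally have "\<bar>X - (x + b)\<bar> \<le> b\<^sup>2 / x" using prod x by (simp add: le_divide_eq)
    moreover have "x * (1 + b / x) = x + b" using x by (simp add: distrib_left)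
    moreover have "x * (1 / x\<^sup>2) = 1 / x" using x by (simp add: power2_eq_square)
    moreover have "l + N + 1 = x + 2 * b" by (simp add: x_def b_def)
    ultimately show ?case
      using x unfolding X_def x_def[symmetric] b_def[symmetric] by simp
  qed
qed

theorem proposition3p1:
  fixes q s N :: real
  assumes "0 < q" "q < 1" "s > 0" "half_integer N" "N > 0"
  shows "unbounded_op (basis2 N) (dirac N)
    \<and> has_bounded_comms q s N (dirac N)
    \<and> order_one_mod_Kq q s N (dirac N)
    \<and> (\<forall>M. half_integer M \<longrightarrow> Kq4 q N M \<subseteq> compact_ops (basis4 N M))
    \<and> eigenvalues (dirac N) = {of_real (\<sigma> * (l - N)) | \<sigma> l. \<sigma> \<in> {1, -1} \<and> l - N \<in> \<nat>}
    \<and> (\<forall>l. \<forall>\<sigma>\<in>{1, -1}. l - N \<in> \<nat> \<longrightarrow>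
          real (cvec_dim (eigenspace (dirac N) (of_real (\<sigma> * (l - N))))) = 2 * l + 1)
    \<and> relatively_compact (basis2 N) (classical_dirac N)
          (uop_diff (dirac N) (classical_dirac N))
    \<and> (\<exists>K\<in>compact_ops (basis2 N).
          fst (classical_dirac N) = {\<psi> \<in> l2 (basis2 N). \<psi> + K \<psi> \<in> fst (dirac N)} \<and>
          (\<forall>\<psi>\<in>fst (classical_dirac N). snd (classical_dirac N) \<psi> = snd (dirac N) (\<psi> + K \<psi>)))
    \<and> (\<lambda>l. sqrt (l - N) * sqrt (l + N + 1) - (l - N) * (1 + (N + 1 / 2) / (l - N)))
          \<in> O[at_top](\<lambda>l. (l - N) * (1 / (l - N)\<^sup>2))"
  using assms unbounded_swap_op[of N "\<lambda>l. l - N"] dirac_bounded_comms[of N q s]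
    dirac_order_one[of N q s] Kq4_subset_compact[of q N] eigenvalues_dirac[of N]
    dim_eigenspace_dirac[of N] relatively_compact_difference[of N]
    classical_compact_perturbation[of N] classical_coeff_expansion[of N]
  unfolding dirac_def[symmetric] by blast

end
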